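(* Let $(\mathcal{M},\otimes,\mathbf{1},\sigma)$ be a symmetric monoidal category with equalizers which are preserved by $X\otimes(-)$ and $(-)\otimes X$, for any $X\in\mathcal{M}$. Then the category $\mathsf{Hopf}_{\mathrm{coc}}(\mathcal{M})$ is (Bourn-)protomodular. In particular, this happens when $(\mathcal{M},\otimes,\mathbf{1},\sigma)$ is an abelian symmetric monoidal category.
   Context: $\mathsf{Hopf}_{\mathrm{coc}}(\mathcal{M})$ is the category of cocommutative Hopf monoids in $\mathcal{M}$, i.e. Hopf monoids $(A,m_A,u_A,\Delta_A,\varepsilon_A,S_A)$ with $\sigma_{A,A}\Delta_A=\Delta_A$, and Hopf monoid morphisms. It is pointed (zero object $\mathbf{1}$) and finitely complete under the hypotheses; for a pointed finitely complete category, (Bourn-)protomodularity is equivalent to the validity of the Split Short Five Lemma. An abelian symmetric monoidal category is a symmetric monoidal category whose underlying category is abelian and such that $M\otimes(-)$ and $(-)\otimes M$ are additive and exact for every object $M$. *)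

theory Defs
  imports "HOL-Algebra.Group"
begin

section \<open>Categories\<close>

text \<open>
  An arrow is always considered together with a source and a target, through membership in
  \<open>Hom C A B\<close>; the hom-sets of different pairs of objects are allowed to overlap.
  This lets a category of structured objects use the arrows of the underlying category as
  they are. The values of \<open>Comp\<close> and \<open>Id\<close> are only relevant on composable arrows and on objects.
\<close>

record ('o, 'm) cat =
  Ob :: "'o set"
  Hom :: "'o \<Rightarrow> 'o \<Rightarrow> 'm set"
  Comp :: "'m \<Rightarrow> 'm \<Rightarrow> 'm"  (infixr "\<cdot>\<index>" 70)
  Id :: "'o \<Rightarrow> 'm"

locale category =
  fixes C :: "('o, 'm, 'z) cat_scheme" (structure)
  assumes Id_in_Hom: "A \<in> Ob C \<Longrightarrow> Id C A \<in> Hom C A A"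
    and Comp_in_Hom:
      "\<lbrakk>A \<in> Ob C; B \<in> Ob C; D \<in> Ob C; f \<in> Hom C A B; g \<in> Hom C B D\<rbrakk> \<Longrightarrow> g \<cdot> f \<in> Hom C A D"
    and Comp_Id: "\<lbrakk>A \<in> Ob C; B \<in> Ob C; f \<in> Hom C A B\<rbrakk> \<Longrightarrow> f \<cdot> Id C A = f"
    and Id_Comp: "\<lbrakk>A \<in> Ob C; B \<in> Ob C; f \<in> Hom C A B\<rbrakk> \<Longrightarrow> Id C B \<cdot> f = f"
    and Comp_assoc:
      "\<lbrakk>A \<in> Ob C; B \<in> Ob C; D \<in> Ob C; E \<in> Ob C;
        f \<in> Hom C A B; g \<in> Hom C B D; h \<in> Hom C D E\<rbrakk> \<Longrightarrow> (h \<cdot> g) \<cdot> f = h \<cdot> (g \<cdot> f)"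

definition inverse_arrows :: "('o, 'm, 'z) cat_scheme \<Rightarrow> 'o \<Rightarrow> 'o \<Rightarrow> 'm \<Rightarrow> 'm \<Rightarrow> bool" where
  "inverse_arrows C A B f g \<longleftrightarrow>
     f \<in> Hom C A B \<and> g \<in> Hom C B A \<and> g \<cdot>\<^bsub>C\<^esub> f = Id C A \<and> f \<cdot>\<^bsub>C\<^esub> g = Id C B"

definition is_iso :: "('o, 'm, 'z) cat_scheme \<Rightarrow> 'o \<Rightarrow> 'o \<Rightarrow> 'm \<Rightarrow> bool" where
  "is_iso C A B f \<longleftrightarrow> (\<exists>g. inverse_arrows C A B f g)"

definition inv_arrow :: "('o, 'm, 'z) cat_scheme \<Rightarrow> 'o \<Rightarrow> 'o \<Rightarrow> 'm \<Rightarrow> 'm" where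
  "inv_arrow C A B f = (THE g. inverse_arrows C A B f g)"

definition is_mono :: "('o, 'm, 'z) cat_scheme \<Rightarrow> 'o \<Rightarrow> 'o \<Rightarrow> 'm \<Rightarrow> bool" where
  "is_mono C A B f \<longleftrightarrow> f \<in> Hom C A B \<and>
     (\<forall>X\<in>Ob C. \<forall>u\<in>Hom C X A. \<forall>v\<in>Hom C X A. f \<cdot>\<^bsub>C\<^esub> u = f \<cdot>\<^bsub>C\<^esub> v \<longrightarrow> u = v)"

definition is_epi :: "('o, 'm, 'z) cat_scheme \<Rightarrow> 'o \<Rightarrow> 'o \<Rightarrow> 'm \<Rightarrow> bool" where
  "is_epi C A B f \<longleftrightarrow> f \<in> Hom C A B \<and>
     (\<forall>X\<in>Ob C. \<forall>u\<in>Hom C B X. \<forall>v\<in>Hom C B X. u \<cdot>\<^bsub>C\<^esub> f = v \<cdot>\<^bsub>C\<^esub> f \<longrightarrow> u = v)"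

definition is_functor ::
  "('o, 'm, 'z) cat_scheme \<Rightarrow> ('p, 'n, 'y) cat_scheme \<Rightarrow> ('o \<Rightarrow> 'p) \<Rightarrow> ('m \<Rightarrow> 'n) \<Rightarrow> bool" where
  "is_functor C D Fo Fa \<longleftrightarrow>
     (\<forall>A\<in>Ob C. Fo A \<in> Ob D \<and> Fa (Id C A) = Id D (Fo A)) \<and>
     (\<forall>A\<in>Ob C. \<forall>B\<in>Ob C. \<forall>f\<in>Hom C A B. Fa f \<in> Hom D (Fo A) (Fo B)) \<and>
     (\<forall>A\<in>Ob C. \<forall>B\<in>Ob C. \<forall>E\<in>Ob C. \<forall>f\<in>Hom C A B. \<forall>g\<in>Hom C B E.
        Fa (g \<cdot>\<^bsub>C\<^esub> f) = Fa g \<cdot>\<^bsub>D\<^esub> Fa f)"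


section \<open>Limits\<close>

definition is_equalizer ::
  "('o, 'm, 'z) cat_scheme \<Rightarrow> 'o \<Rightarrow> 'o \<Rightarrow> 'm \<Rightarrow> 'm \<Rightarrow> 'o \<Rightarrow> 'm \<Rightarrow> bool" where
  "is_equalizer C A B f g E e \<longleftrightarrow>
     E \<in> Ob C \<and> e \<in> Hom C E A \<and> f \<cdot>\<^bsub>C\<^esub> e = g \<cdot>\<^bsub>C\<^esub> e \<and>
     (\<forall>X\<in>Ob C. \<forall>u\<in>Hom C X A. f \<cdot>\<^bsub>C\<^esub> u = g \<cdot>\<^bsub>C\<^esub> u \<longrightarrow> (\<exists>!v. v \<in> Hom C X E \<and> e \<cdot>\<^bsub>C\<^esub> v = u))"

definition has_equalizers :: "('o, 'm, 'z) cat_scheme \<Rightarrow> bool" where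
  "has_equalizers C \<longleftrightarrow>
     (\<forall>A\<in>Ob C. \<forall>B\<in>Ob C. \<forall>f\<in>Hom C A B. \<forall>g\<in>Hom C A B. \<exists>E e. is_equalizer C A B f g E e)"

definition preserves_equalizers ::
  "('o, 'm, 'z) cat_scheme \<Rightarrow> ('p, 'n, 'y) cat_scheme \<Rightarrow> ('o \<Rightarrow> 'p) \<Rightarrow> ('m \<Rightarrow> 'n) \<Rightarrow> bool" where
  "preserves_equalizers C D Fo Fa \<longleftrightarrow>
     (\<forall>A\<in>Ob C. \<forall>B\<in>Ob C. \<forall>f\<in>Hom C A B. \<forall>g\<in>Hom C A B. \<forall>E e.
        is_equalizer C A B f g E e \<longrightarrow>
        is_equalizer D (Fo A) (Fo B) (Fa f) (Fa g) (Fo E) (Fa e))"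

text \<open>\<open>p : A \<rightarrow> B\<close> is pulled back along \<open>h : E \<rightarrow> B\<close>, with projections
  \<open>r : P \<rightarrow> E\<close> and \<open>q : P \<rightarrow> A\<close>.\<close>

definition is_pullback ::
  "('o, 'm, 'z) cat_scheme \<Rightarrow> 'o \<Rightarrow> 'o \<Rightarrow> 'o \<Rightarrow> 'm \<Rightarrow> 'm \<Rightarrow> 'o \<Rightarrow> 'm \<Rightarrow> 'm \<Rightarrow> bool" where
  "is_pullback C E A B h p P r q \<longleftrightarrow>
     P \<in> Ob C \<and> r \<in> Hom C P E \<and> q \<in> Hom C P A \<and> h \<cdot>\<^bsub>C\<^esub> r = p \<cdot>\<^bsub>C\<^esub> q \<and>
     (\<forall>X\<in>Ob C. \<forall>u\<in>Hom C X E. \<forall>v\<in>Hom C X A. h \<cdot>\<^bsub>C\<^esub> u = p \<cdot>\<^bsub>C\<^esub> v \<longrightarrow>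
        (\<exists>!w. w \<in> Hom C X P \<and> r \<cdot>\<^bsub>C\<^esub> w = u \<and> q \<cdot>\<^bsub>C\<^esub> w = v))"

definition is_cone ::
  "('j, 'k, 'y) cat_scheme \<Rightarrow> ('o, 'm, 'z) cat_scheme \<Rightarrow> ('j \<Rightarrow> 'o) \<Rightarrow> ('k \<Rightarrow> 'm) \<Rightarrow>
   'o \<Rightarrow> ('j \<Rightarrow> 'm) \<Rightarrow> bool" where
  "is_cone J C Do Da L \<pi> \<longleftrightarrow>
     L \<in> Ob C \<and> (\<forall>i\<in>Ob J. \<pi> i \<in> Hom C L (Do i)) \<and>
     (\<forall>i\<in>Ob J. \<forall>j\<in>Ob J. \<forall>a\<in>Hom J i j. Da a \<cdot>\<^bsub>C\<^esub> \<pi> i = \<pi> j)"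

definition is_limit ::
  "('j, 'k, 'y) cat_scheme \<Rightarrow> ('o, 'm, 'z) cat_scheme \<Rightarrow> ('j \<Rightarrow> 'o) \<Rightarrow> ('k \<Rightarrow> 'm) \<Rightarrow>
   'o \<Rightarrow> ('j \<Rightarrow> 'm) \<Rightarrow> bool" where
  "is_limit J C Do Da L \<pi> \<longleftrightarrow>
     is_cone J C Do Da L \<pi> \<and>
     (\<forall>X \<phi>. is_cone J C Do Da X \<phi> \<longrightarrow>
        (\<exists>!t. t \<in> Hom C X L \<and> (\<forall>i\<in>Ob J. \<pi> i \<cdot>\<^bsub>C\<^esub> t = \<phi> i)))"

definition finite_category :: "('j, 'k, 'y) cat_scheme \<Rightarrow> bool" where
  "finite_category J \<longleftrightarrow>
     category J \<and> finite (Ob J) \<and> (\<forall>i\<in>Ob J. \<forall>j\<in>Ob J. finite (Hom J i j))"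

text \<open>Every finite category is isomorphic to one whose objects and arrows are natural numbers
  and whose hom-sets are disjoint, so no generality is lost in the choice of types for \<open>J\<close>.\<close>

definition finitely_complete :: "('o, 'm, 'z) cat_scheme \<Rightarrow> bool" where
  "finitely_complete C \<longleftrightarrow> category C \<and>
     (\<forall>(J :: (nat, nat) cat) Do Da. finite_category J \<and> is_functor J C Do Da \<longrightarrow>
        (\<exists>L \<pi>. is_limit J C Do Da L \<pi>))"


section \<open>Points and protomodularity\<close>

text \<open>The category of points over \<open>B\<close>: split epimorphisms with codomain \<open>B\<close> and a chosen section.\<close>

definition pts :: "('o, 'm, 'z) cat_scheme \<Rightarrow> 'o \<Rightarrow> ('o \<times> 'm \<times> 'm, 'm) cat" where
  "pts C B =
     \<lparr>Ob = {(A, p, s). A \<in> Ob C \<and> p \<in> Hom C A B \<and> s \<in> Hom C B A \<and> p \<cdot>\<^bsub>C\<^esub> s = Id C B},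
      Hom = (\<lambda>(A, p, s) (A', p', s').
               {f \<in> Hom C A A'. p' \<cdot>\<^bsub>C\<^esub> f = p \<and> f \<cdot>\<^bsub>C\<^esub> s = s'}),
      Comp = Comp C,
      Id = (\<lambda>(A, p, s). Id C A)\<rparr>"

text \<open>
  The change-of-base functor \<open>h\<^sup>*\<close> along \<open>h : E \<rightarrow> B\<close> depends on a choice of pullbacks, so it is
  given as a relation. On objects, \<open>x'\<close> is a value of \<open>h\<^sup>*\<close> at the point \<open>x\<close>, with \<open>q\<close> the
  projection to the domain of \<open>x\<close>; the section of \<open>x'\<close> is the one induced by that of \<open>x\<close>.
  On arrows, \<open>f'\<close> is the unique arrow induced by \<open>f\<close> between the chosen pullbacks.
\<close>

definition change_of_base_ob ::
  "('o, 'm, 'z) cat_scheme \<Rightarrow> 'o \<Rightarrow> 'o \<Rightarrow> 'm \<Rightarrow> 'o \<times> 'm \<times> 'm \<Rightarrow> 'o \<times> 'm \<times> 'm \<Rightarrow> 'm \<Rightarrow> bool" where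
  "change_of_base_ob C E B h x x' q \<longleftrightarrow>
     x \<in> Ob (pts C B) \<and> x' \<in> Ob (pts C E) \<and>
     (case (x, x') of ((A, p, s), (P, r, t)) \<Rightarrow>
        is_pullback C E A B h p P r q \<and> q \<cdot>\<^bsub>C\<^esub> t = s \<cdot>\<^bsub>C\<^esub> h)"

definition change_of_base_arr ::
  "('o, 'm, 'z) cat_scheme \<Rightarrow> 'o \<Rightarrow> 'o \<Rightarrow> 'm \<Rightarrow>
   'o \<times> 'm \<times> 'm \<Rightarrow> 'o \<times> 'm \<times> 'm \<Rightarrow> 'm \<Rightarrow>
   'o \<times> 'm \<times> 'm \<Rightarrow> 'o \<times> 'm \<times> 'm \<Rightarrow> 'm \<Rightarrow> 'm \<Rightarrow> 'm \<Rightarrow> bool" where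
  "change_of_base_arr C E B h x x' q y y' q' f f' \<longleftrightarrow>
     change_of_base_ob C E B h x x' q \<and> change_of_base_ob C E B h y y' q' \<and>
     f \<in> Hom (pts C B) x y \<and> f' \<in> Hom (pts C E) x' y' \<and> q' \<cdot>\<^bsub>C\<^esub> f' = f \<cdot>\<^bsub>C\<^esub> q"

definition change_of_base_reflects_isos ::
  "('o, 'm, 'z) cat_scheme \<Rightarrow> 'o \<Rightarrow> 'o \<Rightarrow> 'm \<Rightarrow> bool" where
  "change_of_base_reflects_isos C E B h \<longleftrightarrow>
     (\<forall>x x' q y y' q' f f'. change_of_base_arr C E B h x x' q y y' q' f f' \<longrightarrow>
        is_iso (pts C E) x' y' f' \<longrightarrow> is_iso (pts C B) x y f)"

text \<open>Protomodularity in the sense of Bourn: all change-of-base functors of the fibration of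
  points are conservative.\<close>

definition protomodular :: "('o, 'm, 'z) cat_scheme \<Rightarrow> bool" where
  "protomodular C \<longleftrightarrow> finitely_complete C \<and>
     (\<forall>E\<in>Ob C. \<forall>B\<in>Ob C. \<forall>h\<in>Hom C E B. change_of_base_reflects_isos C E B h)"


section \<open>Symmetric monoidal categories\<close>

record ('o, 'm) moncat = "('o, 'm) cat" +
  tensor_ob :: "'o \<Rightarrow> 'o \<Rightarrow> 'o"  (infixr "\<otimes>\<^sub>o\<index>" 75)
  tensor_arr :: "'m \<Rightarrow> 'm \<Rightarrow> 'm"  (infixr "\<otimes>\<^sub>a\<index>" 75)
  unit_ob :: "'o"  ("\<I>\<index>")
  assoc :: "'o \<Rightarrow> 'o \<Rightarrow> 'o \<Rightarrow> 'm"  ("\<alpha>\<index>")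
  lunit :: "'o \<Rightarrow> 'm"  ("\<l>\<index>")
  runit :: "'o \<Rightarrow> 'm"  ("\<r>\<index>")
  braid :: "'o \<Rightarrow> 'o \<Rightarrow> 'm"  ("\<sigma>\<index>")

locale symmetric_monoidal_category = category M
  for M :: "('o, 'm, 'z) moncat_scheme" (structure) +
  assumes tensor_ob: "\<lbrakk>A \<in> Ob M; B \<in> Ob M\<rbrakk> \<Longrightarrow> A \<otimes>\<^sub>o B \<in> Ob M"
    and unit_ob: "\<I> \<in> Ob M"
    and tensor_arr:
      "\<lbrakk>A \<in> Ob M; B \<in> Ob M; A' \<in> Ob M; B' \<in> Ob M; f \<in> Hom M A A'; g \<in> Hom M B B'\<rbrakk>
       \<Longrightarrow> f \<otimes>\<^sub>a g \<in> Hom M (A \<otimes>\<^sub>o B) (A' \<otimes>\<^sub>o B')"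
    and tensor_Id: "\<lbrakk>A \<in> Ob M; B \<in> Ob M\<rbrakk> \<Longrightarrow> Id M A \<otimes>\<^sub>a Id M B = Id M (A \<otimes>\<^sub>o B)"
    and tensor_Comp:
      "\<lbrakk>A \<in> Ob M; B \<in> Ob M; A' \<in> Ob M; B' \<in> Ob M; A'' \<in> Ob M; B'' \<in> Ob M;
        f \<in> Hom M A A'; g \<in> Hom M B B'; f' \<in> Hom M A' A''; g' \<in> Hom M B' B''\<rbrakk>
       \<Longrightarrow> (f' \<cdot> f) \<otimes>\<^sub>a (g' \<cdot> g) = (f' \<otimes>\<^sub>a g') \<cdot> (f \<otimes>\<^sub>a g)"
    and assoc_iso:
      "\<lbrakk>A \<in> Ob M; B \<in> Ob M; D \<in> Ob M\<rbrakk>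
       \<Longrightarrow> is_iso M ((A \<otimes>\<^sub>o B) \<otimes>\<^sub>o D) (A \<otimes>\<^sub>o (B \<otimes>\<^sub>o D)) (\<alpha> A B D)"
    and lunit_iso: "A \<in> Ob M \<Longrightarrow> is_iso M (\<I> \<otimes>\<^sub>o A) A (\<l> A)"
    and runit_iso: "A \<in> Ob M \<Longrightarrow> is_iso M (A \<otimes>\<^sub>o \<I>) A (\<r> A)"
    and braid_in_Hom:
      "\<lbrakk>A \<in> Ob M; B \<in> Ob M\<rbrakk> \<Longrightarrow> \<sigma> A B \<in> Hom M (A \<otimes>\<^sub>o B) (B \<otimes>\<^sub>o A)"
    and assoc_natural:
      "\<lbrakk>A \<in> Ob M; B \<in> Ob M; D \<in> Ob M; A' \<in> Ob M; B' \<in> Ob M; D' \<in> Ob M;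
        f \<in> Hom M A A'; g \<in> Hom M B B'; h \<in> Hom M D D'\<rbrakk>
       \<Longrightarrow> \<alpha> A' B' D' \<cdot> ((f \<otimes>\<^sub>a g) \<otimes>\<^sub>a h) = (f \<otimes>\<^sub>a (g \<otimes>\<^sub>a h)) \<cdot> \<alpha> A B D"
    and lunit_natural:
      "\<lbrakk>A \<in> Ob M; A' \<in> Ob M; f \<in> Hom M A A'\<rbrakk> \<Longrightarrow> \<l> A' \<cdot> (Id M \<I> \<otimes>\<^sub>a f) = f \<cdot> \<l> A"
    and runit_natural:
      "\<lbrakk>A \<in> Ob M; A' \<in> Ob M; f \<in> Hom M A A'\<rbrakk> \<Longrightarrow> \<r> A' \<cdot> (f \<otimes>\<^sub>a Id M \<I>) = f \<cdot> \<r> A"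
    and braid_natural:
      "\<lbrakk>A \<in> Ob M; B \<in> Ob M; A' \<in> Ob M; B' \<in> Ob M; f \<in> Hom M A A'; g \<in> Hom M B B'\<rbrakk>
       \<Longrightarrow> \<sigma> A' B' \<cdot> (f \<otimes>\<^sub>a g) = (g \<otimes>\<^sub>a f) \<cdot> \<sigma> A B"
    and pentagon:
      "\<lbrakk>A \<in> Ob M; B \<in> Ob M; D \<in> Ob M; E \<in> Ob M\<rbrakk>
       \<Longrightarrow> (Id M A \<otimes>\<^sub>a \<alpha> B D E) \<cdot> \<alpha> A (B \<otimes>\<^sub>o D) E \<cdot> (\<alpha> A B D \<otimes>\<^sub>a Id M E)
           = \<alpha> A B (D \<otimes>\<^sub>o E) \<cdot> \<alpha> (A \<otimes>\<^sub>o B) D E"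
    and triangle:
      "\<lbrakk>A \<in> Ob M; B \<in> Ob M\<rbrakk> \<Longrightarrow> (Id M A \<otimes>\<^sub>a \<l> B) \<cdot> \<alpha> A \<I> B = \<r> A \<otimes>\<^sub>a Id M B"
    and hexagon:
      "\<lbrakk>A \<in> Ob M; B \<in> Ob M; D \<in> Ob M\<rbrakk>
       \<Longrightarrow> \<alpha> B D A \<cdot> \<sigma> A (B \<otimes>\<^sub>o D) \<cdot> \<alpha> A B D
           = (Id M B \<otimes>\<^sub>a \<sigma> A D) \<cdot> \<alpha> B A D \<cdot> (\<sigma> A B \<otimes>\<^sub>a Id M D)"
    and symmetry:
      "\<lbrakk>A \<in> Ob M; B \<in> Ob M\<rbrakk> \<Longrightarrow> \<sigma> B A \<cdot> \<sigma> A B = Id M (A \<otimes>\<^sub>o B)"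

definition tensor_preserves_equalizers :: "('o, 'm, 'z) moncat_scheme \<Rightarrow> bool" where
  "tensor_preserves_equalizers M \<longleftrightarrow>
     (\<forall>X\<in>Ob M.
        preserves_equalizers M M (\<lambda>A. X \<otimes>\<^sub>o\<^bsub>M\<^esub> A) (\<lambda>f. Id M X \<otimes>\<^sub>a\<^bsub>M\<^esub> f) \<and>
        preserves_equalizers M M (\<lambda>A. A \<otimes>\<^sub>o\<^bsub>M\<^esub> X) (\<lambda>f. f \<otimes>\<^sub>a\<^bsub>M\<^esub> Id M X))"


section \<open>Cocommutative Hopf monoids\<close>

text \<open>The canonical isomorphism \<open>(A \<otimes> B) \<otimes> (D \<otimes> E) \<rightarrow> (A \<otimes> D) \<otimes> (B \<otimes> E)\<close> exchanging
  the two middle factors.\<close>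

definition middle_swap :: "('o, 'm, 'z) moncat_scheme \<Rightarrow> 'o \<Rightarrow> 'o \<Rightarrow> 'o \<Rightarrow> 'o \<Rightarrow> 'm" where
  "middle_swap M A B D E =
     inv_arrow M ((A \<otimes>\<^sub>o\<^bsub>M\<^esub> D) \<otimes>\<^sub>o\<^bsub>M\<^esub> (B \<otimes>\<^sub>o\<^bsub>M\<^esub> E)) (A \<otimes>\<^sub>o\<^bsub>M\<^esub> (D \<otimes>\<^sub>o\<^bsub>M\<^esub> (B \<otimes>\<^sub>o\<^bsub>M\<^esub> E)))
       (\<alpha>\<^bsub>M\<^esub> A D (B \<otimes>\<^sub>o\<^bsub>M\<^esub> E))
     \<cdot>\<^bsub>M\<^esub> (Id M A \<otimes>\<^sub>a\<^bsub>M\<^esub> \<alpha>\<^bsub>M\<^esub> D B E)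
     \<cdot>\<^bsub>M\<^esub> (Id M A \<otimes>\<^sub>a\<^bsub>M\<^esub> (\<sigma>\<^bsub>M\<^esub> B D \<otimes>\<^sub>a\<^bsub>M\<^esub> Id M E))
     \<cdot>\<^bsub>M\<^esub> (Id M A \<otimes>\<^sub>a\<^bsub>M\<^esub>
            inv_arrow M ((B \<otimes>\<^sub>o\<^bsub>M\<^esub> D) \<otimes>\<^sub>o\<^bsub>M\<^esub> E) (B \<otimes>\<^sub>o\<^bsub>M\<^esub> (D \<otimes>\<^sub>o\<^bsub>M\<^esub> E)) (\<alpha>\<^bsub>M\<^esub> B D E))
     \<cdot>\<^bsub>M\<^esub> \<alpha>\<^bsub>M\<^esub> A B (D \<otimes>\<^sub>o\<^bsub>M\<^esub> E)"

record ('o, 'm) hopf_data =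
  carr :: "'o"
  mul :: "'m"
  unt :: "'m"
  comul :: "'m"
  counit :: "'m"
  antipode :: "'m"

locale monoid_object = symmetric_monoidal_category M
  for M :: "('o, 'm, 'z) moncat_scheme" (structure) and A :: 'o and m u :: 'm +
  assumes carr_ob: "A \<in> Ob M"
    and mul_in_Hom: "m \<in> Hom M (A \<otimes>\<^sub>o A) A"
    and unt_in_Hom: "u \<in> Hom M \<I> A"
    and mul_assoc: "m \<cdot> (m \<otimes>\<^sub>a Id M A) = m \<cdot> (Id M A \<otimes>\<^sub>a m) \<cdot> \<alpha> A A A"
    and mul_lunit: "m \<cdot> (u \<otimes>\<^sub>a Id M A) = \<l> A"
    and mul_runit: "m \<cdot> (Id M A \<otimes>\<^sub>a u) = \<r> A"

locale comonoid_object = symmetric_monoidal_category M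
  for M :: "('o, 'm, 'z) moncat_scheme" (structure) and A :: 'o and \<Delta> \<epsilon> :: 'm +
  assumes cocarr_ob: "A \<in> Ob M"
    and comul_in_Hom: "\<Delta> \<in> Hom M A (A \<otimes>\<^sub>o A)"
    and counit_in_Hom: "\<epsilon> \<in> Hom M A \<I>"
    and comul_coassoc: "\<alpha> A A A \<cdot> (\<Delta> \<otimes>\<^sub>a Id M A) \<cdot> \<Delta> = (Id M A \<otimes>\<^sub>a \<Delta>) \<cdot> \<Delta>"
    and comul_lcounit: "\<l> A \<cdot> (\<epsilon> \<otimes>\<^sub>a Id M A) \<cdot> \<Delta> = Id M A"
    and comul_rcounit: "\<r> A \<cdot> (Id M A \<otimes>\<^sub>a \<epsilon>) \<cdot> \<Delta> = Id M A"

locale hopf_monoid =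
  monoid_object M "carr H" "mul H" "unt H" + comonoid_object M "carr H" "comul H" "counit H"
  for M :: "('o, 'm, 'z) moncat_scheme" (structure) and H :: "('o, 'm) hopf_data" +
  assumes comul_mul:
      "comul H \<cdot> mul H
       = (mul H \<otimes>\<^sub>a mul H) \<cdot> middle_swap M (carr H) (carr H) (carr H) (carr H)
           \<cdot> (comul H \<otimes>\<^sub>a comul H)"
    and comul_unt: "comul H \<cdot> unt H \<cdot> \<l> \<I> = unt H \<otimes>\<^sub>a unt H"
    and counit_mul: "counit H \<cdot> mul H = \<l> \<I> \<cdot> (counit H \<otimes>\<^sub>a counit H)"
    and counit_unt: "counit H \<cdot> unt H = Id M \<I>"
    and antipode_in_Hom: "antipode H \<in> Hom M (carr H) (carr H)"
    and antipode_left: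
      "mul H \<cdot> (antipode H \<otimes>\<^sub>a Id M (carr H)) \<cdot> comul H = unt H \<cdot> counit H"
    and antipode_right:
      "mul H \<cdot> (Id M (carr H) \<otimes>\<^sub>a antipode H) \<cdot> comul H = unt H \<cdot> counit H"

definition cocommutative :: "('o, 'm, 'z) moncat_scheme \<Rightarrow> ('o, 'm) hopf_data \<Rightarrow> bool" where
  "cocommutative M H \<longleftrightarrow> \<sigma>\<^bsub>M\<^esub> (carr H) (carr H) \<cdot>\<^bsub>M\<^esub> comul H = comul H"

text \<open>Morphisms of Hopf monoids are the morphisms of the underlying bimonoids; these are
  automatically compatible with the antipodes.\<close>

definition hopf_morphism ::
  "('o, 'm, 'z) moncat_scheme \<Rightarrow> ('o, 'm) hopf_data \<Rightarrow> ('o, 'm) hopf_data \<Rightarrow> 'm \<Rightarrow> bool" where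
  "hopf_morphism M H K f \<longleftrightarrow>
     f \<in> Hom M (carr H) (carr K) \<and>
     f \<cdot>\<^bsub>M\<^esub> mul H = mul K \<cdot>\<^bsub>M\<^esub> (f \<otimes>\<^sub>a\<^bsub>M\<^esub> f) \<and>
     f \<cdot>\<^bsub>M\<^esub> unt H = unt K \<and>
     comul K \<cdot>\<^bsub>M\<^esub> f = (f \<otimes>\<^sub>a\<^bsub>M\<^esub> f) \<cdot>\<^bsub>M\<^esub> comul H \<and>
     counit K \<cdot>\<^bsub>M\<^esub> f = counit H"

definition Hopf_coc ::
  "('o, 'm, 'z) moncat_scheme \<Rightarrow> (('o, 'm) hopf_data, 'm) cat" where
  "Hopf_coc M =
     \<lparr>Ob = {H. hopf_monoid M H \<and> cocommutative M H},
      Hom = (\<lambda>H K. {f. hopf_morphism M H K f}),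
      Comp = Comp M,
      Id = (\<lambda>H. Id M (carr H))\<rparr>"


section \<open>Abelian symmetric monoidal categories\<close>

text \<open>
  The additive structure on a category \<open>C\<close> is given by abelian groups \<open>G A B\<close> with carriers
  \<open>Hom C A B\<close>. Their operation, the addition of arrows, is written multiplicatively as
  \<open>f \<otimes>\<^bsub>G A B\<^esub> g\<close>, and the zero arrow is \<open>\<one>\<^bsub>G A B\<^esub>\<close>.
\<close>

locale preadditive_category = category C
  for C :: "('o, 'm, 'z) cat_scheme" (structure) and G :: "'o \<Rightarrow> 'o \<Rightarrow> 'm monoid" +
  assumes hom_group: "\<lbrakk>A \<in> Ob C; B \<in> Ob C\<rbrakk> \<Longrightarrow> comm_group (G A B)"
    and hom_group_carrier: "\<lbrakk>A \<in> Ob C; B \<in> Ob C\<rbrakk> \<Longrightarrow> carrier (G A B) = Hom C A B"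
    and Comp_additive_left:
      "\<lbrakk>A \<in> Ob C; B \<in> Ob C; D \<in> Ob C; f \<in> Hom C A B\<rbrakk> \<Longrightarrow> (\<lambda>g. g \<cdot> f) \<in> hom (G B D) (G A D)"
    and Comp_additive_right:
      "\<lbrakk>A \<in> Ob C; B \<in> Ob C; D \<in> Ob C; g \<in> Hom C B D\<rbrakk> \<Longrightarrow> (\<lambda>f. g \<cdot> f) \<in> hom (G A B) (G A D)"

definition is_zero_object :: "('o, 'm, 'z) cat_scheme \<Rightarrow> 'o \<Rightarrow> bool" where
  "is_zero_object C Z \<longleftrightarrow> Z \<in> Ob C \<and>
     (\<forall>A\<in>Ob C. (\<exists>!f. f \<in> Hom C A Z) \<and> (\<exists>!f. f \<in> Hom C Z A))"

definition is_biproduct ::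
  "('o, 'm, 'z) cat_scheme \<Rightarrow> ('o \<Rightarrow> 'o \<Rightarrow> 'm monoid) \<Rightarrow> 'o \<Rightarrow> 'o \<Rightarrow>
   'o \<Rightarrow> 'm \<Rightarrow> 'm \<Rightarrow> 'm \<Rightarrow> 'm \<Rightarrow> bool" where
  "is_biproduct C G A B P p1 p2 i1 i2 \<longleftrightarrow>
     P \<in> Ob C \<and> p1 \<in> Hom C P A \<and> p2 \<in> Hom C P B \<and> i1 \<in> Hom C A P \<and> i2 \<in> Hom C B P \<and>
     p1 \<cdot>\<^bsub>C\<^esub> i1 = Id C A \<and> p2 \<cdot>\<^bsub>C\<^esub> i2 = Id C B \<and>
     (i1 \<cdot>\<^bsub>C\<^esub> p1) \<otimes>\<^bsub>G P P\<^esub> (i2 \<cdot>\<^bsub>C\<^esub> p2) = Id C P"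

definition is_kernel ::
  "('o, 'm, 'z) cat_scheme \<Rightarrow> ('o \<Rightarrow> 'o \<Rightarrow> 'm monoid) \<Rightarrow> 'o \<Rightarrow> 'o \<Rightarrow> 'm \<Rightarrow> 'o \<Rightarrow> 'm \<Rightarrow> bool" where
  "is_kernel C G A B f K k \<longleftrightarrow>
     f \<in> Hom C A B \<and> K \<in> Ob C \<and> k \<in> Hom C K A \<and> f \<cdot>\<^bsub>C\<^esub> k = \<one>\<^bsub>G K B\<^esub> \<and>
     (\<forall>X\<in>Ob C. \<forall>u\<in>Hom C X A. f \<cdot>\<^bsub>C\<^esub> u = \<one>\<^bsub>G X B\<^esub> \<longrightarrow> (\<exists>!v. v \<in> Hom C X K \<and> k \<cdot>\<^bsub>C\<^esub> v = u))"

definition is_cokernel ::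
  "('o, 'm, 'z) cat_scheme \<Rightarrow> ('o \<Rightarrow> 'o \<Rightarrow> 'm monoid) \<Rightarrow> 'o \<Rightarrow> 'o \<Rightarrow> 'm \<Rightarrow> 'o \<Rightarrow> 'm \<Rightarrow> bool" where
  "is_cokernel C G A B f Q q \<longleftrightarrow>
     f \<in> Hom C A B \<and> Q \<in> Ob C \<and> q \<in> Hom C B Q \<and> q \<cdot>\<^bsub>C\<^esub> f = \<one>\<^bsub>G A Q\<^esub> \<and>
     (\<forall>X\<in>Ob C. \<forall>u\<in>Hom C B X. u \<cdot>\<^bsub>C\<^esub> f = \<one>\<^bsub>G A X\<^esub> \<longrightarrow> (\<exists>!v. v \<in> Hom C Q X \<and> v \<cdot>\<^bsub>C\<^esub> q = u))"

locale abelian_category = preadditive_category C G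
  for C :: "('o, 'm, 'z) cat_scheme" (structure) and G :: "'o \<Rightarrow> 'o \<Rightarrow> 'm monoid" +
  assumes zero_object: "\<exists>Z. is_zero_object C Z"
    and biproducts:
      "\<lbrakk>A \<in> Ob C; B \<in> Ob C\<rbrakk> \<Longrightarrow> \<exists>P p1 p2 i1 i2. is_biproduct C G A B P p1 p2 i1 i2"
    and kernels:
      "\<lbrakk>A \<in> Ob C; B \<in> Ob C; f \<in> Hom C A B\<rbrakk> \<Longrightarrow> \<exists>K k. is_kernel C G A B f K k"
    and cokernels:
      "\<lbrakk>A \<in> Ob C; B \<in> Ob C; f \<in> Hom C A B\<rbrakk> \<Longrightarrow> \<exists>Q q. is_cokernel C G A B f Q q"
    and mono_normal:
      "\<lbrakk>A \<in> Ob C; B \<in> Ob C; is_mono C A B f\<rbrakk> \<Longrightarrow> \<exists>D\<in>Ob C. \<exists>g. is_kernel C G B D g A f"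
    and epi_normal:
      "\<lbrakk>A \<in> Ob C; B \<in> Ob C; is_epi C A B f\<rbrakk> \<Longrightarrow> \<exists>D\<in>Ob C. \<exists>g. is_cokernel C G D A g B f"

definition short_exact ::
  "('o, 'm, 'z) cat_scheme \<Rightarrow> ('o \<Rightarrow> 'o \<Rightarrow> 'm monoid) \<Rightarrow> 'o \<Rightarrow> 'o \<Rightarrow> 'o \<Rightarrow> 'm \<Rightarrow> 'm \<Rightarrow> bool" where
  "short_exact C G A B D f g \<longleftrightarrow> is_kernel C G B D g A f \<and> is_cokernel C G A B f D g"

definition additive_functor ::
  "('o, 'm, 'z) cat_scheme \<Rightarrow> ('o \<Rightarrow> 'o \<Rightarrow> 'm monoid) \<Rightarrow>
   ('p, 'n, 'y) cat_scheme \<Rightarrow> ('p \<Rightarrow> 'p \<Rightarrow> 'n monoid) \<Rightarrow> ('o \<Rightarrow> 'p) \<Rightarrow> ('m \<Rightarrow> 'n) \<Rightarrow> bool" where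
  "additive_functor C G D G' Fo Fa \<longleftrightarrow> is_functor C D Fo Fa \<and>
     (\<forall>A\<in>Ob C. \<forall>B\<in>Ob C. Fa \<in> hom (G A B) (G' (Fo A) (Fo B)))"

definition exact_functor ::
  "('o, 'm, 'z) cat_scheme \<Rightarrow> ('o \<Rightarrow> 'o \<Rightarrow> 'm monoid) \<Rightarrow>
   ('p, 'n, 'y) cat_scheme \<Rightarrow> ('p \<Rightarrow> 'p \<Rightarrow> 'n monoid) \<Rightarrow> ('o \<Rightarrow> 'p) \<Rightarrow> ('m \<Rightarrow> 'n) \<Rightarrow> bool" where
  "exact_functor C G D G' Fo Fa \<longleftrightarrow> is_functor C D Fo Fa \<and>
     (\<forall>X\<in>Ob C. \<forall>Y\<in>Ob C. \<forall>Z\<in>Ob C. \<forall>f g. short_exact C G X Y Z f g \<longrightarrow>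
        short_exact D G' (Fo X) (Fo Y) (Fo Z) (Fa f) (Fa g))"

locale abelian_symmetric_monoidal_category =
  symmetric_monoidal_category M + abelian_category M G
  for M :: "('o, 'm, 'z) moncat_scheme" (structure) and G :: "'o \<Rightarrow> 'o \<Rightarrow> 'm monoid" +
  assumes ltensor_additive:
      "X \<in> Ob M \<Longrightarrow> additive_functor M G M G (\<lambda>A. X \<otimes>\<^sub>o A) (\<lambda>f. Id M X \<otimes>\<^sub>a f)"
    and rtensor_additive:
      "X \<in> Ob M \<Longrightarrow> additive_functor M G M G (\<lambda>A. A \<otimes>\<^sub>o X) (\<lambda>f. f \<otimes>\<^sub>a Id M X)"
    and ltensor_exact:
      "X \<in> Ob M \<Longrightarrow> exact_functor M G M G (\<lambda>A. X \<otimes>\<^sub>o A) (\<lambda>f. Id M X \<otimes>\<^sub>a f)"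
    and rtensor_exact:
      "X \<in> Ob M \<Longrightarrow> exact_functor M G M G (\<lambda>A. A \<otimes>\<^sub>o X) (\<lambda>f. f \<otimes>\<^sub>a Id M X)"

end

theory Submission
  imports Defs
begin

text \<open>
  By cocommutativity the tensor product of two cocommutative comonoids is their product, so
  cocommutative Hopf monoids are the group objects in the category of cocommutative comonoids.
  That category has equalizers, computed in \<open>M\<close> because the tensor product preserves them, hence
  finite limits; a limit of underlying comonoids of group objects is again a group object, with the
  pointwise operations on generalised elements \<open>X \<rightarrow> L\<close>. Protomodularity then reduces, by Yoneda, to the
  split short five lemma for the groups of generalised elements: kernels computed in comonoids
  are tested against every \<open>X\<close>, and they factor through any pullback along a base change.
  In the abelian case an equalizer is a kernel, and an exact functor preserves the kernel of
  \<open>d = m \<cdot> q\<close> (\<open>q\<close> the coimage, \<open>m\<close> a monomorphism, hence a kernel) because it preserves the two short exact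
  sequences through \<open>q\<close> and \<open>m\<close>.
\<close>

section \<open>Arrows between formal tensor words\<close>

text \<open>Three obstacles shape the argument. The universal property of a pullback in
  \<open>Hopf_coc M\<close> is tested by Hopf monoids only, while generalised elements start at
  arbitrary cocommutative comonoids X. An element of a kernel is therefore factored as X -> K -> A
  through the kernel, which is itself a group object; the pullback is applied to K, paired with the
  trivial morphism from K to E, and the result is restricted along X -> K. This treats every base
  change E -> B at once. Next, the antipode of a Hopf monoid is given merely as an arrow of M.
  Inverting generalised elements, or building the antipode of a limit, requires it to be a comonoid
  morphism, and this has to be derived from cocommutativity. Finally, M is not strict, and the
  tensor product of comonoids already involves the middle exchange with its associators, so a
  coherence argument comes before any comonoid. Arrows of M do not determine their ends and
  different tensor words may have the same value, which is why the ends are recorded as formal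
  words.\<close>

text \<open>Sources and targets are formal tensor words, so that the tensor product of objects is injective,
  and \<open>Null\<close> is an absorbing undefined arrow. With the composition \<open>\<bullet>\<close> and the tensor \<open>\<star>\<close> below,
  associativity and interchange hold without side conditions, so that they can be used by the simplifier.\<close>

datatype 'o tree = Leaf 'o | Unit | Node "'o tree" "'o tree" (infixr "\<diamondop>" 75)

datatype ('o, 'm) tarr = Null | Arr (src: "'o tree") (raw: 'm) (tgt: "'o tree")

text \<open>A two-sided inverse is unique, so the definite description in \<open>inv_arrow\<close>
  denotes it.\<close>

lemma (in category) inverse_arrows_inv_arrow:
  assumes "A \<in> Ob C" "B \<in> Ob C" "is_iso C A B f"
  shows "inverse_arrows C A B f (inv_arrow C A B f)"
proof -
  obtain g where g: "inverse_arrows C A B f g"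
    using assms by (auto simp: is_iso_def)
  have "g' = g" if g': "inverse_arrows C A B f g'" for g'
  proof -
    have "g' = g' \<cdot> (f \<cdot> g)"
      using Comp_Id[of B A g'] assms g g' unfolding inverse_arrows_def by auto
    also have "\<dots> = (g' \<cdot> f) \<cdot> g"
      using Comp_assoc[of B A B A g f g'] assms g g' unfolding inverse_arrows_def by auto
    also have "\<dots> = g"
      using Id_Comp[of B A g] assms g g' unfolding inverse_arrows_def by auto
    finally show ?thesis .
  qed
  with g have "\<exists>!g. inverse_arrows C A B f g" by blast
  then show ?thesis
    unfolding inv_arrow_def by (rule theI')
qed

context symmetric_monoidal_category
begin

primrec tob :: "'o tree \<Rightarrow> 'o" where
  "tob (Leaf A) = A"
| "tob Unit = \<I>"
| "tob (a \<diamondop> b) = tob a \<otimes>\<^sub>o tob b"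

primrec wf_tree :: "'o tree \<Rightarrow> bool" where
  "wf_tree (Leaf A) \<longleftrightarrow> A \<in> Ob M"
| "wf_tree Unit \<longleftrightarrow> True"
| "wf_tree (a \<diamondop> b) \<longleftrightarrow> wf_tree a \<and> wf_tree b"

lemma tob_Ob [simp]: "wf_tree t \<Longrightarrow> tob t \<in> Ob M"
  by (induction t) (auto simp: unit_ob tensor_ob)

definition arr :: "('o, 'm) tarr \<Rightarrow> bool" where
  "arr x \<longleftrightarrow> (case x of Null \<Rightarrow> False
     | Arr s f t \<Rightarrow> wf_tree s \<and> wf_tree t \<and> f \<in> Hom M (tob s) (tob t))"

lemma arr_Arr: "arr (Arr s f t) \<longleftrightarrow> wf_tree s \<and> wf_tree t \<and> f \<in> Hom M (tob s) (tob t)"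
  and arr_Null [simp]: "\<not> arr Null"
  by (auto simp: arr_def)

lemma arrE:
  assumes "arr x"
  obtains s f t where "x = Arr s f t" "wf_tree s" "wf_tree t" "f \<in> Hom M (tob s) (tob t)"
  using assms by (auto simp: arr_def split: tarr.splits)

lemma arr_wf [simp]: "arr x \<Longrightarrow> wf_tree (src x)" "arr x \<Longrightarrow> wf_tree (tgt x)"
  and arr_raw: "arr x \<Longrightarrow> raw x \<in> Hom M (tob (src x)) (tob (tgt x))"
  by (auto elim!: arrE)

lemma arr_eqI:
  "\<lbrakk>arr x; arr y; src x = src y; tgt x = tgt y; raw x = raw y\<rbrakk> \<Longrightarrow> x = y"
  by (auto elim!: arrE)

definition tcomp :: "('o, 'm) tarr \<Rightarrow> ('o, 'm) tarr \<Rightarrow> ('o, 'm) tarr" (infixr "\<bullet>" 70) where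
  "x \<bullet> y = (if arr x \<and> arr y \<and> src x = tgt y then Arr (src y) (raw x \<cdot> raw y) (tgt x) else Null)"

definition tens :: "('o, 'm) tarr \<Rightarrow> ('o, 'm) tarr \<Rightarrow> ('o, 'm) tarr" (infixr "\<star>" 75) where
  "x \<star> y = (if arr x \<and> arr y
     then Arr (src x \<diamondop> src y) (raw x \<otimes>\<^sub>a raw y) (tgt x \<diamondop> tgt y) else Null)"

definition idt :: "'o tree \<Rightarrow> ('o, 'm) tarr" where
  "idt t = Arr t (Id M (tob t)) t"

lemma arr_comp [simp]: "arr (x \<bullet> y) \<longleftrightarrow> arr x \<and> arr y \<and> src x = tgt y"
proof -
  have "raw x \<cdot> raw y \<in> Hom M (tob (src y)) (tob (tgt x))" if "arr x" "arr y" "src x = tgt y"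
    using that arr_raw[of x] arr_raw[of y] Comp_in_Hom[of _ "tob (tgt y)"] by simp
  then show ?thesis
    by (auto simp: tcomp_def arr_Arr)
qed

lemma arr_tens [simp]: "arr (x \<star> y) \<longleftrightarrow> arr x \<and> arr y"
  by (auto simp: tens_def arr_Arr intro!: tensor_arr arr_raw)

lemma arr_idt [simp]: "arr (idt t) \<longleftrightarrow> wf_tree t"
  by (auto simp: idt_def arr_Arr Id_in_Hom)

lemma src_tgt [simp]:
  "arr (x \<bullet> y) \<Longrightarrow> src (x \<bullet> y) = src y" "arr (x \<bullet> y) \<Longrightarrow> tgt (x \<bullet> y) = tgt x"
  "arr (x \<star> y) \<Longrightarrow> src (x \<star> y) = src x \<diamondop> src y" "arr (x \<star> y) \<Longrightarrow> tgt (x \<star> y) = tgt x \<diamondop> tgt y"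
  "src (idt t) = t" "tgt (idt t) = t"
  by (auto simp: tcomp_def tens_def idt_def arr_Arr)

lemma raw_simps:
  "arr (x \<bullet> y) \<Longrightarrow> raw (x \<bullet> y) = raw x \<cdot> raw y"
  "arr (x \<star> y) \<Longrightarrow> raw (x \<star> y) = raw x \<otimes>\<^sub>a raw y"
  "raw (idt t) = Id M (tob t)"
  by (auto simp: tcomp_def tens_def idt_def arr_Arr)

lemma not_arr: "\<not> arr x \<Longrightarrow> x \<bullet> y = Null" "\<not> arr y \<Longrightarrow> x \<bullet> y = Null"
  "\<not> arr x \<Longrightarrow> x \<star> y = Null" "\<not> arr y \<Longrightarrow> x \<star> y = Null"
  "src x \<noteq> tgt y \<Longrightarrow> x \<bullet> y = Null"
  by (auto simp: tcomp_def tens_def)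

text \<open>Both bracketings are defined under the same typing conditions, and an undefined
  composite is \<open>Null\<close>; hence the equation is unconditional. The same remark gives the
  interchange law \<open>tens_comp\<close>.\<close>

lemma tcomp_assoc: "(x \<bullet> y) \<bullet> z = x \<bullet> y \<bullet> z"
proof (cases "arr x \<and> arr y \<and> arr z \<and> src x = tgt y \<and> src y = tgt z")
  case True
  then show ?thesis
    using Comp_assoc[of "tob (src z)" "tob (tgt z)" "tob (tgt y)" "tob (tgt x)" "raw z" "raw y" "raw x"]
      arr_raw[of x] arr_raw[of y] arr_raw[of z]
    by (intro arr_eqI) (auto simp: raw_simps)
next
  case False
  then have "\<not> arr ((x \<bullet> y) \<bullet> z)" "\<not> arr (x \<bullet> y \<bullet> z)" by auto
  then show ?thesis
    by (metis arr_comp not_arr)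
qed

lemma tens_comp: "(f' \<star> g') \<bullet> (f \<star> g) = (f' \<bullet> f) \<star> (g' \<bullet> g)"
proof (cases "arr f \<and> arr g \<and> arr f' \<and> arr g' \<and> src f' = tgt f \<and> src g' = tgt g")
  case True
  then show ?thesis
    using tensor_Comp[of "tob (src f)" "tob (src g)" "tob (tgt f)" "tob (tgt g)" "tob (tgt f')" "tob (tgt g')"
        "raw f" "raw g" "raw f'" "raw g'"]
      arr_raw[of f] arr_raw[of g] arr_raw[of f'] arr_raw[of g']
    by (intro arr_eqI) (auto simp: raw_simps)
next
  case False
  then have "\<not> arr ((f' \<star> g') \<bullet> (f \<star> g))" "\<not> arr ((f' \<bullet> f) \<star> (g' \<bullet> g))" by auto
  then show ?thesis
    by (metis arr_comp arr_tens not_arr)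
qed

lemma tens_comp_comp: "(f' \<star> g') \<bullet> (f \<star> g) \<bullet> x = ((f' \<bullet> f) \<star> (g' \<bullet> g)) \<bullet> x"
  by (simp add: tens_comp flip: tcomp_assoc)

lemma idt_comp [simp]: "\<lbrakk>arr x; tgt x = t\<rbrakk> \<Longrightarrow> idt t \<bullet> x = x"
  using Id_Comp[of "tob (src x)" "tob (tgt x)" "raw x"] arr_raw[of x]
  by (intro arr_eqI) (auto simp: raw_simps)

lemma comp_idt [simp]: "\<lbrakk>arr x; src x = t\<rbrakk> \<Longrightarrow> x \<bullet> idt t = x"
  using Comp_Id[of "tob (src x)" "tob (tgt x)" "raw x"] arr_raw[of x]
  by (intro arr_eqI) (auto simp: raw_simps)

lemma idt_tens [simp]: "\<lbrakk>wf_tree a; wf_tree b\<rbrakk> \<Longrightarrow> idt a \<star> idt b = idt (a \<diamondop> b)"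
  using tensor_Id[of "tob a" "tob b"]
  by (intro arr_eqI) (auto simp: raw_simps)

definition ty :: "('o, 'm) tarr \<Rightarrow> 'o tree \<Rightarrow> 'o tree \<Rightarrow> bool" where
  "ty x s t \<longleftrightarrow> arr x \<and> src x = s \<and> tgt x = t"

lemma tyD: "ty x s t \<Longrightarrow> arr x" "ty x s t \<Longrightarrow> src x = s" "ty x s t \<Longrightarrow> tgt x = t"
  "ty x s t \<Longrightarrow> wf_tree s" "ty x s t \<Longrightarrow> wf_tree t"
  by (auto simp: ty_def)

section \<open>Structural isomorphisms as typed arrows\<close>

definition al where "al a b c = Arr ((a \<diamondop> b) \<diamondop> c) (\<alpha> (tob a) (tob b) (tob c)) (a \<diamondop> b \<diamondop> c)"
definition ali where "ali a b c = Arr (a \<diamondop> b \<diamondop> c)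
   (inv_arrow M ((tob a \<otimes>\<^sub>o tob b) \<otimes>\<^sub>o tob c) (tob a \<otimes>\<^sub>o (tob b \<otimes>\<^sub>o tob c)) (\<alpha> (tob a) (tob b) (tob c)))
   ((a \<diamondop> b) \<diamondop> c)"
definition lu where "lu a = Arr (Unit \<diamondop> a) (\<l> (tob a)) a"
definition lui where "lui a = Arr a (inv_arrow M (\<I> \<otimes>\<^sub>o tob a) (tob a) (\<l> (tob a))) (Unit \<diamondop> a)"
definition ru where "ru a = Arr (a \<diamondop> Unit) (\<r> (tob a)) a"
definition rui where "rui a = Arr a (inv_arrow M (tob a \<otimes>\<^sub>o \<I>) (tob a) (\<r> (tob a))) (a \<diamondop> Unit)"
definition br where "br a b = Arr (a \<diamondop> b) (\<sigma> (tob a) (tob b)) (b \<diamondop> a)"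

lemmas struct_defs = al_def ali_def lu_def lui_def ru_def rui_def br_def

lemma struct_src_tgt [simp]:
  "src (al a b c) = (a \<diamondop> b) \<diamondop> c" "tgt (al a b c) = a \<diamondop> b \<diamondop> c"
  "src (ali a b c) = a \<diamondop> b \<diamondop> c" "tgt (ali a b c) = (a \<diamondop> b) \<diamondop> c"
  "src (lu a) = Unit \<diamondop> a" "tgt (lu a) = a" "src (lui a) = a" "tgt (lui a) = Unit \<diamondop> a"
  "src (ru a) = a \<diamondop> Unit" "tgt (ru a) = a" "src (rui a) = a" "tgt (rui a) = a \<diamondop> Unit"
  "src (br a b) = a \<diamondop> b" "tgt (br a b) = b \<diamondop> a"
  by (simp_all add: struct_defs)

lemmas al_inv = inverse_arrows_inv_arrow[OF _ _ assoc_iso]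
lemmas lu_inv = inverse_arrows_inv_arrow[OF _ _ lunit_iso]
lemmas ru_inv = inverse_arrows_inv_arrow[OF _ _ runit_iso]

lemma struct_arr [simp]:
  "\<lbrakk>wf_tree a; wf_tree b; wf_tree c\<rbrakk> \<Longrightarrow> arr (al a b c)"
  "\<lbrakk>wf_tree a; wf_tree b; wf_tree c\<rbrakk> \<Longrightarrow> arr (ali a b c)"
  "wf_tree a \<Longrightarrow> arr (lu a)" "wf_tree a \<Longrightarrow> arr (lui a)"
  "wf_tree a \<Longrightarrow> arr (ru a)" "wf_tree a \<Longrightarrow> arr (rui a)"
  "\<lbrakk>wf_tree a; wf_tree b\<rbrakk> \<Longrightarrow> arr (br a b)"
  using al_inv[of "tob a" "tob b" "tob c"] lu_inv[of "tob a"] ru_inv[of "tob a"]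
  by (auto simp: struct_defs arr_Arr tensor_ob unit_ob inverse_arrows_def braid_in_Hom)

lemma struct_inv [simp]:
  "\<lbrakk>wf_tree a; wf_tree b; wf_tree c\<rbrakk> \<Longrightarrow> al a b c \<bullet> ali a b c = idt (a \<diamondop> b \<diamondop> c)"
  "\<lbrakk>wf_tree a; wf_tree b; wf_tree c\<rbrakk> \<Longrightarrow> ali a b c \<bullet> al a b c = idt ((a \<diamondop> b) \<diamondop> c)"
  "wf_tree a \<Longrightarrow> lu a \<bullet> lui a = idt a" "wf_tree a \<Longrightarrow> lui a \<bullet> lu a = idt (Unit \<diamondop> a)"
  "wf_tree a \<Longrightarrow> ru a \<bullet> rui a = idt a" "wf_tree a \<Longrightarrow> rui a \<bullet> ru a = idt (a \<diamondop> Unit)"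
  "\<lbrakk>wf_tree a; wf_tree b\<rbrakk> \<Longrightarrow> br b a \<bullet> br a b = idt (a \<diamondop> b)"
  using al_inv[of "tob a" "tob b" "tob c"] lu_inv[of "tob a"] ru_inv[of "tob a"] symmetry[of "tob a" "tob b"]
  by (auto intro!: arr_eqI simp: raw_simps)
     (auto simp: struct_defs tensor_ob unit_ob inverse_arrows_def)

text \<open>Composites are kept nested to the right, where the pair g, f occurs in front of a tail
  x. An equation between composites is therefore also needed with a tail; \<open>comp_cancel\<close>
  is the version for a composite equal to an identity.\<close>

lemma comp_rewr: "g \<bullet> f = h \<bullet> k \<Longrightarrow> g \<bullet> f \<bullet> x = h \<bullet> k \<bullet> x"
  by (simp flip: tcomp_assoc)

lemma comp_cancel: "g \<bullet> f = idt t \<Longrightarrow> arr x \<Longrightarrow> tgt x = t \<Longrightarrow> g \<bullet> f \<bullet> x = x"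
  by (simp flip: tcomp_assoc)

lemmas struct_inv_comp [simp] = struct_inv[THEN comp_cancel]

lemma al_nat:
  "\<lbrakk>arr f; arr g; arr h; tgt f = a; tgt g = b; tgt h = c\<rbrakk>
   \<Longrightarrow> al a b c \<bullet> ((f \<star> g) \<star> h) = (f \<star> g \<star> h) \<bullet> al (src f) (src g) (src h)"
  using assoc_natural[of "tob (src f)" "tob (src g)" "tob (src h)" "tob (tgt f)" "tob (tgt g)" "tob (tgt h)"
      "raw f" "raw g" "raw h"] arr_raw[of f] arr_raw[of g] arr_raw[of h]
  by (auto intro!: arr_eqI simp: raw_simps) (auto simp: struct_defs)

lemma ali_nat:
  assumes "arr f" "arr g" "arr h" "tgt f = a" "tgt g = b" "tgt h = c"
  shows "ali a b c \<bullet> (f \<star> g \<star> h) = ((f \<star> g) \<star> h) \<bullet> ali (src f) (src g) (src h)"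
proof -
  have "ali a b c \<bullet> (f \<star> g \<star> h) = ali a b c \<bullet> ((f \<star> g \<star> h) \<bullet> al (src f) (src g) (src h)) \<bullet> ali (src f) (src g) (src h)"
    using assms by (simp add: tcomp_assoc)
  also have "\<dots> = (ali a b c \<bullet> al a b c) \<bullet> ((f \<star> g) \<star> h) \<bullet> ali (src f) (src g) (src h)"
    by (simp only: tcomp_assoc comp_rewr[OF al_nat[OF assms]])
  finally show ?thesis using assms by auto
qed

lemma lu_nat: "\<lbrakk>arr f; tgt f = a\<rbrakk> \<Longrightarrow> lu a \<bullet> (idt Unit \<star> f) = f \<bullet> lu (src f)"
  using lunit_natural[of "tob (src f)" "tob (tgt f)" "raw f"] arr_raw[of f]
  by (auto intro!: arr_eqI simp: raw_simps) (auto simp: struct_defs)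

lemma ru_nat: "\<lbrakk>arr f; tgt f = a\<rbrakk> \<Longrightarrow> ru a \<bullet> (f \<star> idt Unit) = f \<bullet> ru (src f)"
  using runit_natural[of "tob (src f)" "tob (tgt f)" "raw f"] arr_raw[of f]
  by (auto intro!: arr_eqI simp: raw_simps) (auto simp: struct_defs)

lemma br_nat: "\<lbrakk>arr f; arr g; tgt f = a; tgt g = b\<rbrakk> \<Longrightarrow> br a b \<bullet> (f \<star> g) = (g \<star> f) \<bullet> br (src f) (src g)"
  using braid_natural[of "tob (src f)" "tob (src g)" "tob (tgt f)" "tob (tgt g)" "raw f" "raw g"]
    arr_raw[of f] arr_raw[of g]
  by (auto intro!: arr_eqI simp: raw_simps) (auto simp: struct_defs)

lemma pentagon_t:
  "\<lbrakk>wf_tree a; wf_tree b; wf_tree c; wf_tree d\<rbrakk> \<Longrightarrow>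
   (idt a \<star> al b c d) \<bullet> al a (b \<diamondop> c) d \<bullet> (al a b c \<star> idt d) = al a b (c \<diamondop> d) \<bullet> al (a \<diamondop> b) c d"
  using pentagon[of "tob a" "tob b" "tob c" "tob d"]
  by (auto intro!: arr_eqI simp: raw_simps) (auto simp: struct_defs)

lemma triangle_t:
  "\<lbrakk>wf_tree a; wf_tree b\<rbrakk> \<Longrightarrow> (idt a \<star> lu b) \<bullet> al a Unit b = ru a \<star> idt b"
  using triangle[of "tob a" "tob b"]
  by (auto intro!: arr_eqI simp: raw_simps) (auto simp: struct_defs)

lemma hexagon_t:
  "\<lbrakk>wf_tree a; wf_tree b; wf_tree c\<rbrakk> \<Longrightarrow>
   al b c a \<bullet> br a (b \<diamondop> c) \<bullet> al a b c = (idt b \<star> br a c) \<bullet> al b a c \<bullet> (br a b \<star> idt c)"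
  using hexagon[of "tob a" "tob b" "tob c"]
  by (auto intro!: arr_eqI simp: raw_simps) (auto simp: struct_defs)

end

section \<open>Normalisation and coherence\<close>

context symmetric_monoidal_category
begin

text \<open>An arrow \<open>f : s \<rightarrow> t\<close> is replaced by its action \<open>nf f z : act s z \<rightarrow> act t z\<close> on right-nested words.
  The action is faithful and turns associators and unitors into identities, so coherence identities
  become identities between composites of whiskered adjacent transpositions.\<close>

primrec act :: "'o tree \<Rightarrow> 'o tree \<Rightarrow> 'o tree" where
  "act (Leaf A) z = Leaf A \<diamondop> z"
| "act Unit z = z"
| "act (a \<diamondop> b) z = act a (act b z)"

primrec act_arr :: "'o tree \<Rightarrow> ('o, 'm) tarr \<Rightarrow> ('o, 'm) tarr" where
  "act_arr (Leaf A) h = idt (Leaf A) \<star> h"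
| "act_arr Unit h = h"
| "act_arr (a \<diamondop> b) h = act_arr a (act_arr b h)"

text \<open>The canonical isomorphism from \<open>t \<diamondop> z\<close> to
  \<open>act t z\<close>, which moves the letters of t one by one in front of z and drops the units;
  \<open>nrmi\<close> is its inverse.\<close>

primrec nrm :: "'o tree \<Rightarrow> 'o tree \<Rightarrow> ('o, 'm) tarr" where
  "nrm (Leaf A) z = idt (Leaf A \<diamondop> z)"
| "nrm Unit z = lu z"
| "nrm (a \<diamondop> b) z = nrm a (act b z) \<bullet> (idt a \<star> nrm b z) \<bullet> al a b z"

primrec nrmi :: "'o tree \<Rightarrow> 'o tree \<Rightarrow> ('o, 'm) tarr" where
  "nrmi (Leaf A) z = idt (Leaf A \<diamondop> z)"
| "nrmi Unit z = lui z"
| "nrmi (a \<diamondop> b) z = ali a b z \<bullet> (idt a \<star> nrmi b z) \<bullet> nrmi a (act b z)"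

definition nf :: "('o, 'm) tarr \<Rightarrow> 'o tree \<Rightarrow> ('o, 'm) tarr" where
  "nf f z = nrm (tgt f) z \<bullet> (f \<star> idt z) \<bullet> nrmi (src f) z"

lemma wf_act [simp]: "wf_tree t \<Longrightarrow> wf_tree z \<Longrightarrow> wf_tree (act t z)"
  by (induction t arbitrary: z) auto

lemma act_arr_ty [simp]:
  assumes "wf_tree t" "arr h"
  shows "arr (act_arr t h)" "src (act_arr t h) = act t (src h)" "tgt (act_arr t h) = act t (tgt h)"
  using assms by (induction t arbitrary: h) auto

lemma act_arr_comp: "wf_tree t \<Longrightarrow> act_arr t (g \<bullet> f) = act_arr t g \<bullet> act_arr t f"
  by (induction t arbitrary: g f) (auto simp: tens_comp)

lemma act_arr_idt [simp]: "wf_tree t \<Longrightarrow> wf_tree z \<Longrightarrow> act_arr t (idt z) = idt (act t z)"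
  by (induction t arbitrary: z) auto

lemma nrm_ty [simp]:
  assumes "wf_tree t" "wf_tree z"
  shows "arr (nrm t z)" "src (nrm t z) = t \<diamondop> z" "tgt (nrm t z) = act t z"
  using assms by (induction t arbitrary: z) auto

lemma nrmi_ty [simp]:
  assumes "wf_tree t" "wf_tree z"
  shows "arr (nrmi t z)" "tgt (nrmi t z) = t \<diamondop> z" "src (nrmi t z) = act t z"
  using assms by (induction t arbitrary: z) auto

lemma nrm_inv [simp]: "wf_tree t \<Longrightarrow> wf_tree z \<Longrightarrow> nrm t z \<bullet> nrmi t z = idt (act t z)"
proof (induction t arbitrary: z)
  case (Node a b)
  then show ?case
    by (simp add: tcomp_assoc tens_comp_comp)
qed auto

lemma nrmi_inv [simp]: "wf_tree t \<Longrightarrow> wf_tree z \<Longrightarrow> nrmi t z \<bullet> nrm t z = idt (t \<diamondop> z)"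
proof (induction t arbitrary: z)
  case (Node a b)
  then show ?case
    by (simp add: tcomp_assoc tens_comp_comp comp_cancel[OF Node(1)])
qed auto

lemmas nrm_inv_comp [simp] = nrm_inv[THEN comp_cancel] nrmi_inv[THEN comp_cancel]

text \<open>Naturality in the tail z. The dependence of \<open>nrm\<close> on the word t is
  deliberately left aside: its failure to be natural is what \<open>nf\<close> records.\<close>

lemma nrm_nat:
  "wf_tree t \<Longrightarrow> arr h \<Longrightarrow> nrm t (tgt h) \<bullet> (idt t \<star> h) = act_arr t h \<bullet> nrm t (src h)"
proof (induction t arbitrary: h)
  case (Leaf A)
  then show ?case by simp
next
  case Unit
  then show ?case using lu_nat by simp
next
  case (Node a b)
  let ?A = "act b (tgt h)" and ?B = "act b (src h)"
  have "nrm (a \<diamondop> b) (tgt h) \<bullet> (idt (a \<diamondop> b) \<star> h)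
      = nrm a ?A \<bullet> (idt a \<star> nrm b (tgt h)) \<bullet> al a b (tgt h) \<bullet> ((idt a \<star> idt b) \<star> h)"
    using Node by (simp add: tcomp_assoc)
  also have "\<dots> = nrm a ?A \<bullet> (idt a \<star> nrm b (tgt h)) \<bullet> (idt a \<star> (idt b \<star> h)) \<bullet> al a b (src h)"
    using Node by (subst al_nat) auto
  also have "\<dots> = nrm a ?A \<bullet> (idt a \<star> act_arr b h) \<bullet> (idt a \<star> nrm b (src h)) \<bullet> al a b (src h)"
    using Node by (simp add: tens_comp_comp)
  also have "\<dots> = act_arr a (act_arr b h) \<bullet> nrm a ?B \<bullet> (idt a \<star> nrm b (src h)) \<bullet> al a b (src h)"
    using Node comp_rewr[OF Node(1)[of "act_arr b h"]] by simp
  finally show ?case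
    using Node by (simp add: tcomp_assoc)
qed

lemma nrmi_nat:
  assumes "wf_tree t" "arr h"
  shows "nrmi t (tgt h) \<bullet> act_arr t h = (idt t \<star> h) \<bullet> nrmi t (src h)"
proof -
  have "nrmi t (tgt h) \<bullet> act_arr t h = nrmi t (tgt h) \<bullet> (act_arr t h \<bullet> nrm t (src h)) \<bullet> nrmi t (src h)"
    using assms by (simp add: tcomp_assoc)
  then show ?thesis
    using assms by (simp add: nrm_nat[symmetric] tcomp_assoc)
qed

lemma nf_ty [simp]:
  assumes "arr f" "wf_tree z"
  shows "arr (nf f z)" "src (nf f z) = act (src f) z" "tgt (nf f z) = act (tgt f) z"
  using assms by (auto simp: nf_def)

lemma nf_idt [simp]: "wf_tree t \<Longrightarrow> wf_tree z \<Longrightarrow> nf (idt t) z = idt (act t z)"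
  by (simp add: nf_def)

lemma nf_comp: "\<lbrakk>arr g; arr f; src g = tgt f; wf_tree z\<rbrakk> \<Longrightarrow> nf (g \<bullet> f) z = nf g z \<bullet> nf f z"
  by (simp add: nf_def tcomp_assoc tens_comp_comp)

text \<open>Acting at the front of a word commutes with acting on its tail. This is the relation
  that lets transpositions at disjoint places pass each other in the coherence proofs for
  \<open>ms\<close>.\<close>

lemma nf_nat:
  assumes "arr f" "arr h"
  shows "nf f (tgt h) \<bullet> act_arr (src f) h = act_arr (tgt f) h \<bullet> nf f (src h)"
proof -
  have "nf f (tgt h) \<bullet> act_arr (src f) h
      = nrm (tgt f) (tgt h) \<bullet> (f \<star> idt (tgt h)) \<bullet> (idt (src f) \<star> h) \<bullet> nrmi (src f) (src h)"
    using assms by (simp add: nf_def tcomp_assoc nrmi_nat)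
  also have "\<dots> = nrm (tgt f) (tgt h) \<bullet> (idt (tgt f) \<star> h) \<bullet> (f \<star> idt (src h)) \<bullet> nrmi (src f) (src h)"
    using assms by (simp add: tens_comp_comp)
  also have "\<dots> = act_arr (tgt f) h \<bullet> nf f (src h)"
    using assms comp_rewr[OF nrm_nat[of "tgt f" h]] by (simp add: nf_def)
  finally show ?thesis .
qed

text \<open>Together with \<open>nf_comp\<close> it reduces every structural composite to a
  composite of whiskered elementary arrows.\<close>

lemma nf_tens:
  assumes "arr f" "arr g" "wf_tree z"
  shows "nf (f \<star> g) z = nf f (act (tgt g) z) \<bullet> act_arr (src f) (nf g z)"
proof -
  let ?a = "src f" and ?a' = "tgt f" and ?b = "src g" and ?b' = "tgt g"
  have "nf (f \<star> g) z = nrm ?a' (act ?b' z) \<bullet> (idt ?a' \<star> nrm ?b' z) \<bullet> al ?a' ?b' z \<bullet> ((f \<star> g) \<star> idt z)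
      \<bullet> ali ?a ?b z \<bullet> (idt ?a \<star> nrmi ?b z) \<bullet> nrmi ?a (act ?b z)"
    using assms by (simp add: nf_def tcomp_assoc)
  also have "\<dots> = nrm ?a' (act ?b' z) \<bullet> (idt ?a' \<star> nrm ?b' z) \<bullet> (f \<star> g \<star> idt z) \<bullet> al ?a ?b z
      \<bullet> ali ?a ?b z \<bullet> (idt ?a \<star> nrmi ?b z) \<bullet> nrmi ?a (act ?b z)"
    using assms comp_rewr[OF al_nat[of f g "idt z"]] by (simp add: tcomp_assoc)
  also have "\<dots> = nrm ?a' (act ?b' z) \<bullet> (f \<star> nf g z) \<bullet> nrmi ?a (act ?b z)"
    using assms by (simp add: tens_comp_comp nf_def tcomp_assoc)
  also have "\<dots> = nrm ?a' (act ?b' z) \<bullet> (f \<star> idt (act ?b' z)) \<bullet> (idt ?a \<star> nf g z) \<bullet> nrmi ?a (act ?b z)"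
    using assms by (simp add: tens_comp_comp)
  also have "\<dots> = nf f (act ?b' z) \<bullet> act_arr ?a (nf g z)"
    using assms nrmi_nat[of ?a "nf g z"] by (simp add: nf_def[of f] tcomp_assoc)
  finally show ?thesis .
qed

lemma tens_unit_cancel:
  assumes "arr f" "arr g" "src f = src g" "tgt f = tgt g" "f \<star> idt Unit = g \<star> idt Unit"
  shows "f = g"
proof -
  have "f \<bullet> ru (src f) = g \<bullet> ru (src f)"
    using assms ru_nat[of f] ru_nat[of g] by simp
  then have "(f \<bullet> ru (src f)) \<bullet> rui (src f) = (g \<bullet> ru (src f)) \<bullet> rui (src f)" by simp
  then show ?thesis
    using assms by (simp add: tcomp_assoc)
qed

lemma unit_tens_cancel:
  assumes "arr f" "arr g" "src f = src g" "tgt f = tgt g" "idt Unit \<star> f = idt Unit \<star> g"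
  shows "f = g"
proof -
  have "f \<bullet> lu (src f) = g \<bullet> lu (src f)"
    using assms lu_nat[of f] lu_nat[of g] by simp
  then have "(f \<bullet> lu (src f)) \<bullet> lui (src f) = (g \<bullet> lu (src f)) \<bullet> lui (src f)" by simp
  then show ?thesis
    using assms by (simp add: tcomp_assoc)
qed

text \<open>The tail \<open>Unit\<close> suffices: \<open>nf f Unit\<close> is
  \<open>f \<star> idt Unit\<close> conjugated by canonical isomorphisms, and tensoring with the
  unit is faithful by naturality of the unitor.\<close>

lemma nf_inj:
  assumes "arr f" "arr g" "src f = src g" "tgt f = tgt g" "nf f Unit = nf g Unit"
  shows "f = g"
proof -
  have "f \<star> idt Unit = nrmi (tgt f) Unit \<bullet> nf f Unit \<bullet> nrm (src f) Unit"
    using assms(1) by (simp add: nf_def tcomp_assoc)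
  also have "\<dots> = nrmi (tgt g) Unit \<bullet> nf g Unit \<bullet> nrm (src g) Unit"
    using assms by simp
  also have "\<dots> = g \<star> idt Unit"
    using assms(2) by (simp add: nf_def tcomp_assoc)
  finally show ?thesis
    using assms tens_unit_cancel by blast
qed

section \<open>How the structural isomorphisms act on words\<close>

text \<open>Kelly's derivation of the second unit triangle from the first one and the pentagon.\<close>

lemma lu_tens:
  assumes [simp]: "wf_tree a" "wf_tree z"
  shows "lu (a \<diamondop> z) \<bullet> al Unit a z = lu a \<star> idt z"
proof (rule unit_tens_cancel)
  \<comment> \<open>Both sides are tensored with the unit and compared on the source of the pentagon
    for \<open>Unit\<close>, \<open>Unit\<close>, a, z. \<open>?X\<close> is the invertible part of
    that pentagon and \<open>?Y\<close> its inverse, used for the final cancellation.\<close>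
  let ?X = "al Unit (Unit \<diamondop> a) z \<bullet> (al Unit Unit a \<star> idt z)"
  let ?Y = "(ali Unit Unit a \<star> idt z) \<bullet> ali Unit (Unit \<diamondop> a) z"
  have "(idt Unit \<star> (lu (a \<diamondop> z) \<bullet> al Unit a z)) \<bullet> ?X
      = (idt Unit \<star> lu (a \<diamondop> z)) \<bullet> (idt Unit \<star> al Unit a z) \<bullet> ?X"
    by (simp add: tens_comp_comp)
  also have "\<dots> = ((idt Unit \<star> lu (a \<diamondop> z)) \<bullet> al Unit Unit (a \<diamondop> z)) \<bullet> al (Unit \<diamondop> Unit) a z"
    by (simp add: pentagon_t tcomp_assoc)
  also have "\<dots> = (ru Unit \<star> (idt a \<star> idt z)) \<bullet> al (Unit \<diamondop> Unit) a z"
    by (simp add: triangle_t)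
  also have "\<dots> = al Unit a z \<bullet> ((ru Unit \<star> idt a) \<star> idt z)"
    by (subst al_nat) auto
  also have "\<dots> = al Unit a z \<bullet> ((idt Unit \<star> lu a) \<star> idt z) \<bullet> (al Unit Unit a \<star> idt z)"
    by (simp add: tens_comp triangle_t)
  also have "\<dots> = (idt Unit \<star> (lu a \<star> idt z)) \<bullet> ?X"
    using comp_rewr[OF al_nat[of "idt Unit" "lu a" "idt z"]] by simp
  finally have "((idt Unit \<star> (lu (a \<diamondop> z) \<bullet> al Unit a z)) \<bullet> ?X) \<bullet> ?Y
      = ((idt Unit \<star> (lu a \<star> idt z)) \<bullet> ?X) \<bullet> ?Y"
    by (rule arg_cong)
  then show "idt Unit \<star> (lu (a \<diamondop> z) \<bullet> al Unit a z) = idt Unit \<star> (lu a \<star> idt z)"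
    by (simp add: tcomp_assoc tens_comp_comp)
qed auto

text \<open>The left unitor requires the derived triangle \<open>lu_tens\<close>, the right unitor
  below is the axiom \<open>triangle_t\<close>.\<close>

lemma nf_lu [simp]: "wf_tree a \<Longrightarrow> wf_tree z \<Longrightarrow> nf (lu a) z = idt (act a z)"
  by (simp add: nf_def tcomp_assoc lu_tens[symmetric] comp_rewr[OF lu_nat])

lemma nf_ru [simp]: "wf_tree a \<Longrightarrow> wf_tree z \<Longrightarrow> nf (ru a) z = idt (act a z)"
  by (simp add: nf_def tcomp_assoc triangle_t[symmetric] tens_comp_comp)

text \<open>By the pentagon, reassociating and then normalising is the same as normalising directly,
  so the associator acts as the identity.\<close>

lemma nf_al [simp]:
  assumes [simp]: "wf_tree a" "wf_tree b" "wf_tree c" "wf_tree z"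
  shows "nf (al a b c) z = idt (act a (act b (act c z)))"
proof -
  have "nrm (a \<diamondop> b \<diamondop> c) z \<bullet> (al a b c \<star> idt z)
     = nrm a (act b (act c z)) \<bullet> (idt a \<star> nrm b (act c z)) \<bullet> (idt a \<star> (idt b \<star> nrm c z))
       \<bullet> (idt a \<star> al b c z) \<bullet> al a (b \<diamondop> c) z \<bullet> (al a b c \<star> idt z)"
    by (simp add: tcomp_assoc tens_comp_comp)
  also have "\<dots> = nrm a (act b (act c z)) \<bullet> (idt a \<star> nrm b (act c z)) \<bullet> (idt a \<star> (idt b \<star> nrm c z))
       \<bullet> al a b (c \<diamondop> z) \<bullet> al (a \<diamondop> b) c z"
    by (simp add: pentagon_t)
  also have "\<dots> = nrm a (act b (act c z)) \<bullet> (idt a \<star> nrm b (act c z)) 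
       \<bullet> al a b (act c z) \<bullet> (idt (a \<diamondop> b) \<star> nrm c z) \<bullet> al (a \<diamondop> b) c z"
    by (simp add: comp_rewr[OF al_nat[of "idt a" "idt b" "nrm c z" a b "act c z"]] flip: idt_tens)
  also have "\<dots> = nrm ((a \<diamondop> b) \<diamondop> c) z"
    by (simp add: tcomp_assoc)
  finally show ?thesis
    unfolding nf_def using nrm_inv[of "(a \<diamondop> b) \<diamondop> c" z] by (simp flip: tcomp_assoc)
qed

lemma nf_inverse:
  assumes "arr f" "arr g" "src g = tgt f" "f \<bullet> g = idt (src g)" "nf f z = idt (act (src f) z)" "wf_tree z"
    "src f = tgt g"
  shows "nf g z = idt (act (src g) z)"
proof -
  have "nf f z \<bullet> nf g z = idt (act (src g) z)"
    using nf_comp[of f g z] assms by simp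
  then show ?thesis using assms by simp
qed

lemma nf_lui [simp]: "wf_tree a \<Longrightarrow> wf_tree z \<Longrightarrow> nf (lui a) z = idt (act a z)"
  using nf_inverse[of "lu a" "lui a" z] by simp

lemma nf_rui [simp]: "wf_tree a \<Longrightarrow> wf_tree z \<Longrightarrow> nf (rui a) z = idt (act a z)"
  using nf_inverse[of "ru a" "rui a" z] by simp

lemma nf_ali [simp]: "\<lbrakk>wf_tree a; wf_tree b; wf_tree c; wf_tree z\<rbrakk>
    \<Longrightarrow> nf (ali a b c) z = idt (act a (act b (act c z)))"
  using nf_inverse[of "al a b c" "ali a b c" z] by simp

text \<open>The hexagon, once its associators act as identities.\<close>

lemma nf_br_right:
  assumes [simp]: "wf_tree a" "wf_tree b" "wf_tree c" "wf_tree z"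
  shows "nf (br a (b \<diamondop> c)) z = act_arr b (nf (br a c) z) \<bullet> nf (br a b) (act c z)"
  using arg_cong[OF hexagon_t[of a b c], of "\<lambda>f. nf f z"]
  by (simp add: nf_comp nf_tens)

lemma nf_br_cancel [simp]:
  assumes [simp]: "wf_tree a" "wf_tree b" "wf_tree z"
  shows "nf (br b a) z \<bullet> nf (br a b) z = idt (act a (act b z))"
  using nf_comp[of "br b a" "br a b" z] by simp

lemmas nf_br_cancel_comp [simp] = nf_br_cancel[THEN comp_cancel]

text \<open>Only one hexagon is an axiom; the other one is its inverse, because the braiding is a
  symmetry.\<close>

lemma nf_br_left:
  assumes [simp]: "wf_tree a" "wf_tree b" "wf_tree c" "wf_tree z"
  shows "nf (br (a \<diamondop> b) c) z = nf (br a c) (act b z) \<bullet> act_arr a (nf (br b c) z)"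
proof -
  let ?g = "nf (br a c) (act b z) \<bullet> act_arr a (nf (br b c) z)"
  have "nf (br c (a \<diamondop> b)) z \<bullet> ?g = idt (act (a \<diamondop> b) (act c z))"
    using act_arr_comp[of a "nf (br c b) z" "nf (br b c) z"]
    by (simp add: nf_br_right tcomp_assoc)
  then have "nf (br (a \<diamondop> b) c) z \<bullet> nf (br c (a \<diamondop> b)) z \<bullet> ?g = nf (br (a \<diamondop> b) c) z"
    by simp
  then show ?thesis
    using nf_br_cancel[of c "a \<diamondop> b" z] by (simp add: comp_cancel[OF nf_br_cancel] del: nf_br_cancel)
qed

text \<open>Naturality of the braiding along the isomorphism of
  \<open>Unit \<diamondop> Unit\<close> with \<open>Unit\<close> makes this action idempotent, and
  an invertible idempotent is the identity.\<close>

lemma nf_br_unit_right [simp]: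
  assumes [simp]: "wf_tree a" "wf_tree z"
  shows "nf (br a Unit) z = idt (act a z)"
proof -
  have "nf (br a Unit) z = nf (br a Unit \<bullet> (idt a \<star> lu Unit)) z"
    by (simp add: nf_comp nf_tens)
  also have "\<dots> = nf ((lu Unit \<star> idt a) \<bullet> br a (Unit \<diamondop> Unit)) z"
    using br_nat[of "idt a" "lu Unit" a Unit] by simp
  also have "\<dots> = nf (br a Unit) z \<bullet> nf (br a Unit) z"
    by (simp add: nf_comp nf_tens nf_br_right)
  finally have "nf (br Unit a) z \<bullet> nf (br a Unit) z = nf (br Unit a) z \<bullet> nf (br a Unit) z \<bullet> nf (br a Unit) z"
    by simp
  then show ?thesis
    by simp
qed

lemma nf_br_unit_left [simp]:
  assumes [simp]: "wf_tree a" "wf_tree z"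
  shows "nf (br Unit a) z = idt (act a z)"
  using nf_br_cancel[of Unit a z] by (simp del: nf_br_cancel)

section \<open>The exchange of middle factors and its coherence\<close>

definition ms :: "'o tree \<Rightarrow> 'o tree \<Rightarrow> 'o tree \<Rightarrow> 'o tree \<Rightarrow> ('o, 'm) tarr" where
  "ms a b c d = ali a c (b \<diamondop> d) \<bullet> (idt a \<star> al c b d) \<bullet> (idt a \<star> (br b c \<star> idt d))
     \<bullet> (idt a \<star> ali b c d) \<bullet> al a b (c \<diamondop> d)"

lemma ms_ty [simp]:
  assumes "wf_tree a" "wf_tree b" "wf_tree c" "wf_tree d"
  shows "arr (ms a b c d)" "src (ms a b c d) = (a \<diamondop> b) \<diamondop> (c \<diamondop> d)" "tgt (ms a b c d) = (a \<diamondop> c) \<diamondop> (b \<diamondop> d)"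
  using assms by (auto simp: ms_def)

lemma raw_ms: "\<lbrakk>wf_tree a; wf_tree b; wf_tree c; wf_tree d\<rbrakk>
  \<Longrightarrow> raw (ms a b c d) = middle_swap M (tob a) (tob b) (tob c) (tob d)"
  by (simp add: ms_def middle_swap_def raw_simps) (simp add: struct_defs)

lemma ms_nat:
  assumes "arr f" "arr g" "arr h" "arr k" "tgt f = a" "tgt g = b" "tgt h = c" "tgt k = d"
  shows "ms a b c d \<bullet> ((f \<star> g) \<star> (h \<star> k)) = ((f \<star> h) \<star> (g \<star> k)) \<bullet> ms (src f) (src g) (src h) (src k)"
proof -
  have "ms a b c d \<bullet> ((f \<star> g) \<star> (h \<star> k))
     = ali a c (b \<diamondop> d) \<bullet> (idt a \<star> (al c b d \<bullet> (br b c \<star> idt d) \<bullet> ali b c d)) \<bullet> al a b (c \<diamondop> d) \<bullet> ((f \<star> g) \<star> (h \<star> k))"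
    using assms by (auto simp add: ms_def tcomp_assoc tens_comp_comp)
  also have "al a b (c \<diamondop> d) \<bullet> ((f \<star> g) \<star> (h \<star> k)) = (f \<star> (g \<star> (h \<star> k))) \<bullet> al (src f) (src g) (src h \<diamondop> src k)"
    using assms by (auto simp: al_nat)
  also have "ali a c (b \<diamondop> d) \<bullet> (idt a \<star> (al c b d \<bullet> (br b c \<star> idt d) \<bullet> ali b c d)) \<bullet> \<dots>
     = ali a c (b \<diamondop> d) \<bullet> (f \<star> (al c b d \<bullet> (br b c \<star> idt d) \<bullet> ali b c d \<bullet> (g \<star> (h \<star> k)))) \<bullet> al (src f) (src g) (src h \<diamondop> src k)"
    using assms by (auto simp: tens_comp_comp tcomp_assoc)
  also have "ali b c d \<bullet> (g \<star> (h \<star> k)) = ((g \<star> h) \<star> k) \<bullet> ali (src g) (src h) (src k)"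
    using assms by (auto simp: ali_nat)
  also have "(br b c \<star> idt d) \<bullet> \<dots> = ((h \<star> g) \<star> k) \<bullet> (br (src g) (src h) \<star> idt (src k)) \<bullet> ali (src g) (src h) (src k)"
    using assms by (auto simp: tens_comp_comp br_nat)
  also have "al c b d \<bullet> \<dots> = (h \<star> (g \<star> k)) \<bullet> al (src h) (src g) (src k) \<bullet> (br (src g) (src h) \<star> idt (src k)) \<bullet> ali (src g) (src h) (src k)"
    using assms by (auto simp: comp_rewr[OF al_nat])
  also have "ali a c (b \<diamondop> d) \<bullet> (f \<star> \<dots>) \<bullet> al (src f) (src g) (src h \<diamondop> src k)
    = ali a c (b \<diamondop> d) \<bullet> (f \<star> (h \<star> (g \<star> k))) \<bullet> (idt (src f) \<star> (al (src h) (src g) (src k) \<bullet> (br (src g) (src h) \<star> idt (src k)) \<bullet> ali (src g) (src h) (src k))) \<bullet> al (src f) (src g) (src h \<diamondop> src k)"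
    using assms by (auto simp: tens_comp_comp)
  also have "\<dots> = ((f \<star> h) \<star> (g \<star> k)) \<bullet> ali (src f) (src h) (src g \<diamondop> src k) \<bullet> (idt (src f) \<star> (al (src h) (src g) (src k) \<bullet> (br (src g) (src h) \<star> idt (src k)) \<bullet> ali (src g) (src h) (src k))) \<bullet> al (src f) (src g) (src h \<diamondop> src k)"
    using assms by (auto simp: comp_rewr[OF ali_nat])
  finally show ?thesis
    using assms by (simp add: ms_def tens_comp_comp tcomp_assoc)
qed

lemma nf_ms [simp]:
  assumes [simp]: "wf_tree a" "wf_tree b" "wf_tree c" "wf_tree d" "wf_tree z"
  shows "nf (ms a b c d) z = act_arr a (nf (br b c) (act d z))"
  by (simp add: ms_def nf_comp nf_tens)

text \<open>Behind the coassociativity of a tensor product of comonoids. After normalisation the two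
  sides consist of the same transpositions, up to an order that \<open>nf_nat\<close>
  corrects.\<close>

lemma ms_assoc:
  assumes [simp]: "wf_tree a" "wf_tree a'" "wf_tree a''" "wf_tree b" "wf_tree b'" "wf_tree b''"
  shows "al (a \<diamondop> b) (a' \<diamondop> b') (a'' \<diamondop> b'') \<bullet> (ms a a' b b' \<star> idt (a'' \<diamondop> b'')) \<bullet> ms (a \<diamondop> a') a'' (b \<diamondop> b') b''
    = (idt (a \<diamondop> b) \<star> ms a' a'' b' b'') \<bullet> ms a (a' \<diamondop> a'') b (b' \<diamondop> b'') \<bullet> (al a a' a'' \<star> al b b' b'')"
proof (rule nf_inj)
  have "act_arr a (nf (br a' b) (act b' (act a'' (act b'' Unit)))) \<bullet> act_arr a (act_arr a' (act_arr b (nf (br a'' b') (act b'' Unit))))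
   = act_arr a (act_arr b (act_arr a' (nf (br a'' b') (act b'' Unit)))) \<bullet> act_arr a (nf (br a' b) (act a'' (act b' (act b'' Unit))))"
    using nf_nat[of "br a' b" "nf (br a'' b') (act b'' Unit)"] by (simp flip: act_arr_comp)
  note * = this comp_rewr[OF this]
  show "nf (al (a \<diamondop> b) (a' \<diamondop> b') (a'' \<diamondop> b'') \<bullet> (ms a a' b b' \<star> idt (a'' \<diamondop> b'')) \<bullet> ms (a \<diamondop> a') a'' (b \<diamondop> b') b'') Unit
    = nf ((idt (a \<diamondop> b) \<star> ms a' a'' b' b'') \<bullet> ms a (a' \<diamondop> a'') b (b' \<diamondop> b'') \<bullet> (al a a' a'' \<star> al b b' b'')) Unit"
    by (simp add: nf_comp nf_tens nf_br_right nf_br_left act_arr_comp tcomp_assoc *)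
qed auto

text \<open>Behind the cocommutativity of a tensor product of comonoids. Braiding the two pairs
  undoes the exchange of the inner letters, and the transpositions of a with a' and of b with b'
  commute by \<open>nf_nat\<close>.\<close>

lemma ms_br:
  assumes [simp]: "wf_tree a" "wf_tree a'" "wf_tree b" "wf_tree b'"
  shows "br (a \<diamondop> b) (a' \<diamondop> b') \<bullet> ms a a' b b' = ms a' a b' b \<bullet> (br a a' \<star> br b b')"
proof (rule nf_inj)
  have "act_arr a (nf (br b a') (act b' Unit)) \<bullet> act_arr a (nf (br a' b) (act b' Unit)) = idt (act a (act a' (act b (act b' Unit))))"
    by (simp flip: act_arr_comp)
  note 1 = this comp_cancel[OF this]
  have "nf (br a a') (act b' (act b Unit)) \<bullet> act_arr a (act_arr a' (nf (br b b') Unit))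
      = act_arr a' (act_arr a (nf (br b b') Unit)) \<bullet> nf (br a a') (act b (act b' Unit))"
    using nf_nat[of "br a a'" "nf (br b b') Unit"] by simp
  note 2 = this comp_rewr[OF this]
  show "nf (br (a \<diamondop> b) (a' \<diamondop> b') \<bullet> ms a a' b b') Unit = nf (ms a' a b' b \<bullet> (br a a' \<star> br b b')) Unit"
    by (simp add: nf_comp nf_tens nf_br_right nf_br_left act_arr_comp tcomp_assoc 1 2)
qed auto

end

section \<open>Cocommutative comonoids\<close>

record ('o, 'm) coalg =
  cob :: "'o tree"
  cmu :: "('o, 'm) tarr"
  cun :: "('o, 'm) tarr"

context symmetric_monoidal_category
begin

text \<open>What makes the associator a comonoid morphism, see \<open>cmor_al\<close>.\<close>

lemma ms_al:
  assumes [simp]: "wf_tree a" "wf_tree a'" "wf_tree b" "wf_tree b'" "wf_tree c" "wf_tree c'"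
  shows "(al a b c \<star> al a' b' c') \<bullet> ms (a \<diamondop> b) (a' \<diamondop> b') c c' \<bullet> (ms a a' b b' \<star> idt (c \<diamondop> c'))
    = ms a a' (b \<diamondop> c) (b' \<diamondop> c') \<bullet> (idt (a \<diamondop> a') \<star> ms b b' c c') \<bullet> al (a \<diamondop> a') (b \<diamondop> b') (c \<diamondop> c')"
proof (rule nf_inj)
  let ?z = "act c' Unit"
  have "act_arr a (act_arr b (nf (br a' c) (act b' ?z))) \<bullet> act_arr a (act_arr b (act_arr a' (nf (br b' c) ?z))) 
        \<bullet> act_arr a (nf (br a' b) (act b' (act c ?z)))
    = act_arr a (act_arr b (nf (br a' c) (act b' ?z)))  
        \<bullet> act_arr a (nf (br a' b) (act c (act b' ?z))) \<bullet> act_arr a (act_arr a' (act_arr b (nf (br b' c) ?z)))"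
    using nf_nat[of "br a' b" "nf (br b' c) ?z"] by (simp flip: act_arr_comp)
  note * = this
  show "nf ((al a b c \<star> al a' b' c') \<bullet> ms (a \<diamondop> b) (a' \<diamondop> b') c c' \<bullet> (ms a a' b b' \<star> idt (c \<diamondop> c'))) Unit
    = nf (ms a a' (b \<diamondop> c) (b' \<diamondop> c') \<bullet> (idt (a \<diamondop> a') \<star> ms b b' c c') \<bullet> al (a \<diamondop> a') (b \<diamondop> b') (c \<diamondop> c')) Unit"
    by (simp add: nf_comp nf_tens nf_br_right nf_br_left act_arr_comp tcomp_assoc *)
qed auto

definition coc :: "('o, 'm, 'y) coalg_scheme \<Rightarrow> bool" where
  "coc X \<longleftrightarrow> wf_tree (cob X) \<and> ty (cmu X) (cob X) (cob X \<diamondop> cob X) \<and> ty (cun X) (cob X) Unit \<and>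
     al (cob X) (cob X) (cob X) \<bullet> (cmu X \<star> idt (cob X)) \<bullet> cmu X = (idt (cob X) \<star> cmu X) \<bullet> cmu X \<and>
     lu (cob X) \<bullet> (cun X \<star> idt (cob X)) \<bullet> cmu X = idt (cob X) \<and>
     ru (cob X) \<bullet> (idt (cob X) \<star> cun X) \<bullet> cmu X = idt (cob X) \<and>
     br (cob X) (cob X) \<bullet> cmu X = cmu X"

definition cmor :: "('o, 'm, 'y) coalg_scheme \<Rightarrow> ('o, 'm, 'x) coalg_scheme \<Rightarrow> ('o, 'm) tarr \<Rightarrow> bool" where
  "cmor X Y f \<longleftrightarrow> ty f (cob X) (cob Y) \<and> cmu Y \<bullet> f = (f \<star> f) \<bullet> cmu X \<and> cun Y \<bullet> f = cun X"

definition prodc :: "('o, 'm, 'y) coalg_scheme \<Rightarrow> ('o, 'm, 'x) coalg_scheme \<Rightarrow> ('o, 'm) coalg" where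
  "prodc X Y = \<lparr>cob = cob X \<diamondop> cob Y,
     cmu = ms (cob X) (cob X) (cob Y) (cob Y) \<bullet> (cmu X \<star> cmu Y),
     cun = lu Unit \<bullet> (cun X \<star> cun Y)\<rparr>"

definition unitc :: "('o, 'm) coalg" where
  "unitc = \<lparr>cob = Unit, cmu = lui Unit, cun = idt Unit\<rparr>"

lemma cob_simps [simp]: "cob (prodc X Y) = cob X \<diamondop> cob Y" "cob unitc = Unit"
  by (simp_all add: prodc_def unitc_def)

lemma coc_ty [simp]:
  assumes "coc X"
  shows "wf_tree (cob X)" "arr (cmu X)" "src (cmu X) = cob X" "tgt (cmu X) = cob X \<diamondop> cob X"
    "arr (cun X)" "src (cun X) = cob X" "tgt (cun X) = Unit"
  using assms by (auto simp: coc_def ty_def)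

lemma coc_laws:
  assumes "coc X"
  shows coc_assoc: "al (cob X) (cob X) (cob X) \<bullet> (cmu X \<star> idt (cob X)) \<bullet> cmu X = (idt (cob X) \<star> cmu X) \<bullet> cmu X"
    and coc_lunit: "lu (cob X) \<bullet> (cun X \<star> idt (cob X)) \<bullet> cmu X = idt (cob X)"
    and coc_runit: "ru (cob X) \<bullet> (idt (cob X) \<star> cun X) \<bullet> cmu X = idt (cob X)"
    and coc_comm: "br (cob X) (cob X) \<bullet> cmu X = cmu X"
  using assms by (auto simp: coc_def)

lemma cmor_ty:
  assumes "cmor X Y f"
  shows "arr f" "src f = cob X" "tgt f = cob Y" "ty f (cob X) (cob Y)"
  using assms by (auto simp: cmor_def ty_def)

lemma cmor_cmu: "cmor X Y f \<Longrightarrow> cmu Y \<bullet> f = (f \<star> f) \<bullet> cmu X"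
  and cmor_cun: "cmor X Y f \<Longrightarrow> cun Y \<bullet> f = cun X"
  by (auto simp: cmor_def)

lemma cmor_idt: "coc X \<Longrightarrow> cmor X X (idt (cob X))"
  by (simp add: cmor_def ty_def)

lemma cmor_comp:
  assumes f: "cmor X Y f" and g: "cmor Y Z g"
  shows "cmor X Z (g \<bullet> f)"
proof -
  have "cmu Z \<bullet> g \<bullet> f = ((g \<bullet> f) \<star> (g \<bullet> f)) \<bullet> cmu X"
    by (simp add: comp_rewr[OF cmor_cmu[OF g]] cmor_cmu[OF f] tens_comp_comp)
  moreover have "cun Z \<bullet> g \<bullet> f = cun X"
    using cmor_cun[OF f] cmor_cun[OF g] by (simp flip: tcomp_assoc)
  ultimately show ?thesis
    using cmor_ty[OF f] cmor_ty[OF g] by (simp add: cmor_def ty_def)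
qed

text \<open>In each axiom \<open>ms_nat\<close> moves the exchanges to the left end, where coherence
  rearranges or removes them; what remains is the tensor product of the corresponding axioms of X
  and Y.\<close>

lemma coc_prodc:
  assumes X [simp]: "coc X" and Y [simp]: "coc Y"
  shows "coc (prodc X Y)"
proof -
  let ?a = "cob X" and ?b = "cob Y" and ?D = "cmu X" and ?E = "cmu Y"
  let ?M = "ms ?a ?a ?b ?b" and ?c = "cmu (prodc X Y)"
  have c: "?c = ?M \<bullet> (?D \<star> ?E)" and e: "cun (prodc X Y) = lu Unit \<bullet> (cun X \<star> cun Y)"
    by (simp_all add: prodc_def)
  have "al (?a \<diamondop> ?b) (?a \<diamondop> ?b) (?a \<diamondop> ?b) \<bullet> (?c \<star> idt (?a \<diamondop> ?b)) \<bullet> ?c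
      = al (?a \<diamondop> ?b) (?a \<diamondop> ?b) (?a \<diamondop> ?b) \<bullet> (?M \<star> idt (?a \<diamondop> ?b)) \<bullet> ((?D \<star> ?E) \<star> (idt ?a \<star> idt ?b)) \<bullet> ?M \<bullet> (?D \<star> ?E)"
    by (simp add: c tens_comp_comp)
  also have "\<dots> = al (?a \<diamondop> ?b) (?a \<diamondop> ?b) (?a \<diamondop> ?b) \<bullet> (?M \<star> idt (?a \<diamondop> ?b)) 
      \<bullet> ms (?a \<diamondop> ?a) ?a (?b \<diamondop> ?b) ?b \<bullet> ((?D \<star> idt ?a) \<star> (?E \<star> idt ?b)) \<bullet> (?D \<star> ?E)"
    using comp_rewr[OF ms_nat[of ?D "idt ?a" ?E "idt ?b"]] by simp
  also have "\<dots> = (al (?a \<diamondop> ?b) (?a \<diamondop> ?b) (?a \<diamondop> ?b) \<bullet> (?M \<star> idt (?a \<diamondop> ?b)) 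
      \<bullet> ms (?a \<diamondop> ?a) ?a (?b \<diamondop> ?b) ?b) \<bullet> (((?D \<star> idt ?a) \<bullet> ?D) \<star> ((?E \<star> idt ?b) \<bullet> ?E))"
    by (simp add: tens_comp tcomp_assoc)
  also have "\<dots> = (idt (?a \<diamondop> ?b) \<star> ?M) \<bullet> ms ?a (?a \<diamondop> ?a) ?b (?b \<diamondop> ?b) \<bullet> (al ?a ?a ?a \<star> al ?b ?b ?b)
       \<bullet> (((?D \<star> idt ?a) \<bullet> ?D) \<star> ((?E \<star> idt ?b) \<bullet> ?E))"
    by (subst ms_assoc) (simp_all add: tcomp_assoc)
  also have "\<dots> = (idt (?a \<diamondop> ?b) \<star> ?M) \<bullet> ms ?a (?a \<diamondop> ?a) ?b (?b \<diamondop> ?b)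
       \<bullet> ((idt ?a \<star> ?D) \<star> (idt ?b \<star> ?E)) \<bullet> (?D \<star> ?E)"
    by (simp add: tens_comp coc_assoc)
  also have "\<dots> = (idt (?a \<diamondop> ?b) \<star> ?M) \<bullet> ((idt ?a \<star> idt ?b) \<star> (?D \<star> ?E)) \<bullet> ?M \<bullet> (?D \<star> ?E)"
    using comp_rewr[OF ms_nat[of "idt ?a" ?D "idt ?b" ?E]] by simp
  also have "\<dots> = (idt (?a \<diamondop> ?b) \<star> ?c) \<bullet> ?c"
    by (simp add: c tens_comp_comp)
  finally have 1: "al (?a \<diamondop> ?b) (?a \<diamondop> ?b) (?a \<diamondop> ?b) \<bullet> (?c \<star> idt (?a \<diamondop> ?b)) \<bullet> ?c = (idt (?a \<diamondop> ?b) \<star> ?c) \<bullet> ?c" .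
  have "lu (?a \<diamondop> ?b) \<bullet> (cun (prodc X Y) \<star> idt (?a \<diamondop> ?b)) \<bullet> ?c
      = lu (?a \<diamondop> ?b) \<bullet> (lu Unit \<star> idt (?a \<diamondop> ?b)) \<bullet> ((cun X \<star> cun Y) \<star> (idt ?a \<star> idt ?b)) \<bullet> ?M \<bullet> (?D \<star> ?E)"
    by (simp add: c e tens_comp_comp)
  also have "\<dots> = (lu (?a \<diamondop> ?b) \<bullet> (lu Unit \<star> idt (?a \<diamondop> ?b)) \<bullet> ms Unit ?a Unit ?b) 
       \<bullet> ((cun X \<star> idt ?a) \<star> (cun Y \<star> idt ?b)) \<bullet> (?D \<star> ?E)"
    using comp_rewr[OF ms_nat[of "cun X" "idt ?a" "cun Y" "idt ?b"]] by (simp add: tcomp_assoc)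
  also have "lu (?a \<diamondop> ?b) \<bullet> (lu Unit \<star> idt (?a \<diamondop> ?b)) \<bullet> ms Unit ?a Unit ?b = lu ?a \<star> lu ?b"
    by (rule nf_inj) (simp_all add: nf_comp nf_tens)
  finally have 2: "lu (?a \<diamondop> ?b) \<bullet> (cun (prodc X Y) \<star> idt (?a \<diamondop> ?b)) \<bullet> ?c = idt (?a \<diamondop> ?b)"
    by (simp add: tens_comp tens_comp_comp coc_lunit)
  have "ru (?a \<diamondop> ?b) \<bullet> (idt (?a \<diamondop> ?b) \<star> cun (prodc X Y)) \<bullet> ?c
      = ru (?a \<diamondop> ?b) \<bullet> (idt (?a \<diamondop> ?b) \<star> lu Unit) \<bullet> ((idt ?a \<star> idt ?b) \<star> (cun X \<star> cun Y)) \<bullet> ?M \<bullet> (?D \<star> ?E)"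
    by (simp add: c e tens_comp_comp)
  also have "\<dots> = (ru (?a \<diamondop> ?b) \<bullet> (idt (?a \<diamondop> ?b) \<star> lu Unit) \<bullet> ms ?a Unit ?b Unit) 
       \<bullet> ((idt ?a \<star> cun X) \<star> (idt ?b \<star> cun Y)) \<bullet> (?D \<star> ?E)"
    using comp_rewr[OF ms_nat[of "idt ?a" "cun X" "idt ?b" "cun Y"]] by (simp add: tcomp_assoc)
  also have "ru (?a \<diamondop> ?b) \<bullet> (idt (?a \<diamondop> ?b) \<star> lu Unit) \<bullet> ms ?a Unit ?b Unit = ru ?a \<star> ru ?b"
    by (rule nf_inj) (simp_all add: nf_comp nf_tens)
  finally have 3: "ru (?a \<diamondop> ?b) \<bullet> (idt (?a \<diamondop> ?b) \<star> cun (prodc X Y)) \<bullet> ?c = idt (?a \<diamondop> ?b)"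
    by (simp add: tens_comp tens_comp_comp coc_runit)
  have 4: "br (?a \<diamondop> ?b) (?a \<diamondop> ?b) \<bullet> ?c = ?c"
    by (simp add: c comp_rewr[OF ms_br] tens_comp coc_comm)
  show ?thesis
    unfolding coc_def using 1 2 3 4 by (simp add: ty_def c e)
qed

lemma coc_unitc [simp]: "coc unitc"
proof -
  have "lu Unit \<bullet> (idt Unit \<star> idt Unit) \<bullet> lui Unit = idt Unit"
    "ru Unit \<bullet> (idt Unit \<star> idt Unit) \<bullet> lui Unit = idt Unit"
    "br Unit Unit \<bullet> lui Unit = lui Unit"
    "al Unit Unit Unit \<bullet> (lui Unit \<star> idt Unit) \<bullet> lui Unit = (idt Unit \<star> lui Unit) \<bullet> lui Unit"
    by (rule nf_inj; simp add: nf_comp nf_tens)+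
  then show ?thesis
    by (simp add: coc_def unitc_def ty_def)
qed

lemma cmor_tens:
  assumes [simp]: "coc X" "coc Y" "coc X'" "coc Y'" and f: "cmor X X' f" and g: "cmor Y Y' g"
  shows "cmor (prodc X Y) (prodc X' Y') (f \<star> g)"
proof -
  note [simp] = cmor_ty(1-3)[OF f] cmor_ty(1-3)[OF g]
  have "cmu (prodc X' Y') \<bullet> (f \<star> g) = ms (cob X') (cob X') (cob Y') (cob Y') \<bullet> ((f \<star> f) \<star> (g \<star> g)) \<bullet> (cmu X \<star> cmu Y)"
    by (simp add: prodc_def tcomp_assoc tens_comp cmor_cmu[OF f] cmor_cmu[OF g])
  also have "\<dots> = ((f \<star> g) \<star> (f \<star> g)) \<bullet> cmu (prodc X Y)"
    using comp_rewr[OF ms_nat[of f f g g]] by (simp add: prodc_def)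
  finally show ?thesis
    by (simp add: cmor_def ty_def prodc_def tcomp_assoc tens_comp cmor_cun[OF f] cmor_cun[OF g])
qed

text \<open>The counit law followed by \<open>cun X\<close> is the compatibility with
  comultiplications. Together with \<open>cmor_unitc_unique\<close> it makes the unit comonoid
  terminal.\<close>

lemma cmor_cun_unitc:
  assumes [simp]: "coc X"
  shows "cmor X unitc (cun X)"
proof -
  have "lu Unit \<bullet> (cun X \<star> cun X) \<bullet> cmu X = lu Unit \<bullet> (idt Unit \<star> cun X) \<bullet> (cun X \<star> idt (cob X)) \<bullet> cmu X"
    by (simp add: tens_comp_comp)
  also have "\<dots> = cun X \<bullet> lu (cob X) \<bullet> (cun X \<star> idt (cob X)) \<bullet> cmu X"
    using comp_rewr[OF lu_nat[of "cun X"]] by simp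
  also have "\<dots> = cun X"
    by (simp add: coc_lunit)
  finally have "lui Unit \<bullet> cun X = lui Unit \<bullet> lu Unit \<bullet> (cun X \<star> cun X) \<bullet> cmu X"
    by simp
  then show ?thesis
    by (simp add: cmor_def ty_def unitc_def)
qed

lemma cmor_unitc_unique: "cmor X unitc f \<Longrightarrow> f = cun X"
  using cmor_cun[of X unitc f] cmor_ty[of X unitc f] by (simp add: unitc_def)

lemma cun_cmu:
  assumes [simp]: "coc X"
  shows "lu Unit \<bullet> (cun X \<star> cun X) \<bullet> cmu X = cun X"
  using cmor_cmu[OF cmor_cun_unitc[OF assms], symmetric] by (simp add: unitc_def)

text \<open>The place where cocommutativity is decisive: coassociativity rearranges the four copies
  so that the two middle ones come from a single comultiplication, and the exchange is absorbed
  there. As a comonoid morphism, the comultiplication becomes the diagonal of a categorical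
  product.\<close>

lemma cmor_cmu_prodc:
  assumes [simp]: "coc X"
  shows "cmor X (prodc X X) (cmu X)"
proof -
  let ?a = "cob X" and ?D = "cmu X"
  let ?Y = "(idt ?a \<star> (al ?a ?a ?a \<bullet> (?D \<star> idt ?a) \<bullet> ?D)) \<bullet> ?D"
  have "al ?a ?a (?a \<diamondop> ?a) \<bullet> (?D \<star> ?D) \<bullet> ?D = al ?a ?a (?a \<diamondop> ?a) \<bullet> ((idt ?a \<star> idt ?a) \<star> ?D) \<bullet> (?D \<star> idt ?a) \<bullet> ?D"
    by (simp add: tens_comp_comp)
  also have "\<dots> = (idt ?a \<star> (idt ?a \<star> ?D)) \<bullet> al ?a ?a ?a \<bullet> (?D \<star> idt ?a) \<bullet> ?D"
    by (subst comp_rewr[OF al_nat]) auto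
  also have "\<dots> = (idt ?a \<star> ((idt ?a \<star> ?D) \<bullet> ?D)) \<bullet> ?D"
    by (simp add: coc_assoc tens_comp_comp)
  finally have Y: "al ?a ?a (?a \<diamondop> ?a) \<bullet> (?D \<star> ?D) \<bullet> ?D = ?Y"
    by (simp add: coc_assoc)
  have "ms ?a ?a ?a ?a \<bullet> (?D \<star> ?D) \<bullet> ?D
      = ali ?a ?a (?a \<diamondop> ?a) \<bullet> (idt ?a \<star> (al ?a ?a ?a \<bullet> (br ?a ?a \<star> idt ?a) \<bullet> ali ?a ?a ?a)) \<bullet> ?Y"
    by (simp add: ms_def tcomp_assoc Y tens_comp_comp)
  also have "\<dots> = ali ?a ?a (?a \<diamondop> ?a) \<bullet> ?Y"
    by (simp add: tens_comp_comp tcomp_assoc coc_comm)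
  also have "\<dots> = (?D \<star> ?D) \<bullet> ?D"
    by (simp flip: Y)
  finally show ?thesis
    by (simp add: cmor_def ty_def prodc_def tcomp_assoc cun_cmu)
qed

section \<open>The tensor product as categorical product\<close>

definition pair :: "('o, 'm, 'y) coalg_scheme \<Rightarrow> ('o, 'm) tarr \<Rightarrow> ('o, 'm) tarr \<Rightarrow> ('o, 'm) tarr" where
  "pair X f g = (f \<star> g) \<bullet> cmu X"

definition pr1 :: "('o, 'm, 'y) coalg_scheme \<Rightarrow> ('o, 'm, 'x) coalg_scheme \<Rightarrow> ('o, 'm) tarr" where
  "pr1 X Y = ru (cob X) \<bullet> (idt (cob X) \<star> cun Y)"

definition pr2 :: "('o, 'm, 'y) coalg_scheme \<Rightarrow> ('o, 'm, 'x) coalg_scheme \<Rightarrow> ('o, 'm) tarr" where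
  "pr2 X Y = lu (cob Y) \<bullet> (cun X \<star> idt (cob Y))"

lemma cmor_pair:
  assumes "coc X" "coc Y" "coc Z" "cmor X Y f" "cmor X Z g"
  shows "cmor X (prodc Y Z) (pair X f g)"
  unfolding pair_def using assms by (intro cmor_comp[OF cmor_cmu_prodc] cmor_tens)

lemma cmor_ru:
  assumes [simp]: "coc X"
  shows "cmor (prodc X unitc) X (ru (cob X))"
proof -
  let ?a = "cob X"
  have *: "(ru ?a \<star> ru ?a) \<bullet> ms ?a ?a Unit Unit = ru (?a \<diamondop> ?a) \<bullet> (idt (?a \<diamondop> ?a) \<star> lu Unit)"
    and **: "lu Unit = ru Unit"
    by (rule nf_inj; simp add: nf_comp nf_tens)+
  have "(ru ?a \<star> ru ?a) \<bullet> ms ?a ?a Unit Unit \<bullet> (cmu X \<star> lui Unit) = ru (?a \<diamondop> ?a) \<bullet> (cmu X \<star> idt Unit)"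
    by (simp add: comp_rewr[OF *] tens_comp)
  also have "\<dots> = cmu X \<bullet> ru ?a"
    by (simp add: ru_nat)
  finally show ?thesis
    using ru_nat[of "cun X" Unit] by (simp add: cmor_def ty_def prodc_def unitc_def **)
qed

lemma cmor_lu:
  assumes [simp]: "coc X"
  shows "cmor (prodc unitc X) X (lu (cob X))"
proof -
  let ?a = "cob X"
  have *: "(lu ?a \<star> lu ?a) \<bullet> ms Unit Unit ?a ?a = lu (?a \<diamondop> ?a) \<bullet> (lu Unit \<star> idt (?a \<diamondop> ?a))"
    by (rule nf_inj; simp add: nf_comp nf_tens)+
  have "(lu ?a \<star> lu ?a) \<bullet> ms Unit Unit ?a ?a \<bullet> (lui Unit \<star> cmu X) = lu (?a \<diamondop> ?a) \<bullet> (idt Unit \<star> cmu X)"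
    by (simp add: comp_rewr[OF *] tens_comp)
  also have "\<dots> = cmu X \<bullet> lu ?a"
    by (simp add: lu_nat)
  finally show ?thesis
    using lu_nat[of "cun X" Unit] by (simp add: cmor_def ty_def prodc_def unitc_def)
qed

lemma cmor_pr1:
  assumes [simp]: "coc X" "coc Y"
  shows "cmor (prodc X Y) X (pr1 X Y)"
  unfolding pr1_def by (intro cmor_comp[OF cmor_tens cmor_ru] cmor_idt cmor_cun_unitc) auto

lemma cmor_pr2:
  assumes [simp]: "coc X" "coc Y"
  shows "cmor (prodc X Y) Y (pr2 X Y)"
  unfolding pr2_def by (intro cmor_comp[OF cmor_tens cmor_lu] cmor_idt cmor_cun_unitc) auto

lemma pr1_tens:
  assumes "arr f" "arr g" "tgt f = cob X" "tgt g = cob Y" "coc X" "coc Y"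
  shows "pr1 X Y \<bullet> (f \<star> g) = f \<bullet> ru (src f) \<bullet> (idt (src f) \<star> (cun Y \<bullet> g))"
proof -
  have "pr1 X Y \<bullet> (f \<star> g) = ru (cob X) \<bullet> (f \<star> idt Unit) \<bullet> (idt (src f) \<star> (cun Y \<bullet> g))"
    using assms by (simp add: pr1_def tcomp_assoc tens_comp)
  then show ?thesis
    using comp_rewr[OF ru_nat[of f "cob X"]] assms by simp
qed

lemma pr2_tens:
  assumes "arr f" "arr g" "tgt f = cob X" "tgt g = cob Y" "coc X" "coc Y"
  shows "pr2 X Y \<bullet> (f \<star> g) = g \<bullet> lu (src g) \<bullet> ((cun X \<bullet> f) \<star> idt (src g))"
proof -
  have "pr2 X Y \<bullet> (f \<star> g) = lu (cob Y) \<bullet> (idt Unit \<star> g) \<bullet> ((cun X \<bullet> f) \<star> idt (src g))"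
    using assms by (simp add: pr2_def tcomp_assoc tens_comp)
  then show ?thesis
    using comp_rewr[OF lu_nat[of g "cob Y"]] assms by simp
qed

lemma pr1_pair:
  assumes [simp]: "coc X" "coc Y" "coc Z" and f: "ty f (cob X) (cob Y)" and g: "ty g (cob X) (cob Z)" "cun Z \<bullet> g = cun X"
  shows "pr1 Y Z \<bullet> pair X f g = f"
proof -
  note [simp] = tyD[OF f] tyD[OF g(1)]
  have "pr1 Y Z \<bullet> pair X f g = f \<bullet> (ru (cob X) \<bullet> (idt (cob X) \<star> cun X) \<bullet> cmu X)"
    using pr1_tens[of f g Y Z] by (simp add: pair_def g flip: tcomp_assoc)
  then show ?thesis by (simp add: coc_runit)
qed

text \<open>The selected component g is merely typed, so that \<open>cmor_ginv\<close> can take it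
  to be the antipode before that is known to be a comonoid morphism.\<close>

lemma pr2_pair:
  assumes [simp]: "coc X" "coc Y" "coc Z" and f: "ty f (cob X) (cob Y)" "cun Y \<bullet> f = cun X" and g: "ty g (cob X) (cob Z)"
  shows "pr2 Y Z \<bullet> pair X f g = g"
proof -
  note [simp] = tyD[OF f(1)] tyD[OF g]
  have "pr2 Y Z \<bullet> pair X f g = g \<bullet> (lu (cob X) \<bullet> (cun X \<star> idt (cob X)) \<bullet> cmu X)"
    using pr2_tens[of f g Y Z] by (simp add: pair_def f flip: tcomp_assoc)
  then show ?thesis by (simp add: coc_lunit)
qed

text \<open>The two projections discard the inner factors, so the exchange only swaps two units and
  disappears by coherence. With \<open>pair_comp\<close> this yields the uniqueness of
  pairings.\<close>

lemma pair_pr: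
  assumes [simp]: "coc X" "coc Y"
  shows "pair (prodc X Y) (pr1 X Y) (pr2 X Y) = idt (cob X \<diamondop> cob Y)"
proof -
  let ?a = "cob X" and ?b = "cob Y"
  have *: "(ru ?a \<star> lu ?b) \<bullet> ms ?a Unit Unit ?b = ru ?a \<star> lu ?b"
    by (rule nf_inj) (simp_all add: nf_comp nf_tens)
  have "pair (prodc X Y) (pr1 X Y) (pr2 X Y)
      = (ru ?a \<star> lu ?b) \<bullet> ((idt ?a \<star> cun Y) \<star> (cun X \<star> idt ?b)) \<bullet> ms ?a ?a ?b ?b \<bullet> (cmu X \<star> cmu Y)"
    by (simp add: pair_def pr1_def pr2_def prodc_def tens_comp_comp)
  also have "\<dots> = (ru ?a \<star> lu ?b) \<bullet> ms ?a Unit Unit ?b \<bullet> ((idt ?a \<star> cun X) \<star> (cun Y \<star> idt ?b)) \<bullet> (cmu X \<star> cmu Y)"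
    using comp_rewr[OF ms_nat[of "idt ?a" "cun X" "cun Y" "idt ?b"]] by simp
  also have "\<dots> = (ru ?a \<star> lu ?b) \<bullet> ((idt ?a \<star> cun X) \<star> (cun Y \<star> idt ?b)) \<bullet> (cmu X \<star> cmu Y)"
    by (simp add: * flip: tcomp_assoc)
  also have "\<dots> = idt (?a \<diamondop> ?b)"
    by (simp add: tens_comp coc_lunit coc_runit)
  finally show ?thesis .
qed

lemma pair_comp:
  assumes "cmor W X h"
  shows "pair X f g \<bullet> h = pair W (f \<bullet> h) (g \<bullet> h)"
  by (simp add: pair_def tcomp_assoc cmor_cmu[OF assms] tens_comp_comp)

lemma tens_pair: "(f \<star> g) \<bullet> pair X h k = pair X (f \<bullet> h) (g \<bullet> k)"
  by (simp add: pair_def tens_comp_comp)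

lemma pair_eta:
  assumes [simp]: "coc X" "coc Y" and h: "cmor W (prodc X Y) h"
  shows "pair W (pr1 X Y \<bullet> h) (pr2 X Y \<bullet> h) = h"
  using pair_comp[OF h, of "pr1 X Y" "pr2 X Y"] pair_pr[of X Y] cmor_ty[OF h] by simp

lemma cmor_al:
  assumes [simp]: "coc X" "coc Y" "coc Z"
  shows "cmor (prodc (prodc X Y) Z) (prodc X (prodc Y Z)) (al (cob X) (cob Y) (cob Z))"
proof -
  let ?a = "cob X" and ?b = "cob Y" and ?c = "cob Z"
  let ?al = "al ?a ?b ?c"
  have "(?al \<star> ?al) \<bullet> cmu (prodc (prodc X Y) Z)
     = ((?al \<star> ?al) \<bullet> ms (?a \<diamondop> ?b) (?a \<diamondop> ?b) ?c ?c \<bullet> (ms ?a ?a ?b ?b \<star> idt (?c \<diamondop> ?c))) \<bullet> ((cmu X \<star> cmu Y) \<star> cmu Z)"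
    by (simp add: prodc_def tens_comp tcomp_assoc)
  also have "\<dots> = ms ?a ?a (?b \<diamondop> ?c) (?b \<diamondop> ?c) \<bullet> (idt (?a \<diamondop> ?a) \<star> ms ?b ?b ?c ?c) \<bullet> (cmu X \<star> (cmu Y \<star> cmu Z)) \<bullet> ?al"
    by (simp add: ms_al tcomp_assoc al_nat)
  also have "\<dots> = cmu (prodc X (prodc Y Z)) \<bullet> ?al"
    by (simp add: prodc_def tens_comp_comp tcomp_assoc)
  finally have 1: "cmu (prodc X (prodc Y Z)) \<bullet> ?al = (?al \<star> ?al) \<bullet> cmu (prodc (prodc X Y) Z)" by simp
  have *: "lu Unit \<bullet> (lu Unit \<star> idt Unit) = (lu Unit \<bullet> (idt Unit \<star> lu Unit)) \<bullet> al Unit Unit Unit"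
    by (rule nf_inj) (simp_all add: nf_comp nf_tens)
  have "cun (prodc (prodc X Y) Z) = (lu Unit \<bullet> (lu Unit \<star> idt Unit)) \<bullet> ((cun X \<star> cun Y) \<star> cun Z)"
    by (simp add: prodc_def tens_comp tcomp_assoc)
  also have "\<dots> = lu Unit \<bullet> (idt Unit \<star> lu Unit) \<bullet> (cun X \<star> (cun Y \<star> cun Z)) \<bullet> ?al"
    unfolding * by (simp add: al_nat tcomp_assoc)
  also have "\<dots> = cun (prodc X (prodc Y Z)) \<bullet> ?al"
    by (simp add: prodc_def tens_comp_comp tcomp_assoc)
  finally show ?thesis
    using 1 by (simp add: cmor_def ty_def)
qed

end

section \<open>Equalizers of cocommutative comonoids\<close>

context symmetric_monoidal_category
begin

text \<open>The typing of y is implicit: a composite equal to the arrow x is defined, which fixes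
  both ends of y by \<open>arr_comp_eq\<close>.\<close>

definition teq :: "('o, 'm) tarr \<Rightarrow> ('o, 'm) tarr \<Rightarrow> ('o, 'm) tarr \<Rightarrow> bool" where
  "teq f g e \<longleftrightarrow> arr f \<and> arr g \<and> src f = src g \<and> tgt f = tgt g \<and> arr e \<and> tgt e = src f \<and> f \<bullet> e = g \<bullet> e \<and>
     (\<forall>x. arr x \<longrightarrow> tgt x = src f \<longrightarrow> f \<bullet> x = g \<bullet> x \<longrightarrow> (\<exists>!y. e \<bullet> y = x))"

definition tmono :: "('o, 'm) tarr \<Rightarrow> bool" where
  "tmono e \<longleftrightarrow> arr e \<and> (\<forall>x y. arr (e \<bullet> x) \<longrightarrow> e \<bullet> x = e \<bullet> y \<longrightarrow> x = y)"

lemma arr_comp_eq: "e \<bullet> y = x \<Longrightarrow> arr x \<Longrightarrow> arr y \<and> tgt y = src e \<and> src y = src x"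
  by auto

text \<open>Every object X of M is the value of the one-letter word \<open>Leaf X\<close>, and an
  arrow of M between values of words lifts to a typed arrow; so testing against words is the same as
  testing against objects.\<close>

lemma teq_iff:
  assumes "arr f" "arr g" "src f = src g" "tgt f = tgt g" "arr e" "tgt e = src f"
  shows "teq f g e \<longleftrightarrow>
    is_equalizer M (tob (src f)) (tob (tgt f)) (raw f) (raw g) (tob (src e)) (raw e)"
proof
  assume t: "teq f g e"
  have "\<exists>!v. v \<in> Hom M X (tob (src e)) \<and> raw e \<cdot> v = u"
    if X: "X \<in> Ob M" and u: "u \<in> Hom M X (tob (src f))" "raw f \<cdot> u = raw g \<cdot> u" for X u
  proof -
    define x where "x = Arr (Leaf X) u (src f)"
    have x [simp]: "arr x" "tgt x = src f" "src x = Leaf X" "raw x = u"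
      using X u assms by (simp_all add: x_def arr_Arr)
    have "f \<bullet> x = g \<bullet> x"
      by (rule arr_eqI) (use assms u in \<open>auto simp: raw_simps\<close>)
    with t have ex: "\<exists>!y. e \<bullet> y = x" by (simp add: teq_def)
    then obtain y where y: "e \<bullet> y = x" by blast
    have y' [simp]: "arr y" "tgt y = src e" "src y = Leaf X" using arr_comp_eq[OF y] by auto
    have "raw e \<cdot> raw y = u" using y raw_simps(1)[of e y] assms by simp
    moreover have "raw y \<in> Hom M X (tob (src e))" using arr_raw[of y] by simp
    moreover have "v = raw y" if v: "v \<in> Hom M X (tob (src e))" "raw e \<cdot> v = u" for v
    proof -
      define z where "z = Arr (Leaf X) v (src e)"
      have z [simp]: "arr z" "tgt z = src e" "src z = Leaf X" "raw z = v"
        using X v assms by (simp_all add: z_def arr_Arr)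
      have "e \<bullet> z = x"
        by (rule arr_eqI) (use assms v in \<open>auto simp: raw_simps\<close>)
      with ex y have "z = y" by blast
      then show ?thesis using z by auto
    qed
    ultimately show ?thesis by blast
  qed
  moreover have "raw f \<cdot> raw e = raw g \<cdot> raw e"
    using t raw_simps(1)[of f e] raw_simps(1)[of g e] unfolding teq_def by auto
  ultimately show "is_equalizer M (tob (src f)) (tob (tgt f)) (raw f) (raw g) (tob (src e)) (raw e)"
    using assms arr_raw[of e] by (simp add: is_equalizer_def)
next
  assume t: "is_equalizer M (tob (src f)) (tob (tgt f)) (raw f) (raw g) (tob (src e)) (raw e)"
  have "f \<bullet> e = g \<bullet> e"
    by (rule arr_eqI) (use assms t in \<open>auto simp: raw_simps is_equalizer_def\<close>)
  moreover have "\<exists>!y. e \<bullet> y = x" if x: "arr x" "tgt x = src f" "f \<bullet> x = g \<bullet> x" for x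
  proof -
    have "raw f \<cdot> raw x = raw g \<cdot> raw x"
      using x raw_simps(1)[of f x] raw_simps(1)[of g x] assms by auto
    then have ex: "\<exists>!v. v \<in> Hom M (tob (src x)) (tob (src e)) \<and> raw e \<cdot> v = raw x"
      using t x arr_raw[of x] by (simp add: is_equalizer_def)
    then obtain v where v: "v \<in> Hom M (tob (src x)) (tob (src e))" "raw e \<cdot> v = raw x" by blast
    define y where "y = Arr (src x) v (src e)"
    have y [simp]: "arr y" "tgt y = src e" "src y = src x" "raw y = v"
      using x v assms by (simp_all add: y_def arr_Arr)
    have "e \<bullet> y = x"
      by (rule arr_eqI) (use assms x v in \<open>auto simp: raw_simps\<close>)
    moreover have "z = y" if z: "e \<bullet> z = x" for z
    proof -
      have z' [simp]: "arr z" "tgt z = src e" "src z = src x" using arr_comp_eq[OF z] x by auto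
      have "raw e \<cdot> raw z = raw x" using raw_simps(1)[of e z] assms z x by auto
      then have "raw z = v" using ex v arr_raw[of z] by auto
      then show ?thesis by (intro arr_eqI) auto
    qed
    ultimately show ?thesis by blast
  qed
  ultimately show "teq f g e"
    using assms by (simp add: teq_def)
qed

lemma teq_tmono:
  assumes t: "teq f g e"
  shows "tmono e"
  unfolding tmono_def
proof (intro conjI allI impI)
  fix x y assume x: "arr (e \<bullet> x)" and eq: "e \<bullet> x = e \<bullet> y"
  have "f \<bullet> e \<bullet> x = g \<bullet> e \<bullet> x"
    using t by (simp add: teq_def flip: tcomp_assoc)
  moreover have "tgt (e \<bullet> x) = src f" using x t by (simp add: teq_def)
  ultimately have "\<exists>!z. e \<bullet> z = e \<bullet> x" using t x by (simp add: teq_def)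
  then show "x = y" using eq by metis
qed (use t in \<open>simp add: teq_def\<close>)

lemma tmonoD: "\<lbrakk>tmono e; arr (e \<bullet> x); e \<bullet> x = e \<bullet> y\<rbrakk> \<Longrightarrow> x = y"
  unfolding tmono_def by blast

lemma tmono_comp: "\<lbrakk>tmono e; tmono e'; src e = tgt e'\<rbrakk> \<Longrightarrow> tmono (e \<bullet> e')"
proof -
  assume e: "tmono e" and e': "tmono e'" "src e = tgt e'"
  have "x = y" if x: "arr ((e \<bullet> e') \<bullet> x)" and xy: "(e \<bullet> e') \<bullet> x = (e \<bullet> e') \<bullet> y" for x y
  proof -
    have "arr (e \<bullet> e' \<bullet> x)" "e \<bullet> e' \<bullet> x = e \<bullet> e' \<bullet> y"
      using x xy by (simp_all only: tcomp_assoc)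
    then have "e' \<bullet> x = e' \<bullet> y" by (rule tmonoD[OF e])
    moreover have "arr (e' \<bullet> x)" using x by auto
    ultimately show ?thesis using tmonoD[OF e'(1)] by blast
  qed
  then show ?thesis
    using e e' unfolding tmono_def arr_comp by blast
qed

end

locale equalizer_monoidal_category = symmetric_monoidal_category M
  for M :: "('o, 'm, 'z) moncat_scheme" (structure) +
  assumes equalizers: "has_equalizers M"
    and tensor_equalizers: "tensor_preserves_equalizers M"
begin

lemma teq_exists:
  assumes "arr f" "arr g" "src f = src g" "tgt f = tgt g"
  obtains e where "teq f g e"
proof -
  obtain E e where e: "is_equalizer M (tob (src f)) (tob (tgt f)) (raw f) (raw g) E e"
    using equalizers assms arr_raw[of f] arr_raw[of g] arr_wf[of f] arr_wf[of g]
    unfolding has_equalizers_def by (metis tob_Ob)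
  have "teq f g (Arr (Leaf E) e (src f))"
    by (subst teq_iff) (use assms e in \<open>auto simp: arr_Arr is_equalizer_def\<close>)
  then show ?thesis by (rule that)
qed

lemma teq_tens:
  assumes t: "teq f g e" and z [simp]: "wf_tree z"
  shows "teq (idt z \<star> f) (idt z \<star> g) (idt z \<star> e)" "teq (f \<star> idt z) (g \<star> idt z) (e \<star> idt z)"
proof -
  have a: "arr f" "arr g" "src f = src g" "tgt f = tgt g" "arr e" "tgt e = src f"
    using t by (auto simp: teq_def)
  have q: "is_equalizer M (tob (src f)) (tob (tgt f)) (raw f) (raw g) (tob (src e)) (raw e)"
    using t teq_iff[OF a] by simp
  have p: "preserves_equalizers M M (\<lambda>A. tob z \<otimes>\<^sub>o A) (\<lambda>f. Id M (tob z) \<otimes>\<^sub>a f)"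
       "preserves_equalizers M M (\<lambda>A. A \<otimes>\<^sub>o tob z) (\<lambda>f. f \<otimes>\<^sub>a Id M (tob z))"
    using tensor_equalizers by (auto simp: tensor_preserves_equalizers_def)
  have H: "raw f \<in> Hom M (tob (src f)) (tob (tgt f))" "raw g \<in> Hom M (tob (src f)) (tob (tgt f))"
    using a arr_raw[of f] arr_raw[of g] by auto
  have w: "tob (src f) \<in> Ob M" "tob (tgt f) \<in> Ob M" using a by auto
  show "teq (idt z \<star> f) (idt z \<star> g) (idt z \<star> e)"
    by (subst teq_iff) (use a q H w p(1) in \<open>auto simp: raw_simps preserves_equalizers_def\<close>)
  show "teq (f \<star> idt z) (g \<star> idt z) (e \<star> idt z)"
    by (subst teq_iff) (use a q H w p(2) in \<open>auto simp: raw_simps preserves_equalizers_def\<close>)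
qed

text \<open>Each factorisation consists of copies of e whiskered by identities, which are equalizers
  by preservation and hence monomorphisms. These monomorphisms will reflect the comonoid laws to the
  domain of e.\<close>

lemma teq_tens_mono:
  assumes "teq f g e"
  shows "tmono (e \<star> e)" "tmono (e \<star> (e \<star> e))"
proof -
  have [simp]: "arr e" "arr f" "tgt e = src f" using assms by (auto simp: teq_def)
  let ?s = "src f"
  have 1: "tmono (e \<star> idt ?s)" "tmono (idt (src e) \<star> e)" "tmono (e \<star> idt (?s \<diamondop> ?s))"
    "tmono (idt (src e) \<star> (e \<star> idt ?s))" "tmono (idt (src e) \<star> (idt (src e) \<star> e))"
    by (rule teq_tmono, (rule teq_tens | rule assms | simp)+)+
  have "e \<star> e = (e \<star> idt ?s) \<bullet> (idt (src e) \<star> e)"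
    "e \<star> (e \<star> e) = (e \<star> idt (?s \<diamondop> ?s)) \<bullet> (idt (src e) \<star> (e \<star> idt ?s)) \<bullet> (idt (src e) \<star> (idt (src e) \<star> e))"
    by (simp_all add: tens_comp tens_comp_comp)
  then show "tmono (e \<star> e)" "tmono (e \<star> (e \<star> e))"
    using 1 by (auto intro!: tmono_comp)
qed

text \<open>By cocommutativity the equalizer in \<open>M\<close> of \<open>(f \<otimes> 1) \<Delta>\<close> and \<open>(g \<otimes> 1) \<Delta>\<close> is already a
  subcomonoid, so the two-sided maps \<open>(1 \<otimes> f \<otimes> 1) \<Delta>\<^sup>2\<close> of the general construction are not needed.\<close>

lemma coc_equalizer:
  assumes X [simp]: "coc X" and Y [simp]: "coc Y" and f: "cmor X Y f" and g: "cmor X Y g"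
  obtains E :: "('o, 'm) coalg" and e
  where "coc E" "cmor E X e" "f \<bullet> e = g \<bullet> e" "tmono e"
    "\<And>(W :: ('o, 'm) coalg) h. \<lbrakk>coc W; cmor W X h; f \<bullet> h = g \<bullet> h\<rbrakk> \<Longrightarrow> \<exists>k. cmor W E k \<and> e \<bullet> k = h"
proof -
  note [simp] = cmor_ty(1-3)[OF f] cmor_ty(1-3)[OF g]
  let ?s = "cob X" and ?b = "cob Y" and ?D = "cmu X"
  define F where "F = (f \<star> idt ?s) \<bullet> ?D"
  define G where "G = (g \<star> idt ?s) \<bullet> ?D"
  have F [simp]: "arr F" "src F = ?s" "tgt F = ?b \<diamondop> ?s" by (auto simp: F_def)
  have G [simp]: "arr G" "src G = ?s" "tgt G = ?b \<diamondop> ?s" by (auto simp: G_def)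
  obtain e where t: "teq F G e" using teq_exists[of F G] by auto
  let ?E = "src e"
  have [simp]: "arr e" "tgt e = ?s" and eq: "F \<bullet> e = G \<bullet> e" using t by (auto simp: teq_def)
  have m: "tmono e" "tmono (e \<star> e)" "tmono (e \<star> (e \<star> e))"
    using teq_tmono[OF t] teq_tens_mono[OF t] by auto
  \<comment> \<open>Coassociativity expresses the comultiplication followed by
    \<open>F \<star> idt ?s\<close> through F itself, so that \<open>?D \<bullet> e\<close>
    equalizes \<open>F \<star> idt ?s\<close> and \<open>G \<star> idt ?s\<close>.\<close>
  have R: "(((h \<star> idt ?s) \<bullet> ?D) \<star> idt ?s) \<bullet> ?D = ali ?b ?s ?s \<bullet> (idt ?b \<star> ?D) \<bullet> ((h \<star> idt ?s) \<bullet> ?D)"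
    if [simp]: "arr h" "src h = ?s" "tgt h = ?b" for h
  proof -
    have "al ?b ?s ?s \<bullet> (((h \<star> idt ?s) \<bullet> ?D) \<star> idt ?s) \<bullet> ?D = al ?b ?s ?s \<bullet> ((h \<star> idt ?s) \<star> idt ?s) \<bullet> (?D \<star> idt ?s) \<bullet> ?D"
      by (simp add: tens_comp_comp)
    also have "\<dots> = (h \<star> (idt ?s \<star> idt ?s)) \<bullet> (idt ?s \<star> ?D) \<bullet> ?D"
      by (subst comp_rewr[OF al_nat]) (auto simp: coc_assoc)
    also have "\<dots> = (idt ?b \<star> ?D) \<bullet> ((h \<star> idt ?s) \<bullet> ?D)"
      by (simp add: tens_comp_comp)
    finally have "ali ?b ?s ?s \<bullet> al ?b ?s ?s \<bullet> (((h \<star> idt ?s) \<bullet> ?D) \<star> idt ?s) \<bullet> ?D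
       = ali ?b ?s ?s \<bullet> (idt ?b \<star> ?D) \<bullet> ((h \<star> idt ?s) \<bullet> ?D)" by simp
    then show ?thesis by simp
  qed
  \<comment> \<open>Cocommutativity carries this over to the other tensor factor, so the one-sided
    equalizer controls both legs of \<open>?D \<bullet> e\<close>.\<close>
  have L: "(idt ?s \<star> ((h \<star> idt ?s) \<bullet> ?D)) \<bullet> ?D = al ?s ?b ?s \<bullet> (br ?b ?s \<star> idt ?s) \<bullet> (((h \<star> idt ?s) \<bullet> ?D) \<star> idt ?s) \<bullet> ?D"
    if [simp]: "arr h" "src h = ?s" "tgt h = ?b" for h
  proof -
    have *: "br ?b ?s \<bullet> (h \<star> idt ?s) \<bullet> ?D = (idt ?s \<star> h) \<bullet> ?D"
      by (subst comp_rewr[OF br_nat]) (auto simp: coc_comm)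
    have "al ?s ?b ?s \<bullet> (br ?b ?s \<star> idt ?s) \<bullet> (((h \<star> idt ?s) \<bullet> ?D) \<star> idt ?s) \<bullet> ?D
       = al ?s ?b ?s \<bullet> ((idt ?s \<star> h) \<star> idt ?s) \<bullet> (?D \<star> idt ?s) \<bullet> ?D"
      by (simp add: tens_comp_comp *)
    also have "\<dots> = (idt ?s \<star> (h \<star> idt ?s)) \<bullet> (idt ?s \<star> ?D) \<bullet> ?D"
      by (subst comp_rewr[OF al_nat]) (auto simp: coc_assoc)
    finally show ?thesis by (simp add: tens_comp_comp)
  qed
  have "(F \<star> idt ?s) \<bullet> ?D \<bullet> e = ali ?b ?s ?s \<bullet> (idt ?b \<star> ?D) \<bullet> F \<bullet> e"
    using R[of f, folded F_def] by (simp flip: tcomp_assoc)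
  also have "\<dots> = ali ?b ?s ?s \<bullet> (idt ?b \<star> ?D) \<bullet> G \<bullet> e"
    by (simp add: eq)
  also have "\<dots> = (G \<star> idt ?s) \<bullet> ?D \<bullet> e"
    using R[of g, folded G_def] by (simp flip: tcomp_assoc)
  finally have 1: "(F \<star> idt ?s) \<bullet> ?D \<bullet> e = (G \<star> idt ?s) \<bullet> ?D \<bullet> e" .
  then have "\<exists>!d. (e \<star> idt ?s) \<bullet> d = ?D \<bullet> e"
    using teq_tens(2)[OF t, of ?s] by (simp add: teq_def)
  then obtain d where d: "(e \<star> idt ?s) \<bullet> d = ?D \<bullet> e" by blast
  have [simp]: "arr d" "tgt d = ?E \<diamondop> ?s" "src d = ?E"
    using arr_comp_eq[OF d] by auto
  \<comment> \<open>The first leg now factors through e. To factor the second one, d has to equalize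
    \<open>idt ?E \<star> F\<close> and \<open>idt ?E \<star> G\<close>, which is tested after the
    monomorphism \<open>e \<star> idt (?b \<diamondop> ?s)\<close>.\<close>
  have "(e \<star> idt (?b \<diamondop> ?s)) \<bullet> (idt ?E \<star> F) \<bullet> d = (idt ?s \<star> F) \<bullet> ?D \<bullet> e"
    by (simp add: tens_comp_comp flip: d)
  also have "\<dots> = al ?s ?b ?s \<bullet> (br ?b ?s \<star> idt ?s) \<bullet> (F \<star> idt ?s) \<bullet> ?D \<bullet> e"
    using L[of f, folded F_def] by (simp flip: tcomp_assoc)
  also have "\<dots> = (idt ?s \<star> G) \<bullet> ?D \<bullet> e"
    unfolding 1 using L[of g, folded G_def] by (simp flip: tcomp_assoc)
  also have "\<dots> = (e \<star> idt (?b \<diamondop> ?s)) \<bullet> (idt ?E \<star> G) \<bullet> d"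
    by (simp add: tens_comp_comp flip: d)
  finally have "(idt ?E \<star> F) \<bullet> d = (idt ?E \<star> G) \<bullet> d"
    by (rule tmonoD[OF teq_tmono[OF teq_tens(2)[OF t]], rotated 2]) simp_all
  then have "\<exists>!\<delta>. (idt ?E \<star> e) \<bullet> \<delta> = d"
    using teq_tens(1)[OF t, of ?E] by (simp add: teq_def)
  then obtain \<delta> where \<delta>: "(idt ?E \<star> e) \<bullet> \<delta> = d" by blast
  have [simp]: "arr \<delta>" "tgt \<delta> = ?E \<diamondop> ?E" "src \<delta> = ?E"
    using arr_comp_eq[OF \<delta>] by auto
  have ee: "(e \<star> e) \<bullet> \<delta> = ?D \<bullet> e"
    by (simp add: tens_comp_comp flip: d \<delta>)
  have ee1: "((e \<star> e) \<star> e) \<bullet> (\<delta> \<star> idt ?E) = (?D \<star> idt ?s) \<bullet> (e \<star> e)"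
    and ee2: "(e \<star> (e \<star> e)) \<bullet> (idt ?E \<star> \<delta>) = (idt ?s \<star> ?D) \<bullet> (e \<star> e)"
    by (simp_all add: tens_comp ee)
  define E where "E = \<lparr>cob = ?E, cmu = \<delta>, cun = cun X \<bullet> e\<rparr>"
  have [simp]: "cob E = ?E" "cmu E = \<delta>" "cun E = cun X \<bullet> e" by (auto simp: E_def)
  \<comment> \<open>Each law of E is the restriction of a law of X along e, reflected by the
    monomorphism e, \<open>e \<star> e\<close> or \<open>e \<star> (e \<star> e)\<close> that fits
    its target.\<close>
  have "(e \<star> (e \<star> e)) \<bullet> al ?E ?E ?E \<bullet> (\<delta> \<star> idt ?E) \<bullet> \<delta> = al ?s ?s ?s \<bullet> ((e \<star> e) \<star> e) \<bullet> (\<delta> \<star> idt ?E) \<bullet> \<delta>"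
    by (subst comp_rewr[OF al_nat]) auto
  also have "\<dots> = al ?s ?s ?s \<bullet> (?D \<star> idt ?s) \<bullet> (e \<star> e) \<bullet> \<delta>"
    by (simp only: comp_rewr[OF ee1])
  also have "\<dots> = (al ?s ?s ?s \<bullet> (?D \<star> idt ?s) \<bullet> ?D) \<bullet> e"
    by (simp add: ee tcomp_assoc)
  also have "\<dots> = (idt ?s \<star> ?D) \<bullet> (e \<star> e) \<bullet> \<delta>"
    by (simp add: ee coc_assoc tcomp_assoc)
  also have "\<dots> = (e \<star> (e \<star> e)) \<bullet> (idt ?E \<star> \<delta>) \<bullet> \<delta>"
    by (simp only: comp_rewr[OF ee2])
  finally have a1: "al ?E ?E ?E \<bullet> (\<delta> \<star> idt ?E) \<bullet> \<delta> = (idt ?E \<star> \<delta>) \<bullet> \<delta>"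
    by (rule tmonoD[OF m(3), rotated]) simp
  have "e \<bullet> lu ?E \<bullet> ((cun X \<bullet> e) \<star> idt ?E) \<bullet> \<delta> = lu ?s \<bullet> (idt Unit \<star> e) \<bullet> ((cun X \<bullet> e) \<star> idt ?E) \<bullet> \<delta>"
    by (subst comp_rewr[OF lu_nat]) auto
  also have "\<dots> = lu ?s \<bullet> (cun X \<star> idt ?s) \<bullet> (e \<star> e) \<bullet> \<delta>"
    by (simp add: tens_comp_comp)
  also have "\<dots> = (lu ?s \<bullet> (cun X \<star> idt ?s) \<bullet> ?D) \<bullet> e"
    by (simp add: ee tcomp_assoc)
  also have "\<dots> = e \<bullet> idt ?E"
    by (simp add: coc_lunit)
  finally have a2: "lu ?E \<bullet> ((cun X \<bullet> e) \<star> idt ?E) \<bullet> \<delta> = idt ?E"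
    by (rule tmonoD[OF m(1), rotated]) simp
  have "e \<bullet> ru ?E \<bullet> (idt ?E \<star> (cun X \<bullet> e)) \<bullet> \<delta> = ru ?s \<bullet> (e \<star> idt Unit) \<bullet> (idt ?E \<star> (cun X \<bullet> e)) \<bullet> \<delta>"
    by (subst comp_rewr[OF ru_nat]) auto
  also have "\<dots> = ru ?s \<bullet> (idt ?s \<star> cun X) \<bullet> (e \<star> e) \<bullet> \<delta>"
    by (simp add: tens_comp_comp)
  also have "\<dots> = (ru ?s \<bullet> (idt ?s \<star> cun X) \<bullet> ?D) \<bullet> e"
    by (simp add: ee tcomp_assoc)
  also have "\<dots> = e \<bullet> idt ?E"
    by (simp add: coc_runit)
  finally have a3: "ru ?E \<bullet> (idt ?E \<star> (cun X \<bullet> e)) \<bullet> \<delta> = idt ?E"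
    by (rule tmonoD[OF m(1), rotated]) simp
  have "(e \<star> e) \<bullet> br ?E ?E \<bullet> \<delta> = br ?s ?s \<bullet> (e \<star> e) \<bullet> \<delta>"
    by (subst comp_rewr[OF br_nat]) auto
  also have "\<dots> = (e \<star> e) \<bullet> \<delta>"
    by (simp add: ee coc_comm flip: tcomp_assoc)
  finally have a4: "br ?E ?E \<bullet> \<delta> = \<delta>"
    by (rule tmonoD[OF m(2), rotated]) simp
  have E: "coc E"
    unfolding coc_def ty_def using a1 a2 a3 a4 by (intro conjI) simp_all
  have eX: "cmor E X e"
    by (simp add: cmor_def ty_def ee)
  \<comment> \<open>Applying the counit to the second leg recovers f from F and g from G, so e
    equalizes f and g themselves.\<close>
  have R': "ru ?b \<bullet> (idt ?b \<star> cun X) \<bullet> ((h \<star> idt ?s) \<bullet> ?D) = h"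
    if [simp]: "arr h" "src h = ?s" "tgt h = ?b" for h
  proof -
    have "ru ?b \<bullet> (idt ?b \<star> cun X) \<bullet> ((h \<star> idt ?s) \<bullet> ?D) = ru ?b \<bullet> (h \<star> idt Unit) \<bullet> (idt ?s \<star> cun X) \<bullet> ?D"
      by (simp add: tens_comp_comp)
    also have "\<dots> = h \<bullet> ru ?s \<bullet> (idt ?s \<star> cun X) \<bullet> ?D"
      by (subst comp_rewr[OF ru_nat]) auto
    finally show ?thesis by (simp add: coc_runit)
  qed
  have "f \<bullet> e = ru ?b \<bullet> (idt ?b \<star> cun X) \<bullet> F \<bullet> e"
    using R'[of f, folded F_def] by (simp flip: tcomp_assoc)
  also have "\<dots> = ru ?b \<bullet> (idt ?b \<star> cun X) \<bullet> G \<bullet> e"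
    by (simp add: eq)
  also have "\<dots> = g \<bullet> e"
    using R'[of g, folded G_def] by (simp flip: tcomp_assoc)
  finally have fe: "f \<bullet> e = g \<bullet> e" .
  have "\<exists>k. cmor W E k \<and> e \<bullet> k = h" if W [simp]: "coc W" and h: "cmor W X h" "f \<bullet> h = g \<bullet> h"
    for W :: "('o, 'm) coalg" and h
  proof -
    note [simp] = cmor_ty(1-3)[OF h(1)]
    \<comment> \<open>As h respects comultiplications, \<open>F \<bullet> h\<close> depends only on
      h and \<open>f \<bullet> h\<close>, and likewise for G and g.\<close>
    have "F \<bullet> h = ((f \<bullet> h) \<star> h) \<bullet> cmu W" "G \<bullet> h = ((g \<bullet> h) \<star> h) \<bullet> cmu W"
      by (simp_all add: F_def G_def tcomp_assoc cmor_cmu[OF h(1)] tens_comp_comp)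
    then have "F \<bullet> h = G \<bullet> h" by (simp add: h)
    then have "\<exists>!k. e \<bullet> k = h" using t by (simp add: teq_def)
    then obtain k where k: "e \<bullet> k = h" by blast
    have [simp]: "arr k" "tgt k = ?E" "src k = cob W" using arr_comp_eq[OF k] by auto
    have "(e \<star> e) \<bullet> \<delta> \<bullet> k = (e \<star> e) \<bullet> (k \<star> k) \<bullet> cmu W"
      using cmor_cmu[OF h(1)] by (simp add: comp_rewr[OF ee] tens_comp_comp k)
    then have "\<delta> \<bullet> k = (k \<star> k) \<bullet> cmu W"
      by (rule tmonoD[OF m(2), rotated]) simp
    then have "cmor W E k"
      using cmor_cun[OF h(1)] by (simp add: cmor_def ty_def tcomp_assoc k)
    with k show ?thesis by blast
  qed
  then show ?thesis
    using that[OF E eX fe m(1)] by blast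
qed

end

section \<open>Group objects in cocommutative comonoids\<close>

record ('o, 'm) tgrp =
  gco :: "('o, 'm) coalg"
  gmul :: "('o, 'm) tarr"
  gone :: "('o, 'm) tarr"
  ginv :: "('o, 'm) tarr"

abbreviation gob :: "('o, 'm) tgrp \<Rightarrow> 'o tree" where "gob G \<equiv> cob (gco G)"

context symmetric_monoidal_category
begin

text \<open>As for the antipode of a Hopf monoid, \<open>ginv\<close> is only asked to be an arrow
  of M; that it is a comonoid morphism is the content of \<open>cmor_ginv\<close>.\<close>

definition grp :: "('o, 'm) tgrp \<Rightarrow> bool" where
  "grp G \<longleftrightarrow> coc (gco G) \<and> cmor (prodc (gco G) (gco G)) (gco G) (gmul G) \<and> cmor unitc (gco G) (gone G) \<and>
     ty (ginv G) (gob G) (gob G) \<and>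
     gmul G \<bullet> (gmul G \<star> idt (gob G)) = gmul G \<bullet> (idt (gob G) \<star> gmul G) \<bullet> al (gob G) (gob G) (gob G) \<and>
     gmul G \<bullet> (gone G \<star> idt (gob G)) = lu (gob G) \<and>
     gmul G \<bullet> (idt (gob G) \<star> gone G) = ru (gob G) \<and>
     gmul G \<bullet> (ginv G \<star> idt (gob G)) \<bullet> cmu (gco G) = gone G \<bullet> cun (gco G) \<and>
     gmul G \<bullet> (idt (gob G) \<star> ginv G) \<bullet> cmu (gco G) = gone G \<bullet> cun (gco G)"

definition gmor :: "('o, 'm) tgrp \<Rightarrow> ('o, 'm) tgrp \<Rightarrow> ('o, 'm) tarr \<Rightarrow> bool" where
  "gmor G H f \<longleftrightarrow> cmor (gco G) (gco H) f \<and> f \<bullet> gmul G = gmul H \<bullet> (f \<star> f) \<and> f \<bullet> gone G = gone H"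

text \<open>The convolution product. On comonoid morphisms from X to G it is a group operation with
  neutral element \<open>triv X G\<close>, the inverse of f being
  \<open>ginv G \<bullet> f\<close>.\<close>

definition cv :: "('o, 'm) coalg \<Rightarrow> ('o, 'm) tgrp \<Rightarrow> ('o, 'm) tarr \<Rightarrow> ('o, 'm) tarr \<Rightarrow> ('o, 'm) tarr" where
  "cv X G f g = gmul G \<bullet> pair X f g"

definition triv :: "('o, 'm) coalg \<Rightarrow> ('o, 'm) tgrp \<Rightarrow> ('o, 'm) tarr" where
  "triv X G = gone G \<bullet> cun X"

lemma grp_coc [simp]: "grp G \<Longrightarrow> coc (gco G)"
  and grp_mul: "grp G \<Longrightarrow> cmor (prodc (gco G) (gco G)) (gco G) (gmul G)"
  and grp_one: "grp G \<Longrightarrow> cmor unitc (gco G) (gone G)"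
  by (simp_all add: grp_def)

lemma grp_ty [simp]:
  assumes "grp G"
  shows "arr (gmul G)" "src (gmul G) = gob G \<diamondop> gob G" "tgt (gmul G) = gob G"
    "arr (gone G)" "src (gone G) = Unit" "tgt (gone G) = gob G"
    "arr (ginv G)" "src (ginv G) = gob G" "tgt (ginv G) = gob G"
  using assms by (auto simp: grp_def ty_def cmor_def)

lemma grp_laws:
  assumes "grp G"
  shows grp_assoc: "gmul G \<bullet> (gmul G \<star> idt (gob G)) = gmul G \<bullet> (idt (gob G) \<star> gmul G) \<bullet> al (gob G) (gob G) (gob G)"
    and grp_lunit: "gmul G \<bullet> (gone G \<star> idt (gob G)) = lu (gob G)"
    and grp_runit: "gmul G \<bullet> (idt (gob G) \<star> gone G) = ru (gob G)"
    and grp_linv: "gmul G \<bullet> (ginv G \<star> idt (gob G)) \<bullet> cmu (gco G) = gone G \<bullet> cun (gco G)"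
    and grp_rinv: "gmul G \<bullet> (idt (gob G) \<star> ginv G) \<bullet> cmu (gco G) = gone G \<bullet> cun (gco G)"
  using assms by (auto simp: grp_def)

lemma gmor_cmor: "gmor G H f \<Longrightarrow> cmor (gco G) (gco H) f"
  by (simp add: gmor_def)

lemma pair_ty [simp]:
  assumes "coc X" "arr f" "arr g" "src f = cob X" "src g = cob X"
  shows "arr (pair X f g)" "src (pair X f g) = cob X" "tgt (pair X f g) = tgt f \<diamondop> tgt g"
  using assms by (auto simp: pair_def)

lemma cv_ty [simp]:
  assumes "coc X" "grp G" "arr f" "arr g" "src f = cob X" "src g = cob X" "tgt f = gob G" "tgt g = gob G"
  shows "arr (cv X G f g)" "src (cv X G f g) = cob X" "tgt (cv X G f g) = gob G"
  using assms by (auto simp: cv_def)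

lemma cmor_cv:
  "\<lbrakk>coc X; grp G; cmor X (gco G) f; cmor X (gco G) g\<rbrakk> \<Longrightarrow> cmor X (gco G) (cv X G f g)"
  unfolding cv_def by (intro cmor_comp[OF cmor_pair grp_mul]) auto

lemma cmor_triv: "\<lbrakk>coc X; grp G\<rbrakk> \<Longrightarrow> cmor X (gco G) (triv X G)"
  unfolding triv_def by (intro cmor_comp[OF cmor_cun_unitc grp_one]) auto

lemma triv_ty [simp]:
  assumes "coc X" "grp G"
  shows "arr (triv X G)" "src (triv X G) = cob X" "tgt (triv X G) = gob G"
  using assms by (auto simp: triv_def)

lemma cv_comp: "cmor W X h \<Longrightarrow> cv X G f g \<bullet> h = cv W G (f \<bullet> h) (g \<bullet> h)"
  by (simp add: cv_def pair_comp tcomp_assoc)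

lemma triv_comp: "cmor W X h \<Longrightarrow> triv X G \<bullet> h = triv W G"
  by (simp add: triv_def tcomp_assoc cmor_cun)

lemma gmor_cv: "gmor G H k \<Longrightarrow> k \<bullet> cv X G f g = cv X H (k \<bullet> f) (k \<bullet> g)"
  unfolding cv_def gmor_def
  by (metis tcomp_assoc tens_pair)

lemma gmor_triv: "gmor G H k \<Longrightarrow> k \<bullet> triv X G = triv X H"
  by (simp add: triv_def gmor_def flip: tcomp_assoc)

text \<open>Convolution is a monoid operation on all arrows of M from X to G. This generality is
  used in \<open>cmor_ginv\<close>, where the antipode is convolved before it is known to be a
  comonoid morphism.\<close>

lemma cv_assoc:
  assumes [simp]: "coc X" "grp G" "arr f" "arr g" "arr h" "src f = cob X" "src g = cob X" "src h = cob X"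
    "tgt f = gob G" "tgt g = gob G" "tgt h = gob G"
  shows "cv X G (cv X G f g) h = cv X G f (cv X G g h)"
proof -
  let ?t = "gob G" and ?s = "cob X" and ?m = "gmul G"
  have "cv X G (cv X G f g) h = (?m \<bullet> (?m \<star> idt ?t)) \<bullet> ((f \<star> g) \<star> h) \<bullet> (cmu X \<star> idt ?s) \<bullet> cmu X"
    by (simp add: cv_def pair_def tens_comp_comp tcomp_assoc)
  also have "\<dots> = ?m \<bullet> (idt ?t \<star> ?m) \<bullet> (f \<star> (g \<star> h)) \<bullet> (idt ?s \<star> cmu X) \<bullet> cmu X"
    unfolding grp_assoc[OF assms(2)]
    by (simp add: tcomp_assoc) (subst comp_rewr[OF al_nat], simp_all add: coc_assoc)
  also have "\<dots> = cv X G f (cv X G g h)"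
    by (simp add: cv_def pair_def tens_comp_comp tcomp_assoc)
  finally show ?thesis .
qed

lemma cv_triv_left:
  assumes [simp]: "coc X" "grp G" "arr f" "src f = cob X" "tgt f = gob G"
  shows "cv X G (triv X G) f = f"
proof -
  have "cv X G (triv X G) f = (gmul G \<bullet> (gone G \<star> idt (gob G))) \<bullet> (idt Unit \<star> f) \<bullet> (cun X \<star> idt (cob X)) \<bullet> cmu X"
    by (simp add: cv_def pair_def triv_def tens_comp_comp tcomp_assoc)
  also have "\<dots> = f \<bullet> lu (cob X) \<bullet> (cun X \<star> idt (cob X)) \<bullet> cmu X"
    unfolding grp_lunit[OF assms(2)] by (subst comp_rewr[OF lu_nat]) auto
  finally show ?thesis by (simp add: coc_lunit)
qed

lemma cv_triv_right:
  assumes [simp]: "coc X" "grp G" "arr f" "src f = cob X" "tgt f = gob G"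
  shows "cv X G f (triv X G) = f"
proof -
  have "cv X G f (triv X G) = (gmul G \<bullet> (idt (gob G) \<star> gone G)) \<bullet> (f \<star> idt Unit) \<bullet> (idt (cob X) \<star> cun X) \<bullet> cmu X"
    by (simp add: cv_def pair_def triv_def tens_comp_comp tcomp_assoc)
  also have "\<dots> = f \<bullet> ru (cob X) \<bullet> (idt (cob X) \<star> cun X) \<bullet> cmu X"
    unfolding grp_runit[OF assms(2)] by (subst comp_rewr[OF ru_nat]) auto
  finally show ?thesis by (simp add: coc_runit)
qed

text \<open>The antipode axiom is the case of the generic element \<open>idt (gob G)\<close>;
  precomposition with the comonoid morphism f transports it to f.\<close>

lemma cv_inv_left:
  assumes [simp]: "grp G" and f: "cmor X (gco G) f"
  shows "cv X G (ginv G \<bullet> f) f = triv X G"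
proof -
  have "cv (gco G) G (ginv G) (idt (gob G)) = triv (gco G) G"
    by (simp add: cv_def pair_def triv_def grp_linv)
  then show ?thesis
    using cv_comp[OF f, of G "ginv G" "idt (gob G)"] cmor_ty[OF f] by (simp add: triv_comp[OF f])
qed

lemma cv_inv_right:
  assumes [simp]: "grp G" and f: "cmor X (gco G) f"
  shows "cv X G f (ginv G \<bullet> f) = triv X G"
proof -
  have "cv (gco G) G (idt (gob G)) (ginv G) = triv (gco G) G"
    by (simp add: cv_def pair_def triv_def grp_rinv)
  then show ?thesis
    using cv_comp[OF f, of G "idt (gob G)" "ginv G"] cmor_ty[OF f] by (simp add: triv_comp[OF f])
qed

lemma cmor_inverse:
  assumes X [simp]: "coc X" "coc Y" and f: "cmor X Y f" and g: "ty g (cob Y) (cob X)"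
    and gf: "g \<bullet> f = idt (cob X)" and fg: "f \<bullet> g = idt (cob Y)"
  shows "cmor Y X g"
proof -
  note [simp] = cmor_ty(1-3)[OF f] tyD[OF g]
  have "cmu X \<bullet> g = (g \<star> g) \<bullet> ((f \<star> f) \<bullet> cmu X) \<bullet> g"
    by (simp add: tens_comp_comp gf tcomp_assoc)
  also have "\<dots> = (g \<star> g) \<bullet> cmu Y"
    by (simp add: cmor_cmu[OF f, symmetric] fg tcomp_assoc)
  finally have "cmu X \<bullet> g = (g \<star> g) \<bullet> cmu Y" .
  moreover have "cun X \<bullet> g = cun Y"
    by (simp add: cmor_cun[OF f, symmetric] fg tcomp_assoc)
  ultimately show ?thesis
    using g by (simp add: cmor_def)
qed

text \<open>On generalised elements this is (a, b) \<mapsto> (a, h(a) b). It is used for h the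
  identity and for h the antipode.\<close>

definition shear :: "('o, 'm) tgrp \<Rightarrow> ('o, 'm) tarr \<Rightarrow> ('o, 'm) tarr" where
  "shear G h = (idt (gob G) \<star> (gmul G \<bullet> (h \<star> idt (gob G)))) \<bullet> al (gob G) (gob G) (gob G) \<bullet> (cmu (gco G) \<star> idt (gob G))"

text \<open>The comultiplication duplicates a because a is a comonoid morphism. The second element b
  is merely typed, so it may itself be built from \<open>ginv G\<close>.\<close>

lemma shear_pair:
  assumes [simp]: "coc X" "grp G" and h: "ty h (gob G) (gob G)" and a: "cmor X (gco G) a" and b: "ty b (cob X) (gob G)"
  shows "shear G h \<bullet> pair X a b = pair X a (cv X G (h \<bullet> a) b)"
proof -
  note [simp] = tyD[OF h] tyD[OF b] cmor_ty(1-3)[OF a]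
  let ?t = "gob G" and ?s = "cob X"
  have "shear G h \<bullet> pair X a b = (idt ?t \<star> (gmul G \<bullet> (h \<star> idt ?t))) \<bullet> al ?t ?t ?t \<bullet> ((a \<star> a) \<star> b) \<bullet> (cmu X \<star> idt ?s) \<bullet> cmu X"
    by (simp add: shear_def pair_def tens_comp_comp tcomp_assoc cmor_cmu[OF a])
  also have "\<dots> = (idt ?t \<star> (gmul G \<bullet> (h \<star> idt ?t))) \<bullet> (a \<star> (a \<star> b)) \<bullet> (idt ?s \<star> cmu X) \<bullet> cmu X"
    by (subst comp_rewr[OF al_nat]) (auto simp: coc_assoc)
  finally show ?thesis
    by (simp add: pair_def cv_def tens_comp_comp tens_comp tcomp_assoc)
qed

text \<open>The shear map \<open>(a, b) \<mapsto> (a, a b)\<close> is a comonoid isomorphism with inverse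
  \<open>(a, b) \<mapsto> (a, a\<^sup>-\<^sup>1 b)\<close>, and the antipode is a component of the inverse.\<close>

lemma cmor_ginv:
  assumes [simp]: "grp G"
  shows "cmor (gco G) (gco G) (ginv G)"
proof -
  let ?X = "gco G" and ?P = "prodc (gco G) (gco G)" and ?t = "gob G"
  let ?p = "pr1 ?X ?X" and ?q = "pr2 ?X ?X"
  let ?V = "shear G (idt ?t)" and ?W = "shear G (ginv G)"
  have P [simp]: "coc ?P" by (simp add: coc_prodc)
  have p: "cmor ?P ?X ?p" and q: "cmor ?P ?X ?q" by (simp_all add: cmor_pr1 cmor_pr2)
  note [simp] = cmor_ty(1-3)[OF p, simplified] cmor_ty(1-3)[OF q, simplified]
  have tys: "ty (ginv G) ?t ?t" "ty (idt ?t) ?t ?t" by (simp_all add: ty_def)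
  have [simp]: "arr ?V" "src ?V = ?t \<diamondop> ?t" "tgt ?V = ?t \<diamondop> ?t" "arr ?W" "src ?W = ?t \<diamondop> ?t" "tgt ?W = ?t \<diamondop> ?t"
    by (simp_all add: shear_def)
  have V: "?V = pair ?P ?p (cv ?P G ?p ?q)"
    using shear_pair[OF P assms tys(2) p, of ?q] by (simp add: pair_pr ty_def)
  have W: "?W = pair ?P ?p (cv ?P G (ginv G \<bullet> ?p) ?q)"
    using shear_pair[OF P assms tys(1) p, of ?q] by (simp add: pair_pr ty_def)
  have "?V \<bullet> ?W = pair ?P ?p (cv ?P G ?p (cv ?P G (ginv G \<bullet> ?p) ?q))"
    unfolding W using shear_pair[OF P assms tys(2) p, of "cv ?P G (ginv G \<bullet> ?p) ?q"] by (simp add: ty_def)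
  then have VW: "?V \<bullet> ?W = idt (?t \<diamondop> ?t)"
    by (simp add: cv_assoc[symmetric] cv_inv_right[OF assms p] cv_triv_left pair_pr)
  have "?W \<bullet> ?V = pair ?P ?p (cv ?P G (ginv G \<bullet> ?p) (cv ?P G ?p ?q))"
    unfolding V using shear_pair[OF P assms tys(1) p, of "cv ?P G ?p ?q"] by (simp add: ty_def)
  then have WV: "?W \<bullet> ?V = idt (?t \<diamondop> ?t)"
    by (simp add: cv_assoc[symmetric] cv_inv_left[OF assms p] cv_triv_left pair_pr)
  \<comment> \<open>\<open>?V\<close> is a pairing of comonoid morphisms. Its inverse
    \<open>?W\<close> inherits the property by \<open>cmor_inverse\<close>, although it is built
    from the antipode.\<close>
  have "cmor ?P ?P ?V"
    unfolding V by (intro cmor_pair cmor_cv p q) auto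
  then have "cmor ?P ?P ?W"
    by (rule cmor_inverse[rotated 2]) (use VW WV in \<open>simp_all add: ty_def\<close>)
  moreover have i: "cmor ?X ?X (idt ?t)" by (simp add: cmor_idt)
  \<comment> \<open>\<open>?W\<close> sends (a, 1) to (a, a^-1), so the antipode is a composite of
    comonoid morphisms.\<close>
  ultimately have 1: "cmor ?X ?X (?q \<bullet> ?W \<bullet> pair ?X (idt ?t) (triv ?X G))"
    using cmor_comp[OF cmor_comp[OF cmor_pair[OF _ _ _ i cmor_triv]] q] by simp
  have "?W \<bullet> pair ?X (idt ?t) (triv ?X G) = pair ?X (idt ?t) (ginv G)"
    using shear_pair[OF _ assms tys(1) i, of "triv ?X G"] by (simp add: ty_def cv_triv_right)
  moreover have "?q \<bullet> pair ?X (idt ?t) (ginv G) = ginv G"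
    by (rule pr2_pair) (auto simp: ty_def)
  ultimately show ?thesis
    using 1 by simp
qed

text \<open>A comonoid \<open>L\<close> is made into a group object by multiplying generalised elements pointwise.\<close>

lemma lift_grp:
  assumes L [simp]: "coc L" and D [simp]: "\<And>i. i \<in> I \<Longrightarrow> grp (D i)"
    and \<pi>: "\<And>i. i \<in> I \<Longrightarrow> cmor L (gco (D i)) (\<pi> i)"
    and mono: "\<And>(X :: ('o, 'm) coalg) x y. \<lbrakk>coc X; cmor X L x; cmor X L y; \<And>i. i \<in> I \<Longrightarrow> \<pi> i \<bullet> x = \<pi> i \<bullet> y\<rbrakk> \<Longrightarrow> x = y"
    and mul: "\<And>(X :: ('o, 'm) coalg) x y. \<lbrakk>coc X; cmor X L x; cmor X L y\<rbrakk> \<Longrightarrow>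
        \<exists>z. cmor X L z \<and> (\<forall>i\<in>I. \<pi> i \<bullet> z = cv X (D i) (\<pi> i \<bullet> x) (\<pi> i \<bullet> y))"
    and one: "\<exists>z. cmor unitc L z \<and> (\<forall>i\<in>I. \<pi> i \<bullet> z = gone (D i))"
    and inv: "\<exists>z. cmor L L z \<and> (\<forall>i\<in>I. \<pi> i \<bullet> z = ginv (D i) \<bullet> \<pi> i)"
  obtains G where "grp G" "gco G = L" "\<And>i. i \<in> I \<Longrightarrow> gmor G (D i) (\<pi> i)"
proof -
  let ?t = "cob L" and ?P = "prodc L L"
  have P [simp]: "coc ?P" by (simp add: coc_prodc)
  note [simp] = cmor_ty(1-3)[OF \<pi>]
  have pr: "cmor ?P L (pr1 L L)" "cmor ?P L (pr2 L L)" by (simp_all add: cmor_pr1 cmor_pr2)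
  \<comment> \<open>By Yoneda the operations are determined on generic elements: the product of the
    two projections of \<open>prodc L L\<close> is the multiplication, and the inverse of the
    identity of L is the antipode.\<close>
  obtain m where m: "cmor ?P L m" and m': "\<And>i. i \<in> I \<Longrightarrow> \<pi> i \<bullet> m = cv ?P (D i) (\<pi> i \<bullet> pr1 L L) (\<pi> i \<bullet> pr2 L L)"
    using mul[OF P pr] by blast
  obtain u where u: "cmor unitc L u" and u': "\<And>i. i \<in> I \<Longrightarrow> \<pi> i \<bullet> u = gone (D i)"
    using one by blast
  obtain s where s: "cmor L L s" and s': "\<And>i. i \<in> I \<Longrightarrow> \<pi> i \<bullet> s = ginv (D i) \<bullet> \<pi> i"
    using inv by blast
  note [simp] = cmor_ty(1-3)[OF m, simplified] cmor_ty(1-3)[OF u, simplified] cmor_ty(1-3)[OF s]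
  have pm: "\<pi> i \<bullet> m = gmul (D i) \<bullet> (\<pi> i \<star> \<pi> i)" if "i \<in> I" for i
    using that by (simp add: m' cv_def pair_pr flip: tens_pair)
  have ps: "\<pi> i \<bullet> m \<bullet> x = gmul (D i) \<bullet> (\<pi> i \<star> \<pi> i) \<bullet> x" "\<pi> i \<bullet> u \<bullet> x = gone (D i) \<bullet> x" if "i \<in> I" for i x
    using comp_rewr[OF pm[OF that]] u'[OF that] by (simp_all flip: tcomp_assoc)
  have idL: "cmor L L (idt ?t)" by (simp add: cmor_idt)
  \<comment> \<open>Each law is checked after every \<open>\<pi> i\<close>, where it becomes the law
    of \<open>D i\<close>. Since \<open>mono\<close> compares comonoid morphisms only, both sides
    must first be shown to be such; for the inverse laws this is why s has to be a comonoid
    morphism.\<close>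
  have "m \<bullet> (m \<star> idt ?t) = m \<bullet> (idt ?t \<star> m) \<bullet> al ?t ?t ?t"
  proof (rule mono[of "prodc ?P L"])
    show "cmor (prodc ?P L) L (m \<bullet> (m \<star> idt ?t))"
      by (rule cmor_comp[OF cmor_tens m]) (use m idL in auto)
    show "cmor (prodc ?P L) L (m \<bullet> (idt ?t \<star> m) \<bullet> al ?t ?t ?t)"
      by (rule cmor_comp[OF cmor_comp[OF cmor_al cmor_tens] m]) (use m idL in auto)
    fix i assume i: "i \<in> I"
    let ?g = "gob (D i)" and ?m = "gmul (D i)"
    have "\<pi> i \<bullet> m \<bullet> (m \<star> idt ?t) = (?m \<bullet> (?m \<star> idt ?g)) \<bullet> ((\<pi> i \<star> \<pi> i) \<star> \<pi> i)"
      using i by (simp add: ps pm tens_comp tcomp_assoc)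
    also have "\<dots> = ?m \<bullet> (idt ?g \<star> ?m) \<bullet> (\<pi> i \<star> (\<pi> i \<star> \<pi> i)) \<bullet> al ?t ?t ?t"
      using i by (simp add: grp_assoc tcomp_assoc al_nat)
    also have "\<dots> = \<pi> i \<bullet> m \<bullet> (idt ?t \<star> m) \<bullet> al ?t ?t ?t"
      using i by (simp add: ps pm tens_comp_comp)
    finally show "\<pi> i \<bullet> m \<bullet> (m \<star> idt ?t) = \<pi> i \<bullet> m \<bullet> (idt ?t \<star> m) \<bullet> al ?t ?t ?t" .
  qed (simp add: coc_prodc)
  moreover have "m \<bullet> (u \<star> idt ?t) = lu ?t"
  proof (rule mono[of "prodc unitc L"])
    show "cmor (prodc unitc L) L (m \<bullet> (u \<star> idt ?t))"
      by (rule cmor_comp[OF cmor_tens m]) (use u idL in auto)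
    fix i assume i: "i \<in> I"
    let ?g = "gob (D i)" and ?m = "gmul (D i)"
    have "\<pi> i \<bullet> m \<bullet> (u \<star> idt ?t) = (?m \<bullet> (gone (D i) \<star> idt ?g)) \<bullet> (idt Unit \<star> \<pi> i)"
      using i by (simp add: ps u' tens_comp tcomp_assoc)
    also have "\<dots> = \<pi> i \<bullet> lu ?t"
      using i by (simp add: grp_lunit lu_nat)
    finally show "\<pi> i \<bullet> m \<bullet> (u \<star> idt ?t) = \<pi> i \<bullet> lu ?t" .
  qed (simp_all add: coc_prodc cmor_lu)
  moreover have "m \<bullet> (idt ?t \<star> u) = ru ?t"
  proof (rule mono[of "prodc L unitc"])
    show "cmor (prodc L unitc) L (m \<bullet> (idt ?t \<star> u))"
      by (rule cmor_comp[OF cmor_tens m]) (use u idL in auto)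
    fix i assume i: "i \<in> I"
    let ?g = "gob (D i)" and ?m = "gmul (D i)"
    have "\<pi> i \<bullet> m \<bullet> (idt ?t \<star> u) = (?m \<bullet> (idt ?g \<star> gone (D i))) \<bullet> (\<pi> i \<star> idt Unit)"
      using i by (simp add: ps u' tens_comp tcomp_assoc)
    also have "\<dots> = \<pi> i \<bullet> ru ?t"
      using i by (simp add: grp_runit ru_nat)
    finally show "\<pi> i \<bullet> m \<bullet> (idt ?t \<star> u) = \<pi> i \<bullet> ru ?t" .
  qed (simp_all add: coc_prodc cmor_ru)
  moreover have ue: "cmor L L (u \<bullet> cun L)"
    by (rule cmor_comp[OF cmor_cun_unitc u]) simp
  have "m \<bullet> (s \<star> idt ?t) \<bullet> cmu L = u \<bullet> cun L"
  proof (rule mono[of L])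
    show "cmor L L (m \<bullet> (s \<star> idt ?t) \<bullet> cmu L)"
      by (rule cmor_comp[OF cmor_comp[OF cmor_cmu_prodc cmor_tens] m]) (use s idL in auto)
    fix i assume i: "i \<in> I"
    have "\<pi> i \<bullet> m \<bullet> (s \<star> idt ?t) \<bullet> cmu L = cv L (D i) (ginv (D i) \<bullet> \<pi> i) (\<pi> i)"
      using i by (simp add: ps s' tens_comp_comp cv_def pair_def)
    also have "\<dots> = \<pi> i \<bullet> u \<bullet> cun L"
      using i by (simp add: cv_inv_left[OF D \<pi>] triv_def ps)
    finally show "\<pi> i \<bullet> m \<bullet> (s \<star> idt ?t) \<bullet> cmu L = \<pi> i \<bullet> u \<bullet> cun L" .
  qed (use ue in auto)
  moreover have "m \<bullet> (idt ?t \<star> s) \<bullet> cmu L = u \<bullet> cun L"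
  proof (rule mono[of L])
    show "cmor L L (m \<bullet> (idt ?t \<star> s) \<bullet> cmu L)"
      by (rule cmor_comp[OF cmor_comp[OF cmor_cmu_prodc cmor_tens] m]) (use s idL in auto)
    fix i assume i: "i \<in> I"
    have "\<pi> i \<bullet> m \<bullet> (idt ?t \<star> s) \<bullet> cmu L = cv L (D i) (\<pi> i) (ginv (D i) \<bullet> \<pi> i)"
      using i by (simp add: ps s' tens_comp_comp cv_def pair_def)
    also have "\<dots> = \<pi> i \<bullet> u \<bullet> cun L"
      using i by (simp add: cv_inv_right[OF D \<pi>] triv_def ps)
    finally show "\<pi> i \<bullet> m \<bullet> (idt ?t \<star> s) \<bullet> cmu L = \<pi> i \<bullet> u \<bullet> cun L" .
  qed (use ue in auto)
  ultimately have "grp \<lparr>gco = L, gmul = m, gone = u, ginv = s\<rparr>"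
    unfolding grp_def using m u s by (simp add: ty_def)
  then show ?thesis
    by (rule that) (use \<pi> pm u' in \<open>auto simp: gmor_def\<close>)
qed

end

section \<open>Kernels of group objects\<close>

context equalizer_monoidal_category
begin

text \<open>The equalizer of f and the trivial morphism inherits the operations, because elements
  killed by f are closed under them. Being an equalizer of comonoids, it classifies killed elements
  on every X, not only on group objects; the proof of protomodularity depends on this.\<close>

lemma grp_kernel:
  assumes [simp]: "grp G" "grp H" and f: "gmor G H f"
  obtains K k where "grp K" "gmor K G k" "f \<bullet> k = triv (gco K) H"
    "\<And>X x. \<lbrakk>coc X; cmor X (gco G) x; f \<bullet> x = triv X H\<rbrakk> \<Longrightarrow> \<exists>y. cmor X (gco K) y \<and> k \<bullet> y = x"
proof -
  note fc = gmor_cmor[OF f]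
  note [simp] = cmor_ty(1-3)[OF fc]
  have t: "cmor (gco G) (gco H) (triv (gco G) H)" by (simp add: cmor_triv)
  obtain E :: "('o, 'm) coalg" and e where E [simp]: "coc E" and e: "cmor E (gco G) e" and fe: "f \<bullet> e = triv (gco G) H \<bullet> e" and m: "tmono e"
    and un: "\<And>(W :: ('o, 'm) coalg) h. \<lbrakk>coc W; cmor W (gco G) h; f \<bullet> h = triv (gco G) H \<bullet> h\<rbrakk> \<Longrightarrow> \<exists>k. cmor W E k \<and> e \<bullet> k = h"
    using coc_equalizer[OF grp_coc[OF assms(1)] grp_coc[OF assms(2)] fc t] by blast
  have fe: "f \<bullet> e = triv E H" by (simp add: fe triv_comp[OF e])
  have fex: "f \<bullet> e \<bullet> x = triv X H" if "cmor X E x" for X x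
    using triv_comp[OF that, of H] by (simp add: fe flip: tcomp_assoc)
  have un: "\<exists>y. cmor X E y \<and> e \<bullet> y = x" if "coc X" "cmor X (gco G) x" "f \<bullet> x = triv X H" for X x
    using un[OF that(1,2)] that(3) by (simp add: triv_comp[OF that(2)])
  note [simp] = cmor_ty(1-3)[OF e]
  obtain K where K: "grp K" "gco K = E" "\<And>i. i \<in> {()} \<Longrightarrow> gmor K G e"
  proof (rule lift_grp[of E "{()}" "\<lambda>_. G" "\<lambda>_. e"])
    show "x = y" if "coc X" "cmor X E x" "cmor X E y" "\<And>i. i \<in> {()} \<Longrightarrow> e \<bullet> x = e \<bullet> y" for X x y
    proof (rule tmonoD[OF m])
      show "arr (e \<bullet> x)" using cmor_ty[OF that(2)] by simp
      show "e \<bullet> x = e \<bullet> y" using that(4) by simp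
    qed
    show "\<exists>z. cmor X E z \<and> (\<forall>i\<in>{()}. e \<bullet> z = cv X G (e \<bullet> x) (e \<bullet> y))"
      if [simp]: "coc X" and x: "cmor X E x" and y: "cmor X E y" for X x y
    proof -
      have "f \<bullet> cv X G (e \<bullet> x) (e \<bullet> y) = triv X H"
        by (simp add: gmor_cv[OF f] fex[OF x] fex[OF y] cv_triv_left)
      then show ?thesis
        using un[of X "cv X G (e \<bullet> x) (e \<bullet> y)"] cmor_cv[OF that(1) assms(1) cmor_comp[OF x e] cmor_comp[OF y e]]
        by auto
    qed
    have "triv unitc H = gone H" by (simp add: triv_def unitc_def)
    then show "\<exists>z. cmor unitc E z \<and> (\<forall>i\<in>{()}. e \<bullet> z = gone G)"
      using un[of unitc "gone G"] f by (simp add: grp_one gmor_def)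
    have i: "cmor E (gco G) (ginv G \<bullet> e)"
      by (rule cmor_comp[OF e cmor_ginv]) simp
    have "f \<bullet> ginv G \<bullet> e = cv E H (f \<bullet> ginv G \<bullet> e) (f \<bullet> e)"
      by (simp add: fe cv_triv_right)
    also have "\<dots> = f \<bullet> cv E G (ginv G \<bullet> e) e"
      by (simp add: gmor_cv[OF f])
    also have "\<dots> = triv E H"
      by (simp add: cv_inv_left[OF _ e] gmor_triv[OF f])
    finally show "\<exists>z. cmor E E z \<and> (\<forall>i\<in>{()}. e \<bullet> z = ginv G \<bullet> e)"
      using un[OF E i] by simp
  qed (use e in auto)
  show ?thesis
    by (rule that[of K e]) (use K fe un in auto)
qed

end

section \<open>Finite limits\<close>

context category
begin

text \<open>The diagram is a family of objects with a set K of labelled arrows and no composition,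
  so that a limit can be built by adding one arrow at a time. A functor on a finite category yields
  such a diagram with the same cones.\<close>

definition universal_cone :: "'j set \<Rightarrow> ('j \<times> 'j \<times> 'm) set \<Rightarrow> ('j \<Rightarrow> 'o) \<Rightarrow> 'o \<Rightarrow> ('j \<Rightarrow> 'm) \<Rightarrow> bool" where
  "universal_cone I K D L \<pi> \<longleftrightarrow> L \<in> Ob C \<and> (\<forall>i\<in>I. \<pi> i \<in> Hom C L (D i)) \<and> (\<forall>(i, j, a)\<in>K. a \<cdot> \<pi> i = \<pi> j) \<and>
     (\<forall>X\<in>Ob C. \<forall>\<phi>. (\<forall>i\<in>I. \<phi> i \<in> Hom C X (D i)) \<longrightarrow> (\<forall>(i, j, a)\<in>K. a \<cdot> \<phi> i = \<phi> j) \<longrightarrow>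
        (\<exists>!t. t \<in> Hom C X L \<and> (\<forall>i\<in>I. \<pi> i \<cdot> t = \<phi> i)))"

lemma finite_products:
  assumes T: "T \<in> Ob C" "\<And>X. X \<in> Ob C \<Longrightarrow> \<exists>!f. f \<in> Hom C X T"
    and prod: "\<And>A B. \<lbrakk>A \<in> Ob C; B \<in> Ob C\<rbrakk> \<Longrightarrow> \<exists>P p q. P \<in> Ob C \<and> p \<in> Hom C P A \<and> q \<in> Hom C P B \<and>
        (\<forall>X\<in>Ob C. \<forall>u\<in>Hom C X A. \<forall>v\<in>Hom C X B. \<exists>!w. w \<in> Hom C X P \<and> p \<cdot> w = u \<and> q \<cdot> w = v)"
    and "finite I" "\<And>i. i \<in> I \<Longrightarrow> D i \<in> Ob C"
  shows "\<exists>L \<pi>. universal_cone I {} D L \<pi>"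
  using assms(4,5)
proof (induction I rule: finite_induct)
  case empty
  have "universal_cone {} {} D T \<pi>" for \<pi>
    using T by (simp add: universal_cone_def)
  then show ?case by blast
next
  case (insert j I)
  then obtain L \<pi> where L: "universal_cone I {} D L \<pi>" by auto
  then have LO: "L \<in> Ob C" and \<pi>: "\<And>i. i \<in> I \<Longrightarrow> \<pi> i \<in> Hom C L (D i)" by (auto simp: universal_cone_def)
  have Dj: "D j \<in> Ob C" and DO: "\<And>i. i \<in> I \<Longrightarrow> D i \<in> Ob C" using insert by auto
  obtain P p q where P: "P \<in> Ob C" and p: "p \<in> Hom C P L" and q: "q \<in> Hom C P (D j)"
    and univ: "\<And>X u v. \<lbrakk>X \<in> Ob C; u \<in> Hom C X L; v \<in> Hom C X (D j)\<rbrakk> \<Longrightarrow> \<exists>!w. w \<in> Hom C X P \<and> p \<cdot> w = u \<and> q \<cdot> w = v"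
    using prod[OF LO Dj] by blast
  define \<pi>' where "\<pi>' i = (if i = j then q else \<pi> i \<cdot> p)" for i
  have \<pi>'j: "\<pi>' j = q" by (simp add: \<pi>'_def)
  have \<pi>'i: "\<pi>' i = \<pi> i \<cdot> p" if "i \<in> I" for i using that insert by (auto simp: \<pi>'_def)
  have ex: "\<exists>!t. t \<in> Hom C X P \<and> (\<forall>i\<in>insert j I. \<pi>' i \<cdot> t = \<phi> i)"
    if X: "X \<in> Ob C" and \<phi>: "\<And>i. i \<in> insert j I \<Longrightarrow> \<phi> i \<in> Hom C X (D i)" for X \<phi>
  proof -
    have as: "(\<pi> i \<cdot> p) \<cdot> t = \<pi> i \<cdot> (p \<cdot> t)" if "t \<in> Hom C X P" "i \<in> I" for t i
      using that X P LO DO p \<pi> by (intro Comp_assoc[of X P L "D i"]) auto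
    have exL: "\<exists>!t. t \<in> Hom C X L \<and> (\<forall>i\<in>I. \<pi> i \<cdot> t = \<phi> i)"
      using L X \<phi> by (simp add: universal_cone_def)
    then obtain u where u: "u \<in> Hom C X L" "\<And>i. i \<in> I \<Longrightarrow> \<pi> i \<cdot> u = \<phi> i" by blast
    have exP: "\<exists>!w. w \<in> Hom C X P \<and> p \<cdot> w = u \<and> q \<cdot> w = \<phi> j"
      using univ X u \<phi> by simp
    then obtain w where w: "w \<in> Hom C X P" "p \<cdot> w = u" "q \<cdot> w = \<phi> j" by blast
    show ?thesis
    proof (intro ex1I conjI)
      show "w \<in> Hom C X P" by (rule w)
      show "\<forall>i\<in>insert j I. \<pi>' i \<cdot> w = \<phi> i" using w u by (simp add: \<pi>'j \<pi>'i as)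
      fix t assume t: "t \<in> Hom C X P \<and> (\<forall>i\<in>insert j I. \<pi>' i \<cdot> t = \<phi> i)"
      have pt: "p \<cdot> t \<in> Hom C X L" using t X P LO p by (intro Comp_in_Hom[of X P L]) auto
      have "\<forall>i\<in>I. \<pi> i \<cdot> (p \<cdot> t) = \<phi> i" using t by (auto simp: \<pi>'i as)
      then have "p \<cdot> t = u" using exL u pt by blast
      moreover have "q \<cdot> t = \<phi> j" using t by (simp add: \<pi>'j)
      ultimately show "t = w" using exP w t by blast
    qed
  qed
  have ty: "\<pi>' i \<in> Hom C P (D i)" if "i \<in> insert j I" for i
    using that q Comp_in_Hom[of P L "D i" p "\<pi> i"] p P LO DO \<pi> by (auto simp: \<pi>'j \<pi>'i)
  have "universal_cone (insert j I) {} D P \<pi>'"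
    unfolding universal_cone_def
  proof (intro conjI ballI allI impI)
    fix X \<phi> assume "X \<in> Ob C" "\<forall>i\<in>insert j I. \<phi> i \<in> Hom C X (D i)"
    then show "\<exists>!t. t \<in> Hom C X P \<and> (\<forall>i\<in>insert j I. \<pi>' i \<cdot> t = \<phi> i)" by (intro ex) auto
  qed (use P ty in auto)
  then show ?case by blast
qed

text \<open>Starting from the product, each further arrow a from i to j cuts the limit down to the
  equalizer of \<open>a \<cdot> \<pi> i\<close> and \<open>\<pi> j\<close>.\<close>

lemma finite_cones:
  assumes T: "T \<in> Ob C" "\<And>X. X \<in> Ob C \<Longrightarrow> \<exists>!f. f \<in> Hom C X T"
    and prod: "\<And>A B. \<lbrakk>A \<in> Ob C; B \<in> Ob C\<rbrakk> \<Longrightarrow> \<exists>P p q. P \<in> Ob C \<and> p \<in> Hom C P A \<and> q \<in> Hom C P B \<and>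
        (\<forall>X\<in>Ob C. \<forall>u\<in>Hom C X A. \<forall>v\<in>Hom C X B. \<exists>!w. w \<in> Hom C X P \<and> p \<cdot> w = u \<and> q \<cdot> w = v)"
    and eq: "has_equalizers C"
    and I: "finite I" "\<And>i. i \<in> I \<Longrightarrow> D i \<in> Ob C"
    and K: "finite K" "\<And>i j a. (i, j, a) \<in> K \<Longrightarrow> i \<in> I \<and> j \<in> I \<and> a \<in> Hom C (D i) (D j)"
  shows "\<exists>L \<pi>. universal_cone I K D L \<pi>"
  using K
proof (induction K rule: finite_induct)
  case empty
  show ?case by (rule finite_products[OF T prod I])
next
  case (insert x K)
  obtain i j a where x: "x = (i, j, a)" by (cases x)
  have ij: "i \<in> I" "j \<in> I" and a: "a \<in> Hom C (D i) (D j)" using insert.prems[of i j a] x by auto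
  obtain L \<pi> where L: "universal_cone I K D L \<pi>" using insert by (metis insertCI)
  then have LO: "L \<in> Ob C" and \<pi>: "\<And>i. i \<in> I \<Longrightarrow> \<pi> i \<in> Hom C L (D i)"
    and \<pi>K: "\<And>i j a. (i, j, a) \<in> K \<Longrightarrow> a \<cdot> \<pi> i = \<pi> j" by (auto simp: universal_cone_def)
  have H: "a \<cdot> \<pi> i \<in> Hom C L (D j)" "\<pi> j \<in> Hom C L (D j)"
    using LO I ij a \<pi> by (auto intro: Comp_in_Hom[of L "D i" "D j"])
  then obtain E e where E: "is_equalizer C L (D j) (a \<cdot> \<pi> i) (\<pi> j) E e"
    using eq LO I ij unfolding has_equalizers_def by blast
  then have EO: "E \<in> Ob C" and e: "e \<in> Hom C E L" and ee: "(a \<cdot> \<pi> i) \<cdot> e = \<pi> j \<cdot> e"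
    and univ: "\<And>X u. \<lbrakk>X \<in> Ob C; u \<in> Hom C X L; (a \<cdot> \<pi> i) \<cdot> u = \<pi> j \<cdot> u\<rbrakk> \<Longrightarrow> \<exists>!v. v \<in> Hom C X E \<and> e \<cdot> v = u"
    by (auto simp: is_equalizer_def)
  define \<pi>' where "\<pi>' k = \<pi> k \<cdot> e" for k
  have as: "(b \<cdot> \<pi> k) \<cdot> u = b \<cdot> (\<pi> k \<cdot> u)" if "X \<in> Ob C" "u \<in> Hom C X L" "k \<in> I" "l \<in> I" "b \<in> Hom C (D k) (D l)" for b k l u X
    using that LO I \<pi> by (intro Comp_assoc[of X L "D k" "D l"]) auto
  have as': "(\<pi> k \<cdot> e) \<cdot> u = \<pi> k \<cdot> (e \<cdot> u)" if "X \<in> Ob C" "u \<in> Hom C X E" "k \<in> I" for k u X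
    using that LO EO e I \<pi> by (intro Comp_assoc[of X E L "D k"]) auto
  have 1: "\<pi>' k \<in> Hom C E (D k)" if "k \<in> I" for k
    unfolding \<pi>'_def using that EO LO I e \<pi> by (intro Comp_in_Hom[of E L "D k"]) auto
  have 2: "b \<cdot> \<pi>' k = \<pi>' l" if kl: "(k, l, b) \<in> insert x K" for k l b
  proof -
    have "k \<in> I" "l \<in> I" "b \<in> Hom C (D k) (D l)" using insert.prems[OF kl] by auto
    then have "b \<cdot> \<pi>' k = (b \<cdot> \<pi> k) \<cdot> e" using as[OF EO e, of k l b] by (simp add: \<pi>'_def)
    then show ?thesis using kl \<pi>K[of k l b] ee by (auto simp: x \<pi>'_def)
  qed
  have 3: "\<exists>!t. t \<in> Hom C X E \<and> (\<forall>i\<in>I. \<pi>' i \<cdot> t = \<phi> i)"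
    if X: "X \<in> Ob C" and \<phi>: "\<And>i. i \<in> I \<Longrightarrow> \<phi> i \<in> Hom C X (D i)"
      and \<phi>K: "\<And>i j a. (i, j, a) \<in> insert x K \<Longrightarrow> a \<cdot> \<phi> i = \<phi> j" for X \<phi>
  proof -
    have exL: "\<exists>!t. t \<in> Hom C X L \<and> (\<forall>i\<in>I. \<pi> i \<cdot> t = \<phi> i)"
    proof -
      have "\<forall>(i, j, a)\<in>K. a \<cdot> \<phi> i = \<phi> j" using \<phi>K by auto
      then show ?thesis using L X \<phi> by (simp add: universal_cone_def)
    qed
    then obtain u where u: "u \<in> Hom C X L" "\<And>i. i \<in> I \<Longrightarrow> \<pi> i \<cdot> u = \<phi> i" by blast
    have "(a \<cdot> \<pi> i) \<cdot> u = \<pi> j \<cdot> u"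
      using as[OF X u(1) ij a] u(2) ij \<phi>K[of i j a] by (simp add: x)
    then have exE: "\<exists>!v. v \<in> Hom C X E \<and> e \<cdot> v = u" using univ X u by simp
    then obtain v where v: "v \<in> Hom C X E" "e \<cdot> v = u" by blast
    show ?thesis
    proof (intro ex1I conjI)
      show "v \<in> Hom C X E" by (rule v)
      show "\<forall>i\<in>I. \<pi>' i \<cdot> v = \<phi> i" using as'[OF X v(1)] v u by (simp add: \<pi>'_def)
      fix t assume t: "t \<in> Hom C X E \<and> (\<forall>i\<in>I. \<pi>' i \<cdot> t = \<phi> i)"
      have "e \<cdot> t \<in> Hom C X L" using t X EO LO e by (intro Comp_in_Hom[of X E L]) auto
      moreover have "\<forall>i\<in>I. \<pi> i \<cdot> (e \<cdot> t) = \<phi> i" using t as'[OF X] by (auto simp: \<pi>'_def)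
      ultimately have "e \<cdot> t = u" using exL u by blast
      then show "t = v" using exE v t by blast
    qed
  qed
  have "universal_cone I (insert x K) D E \<pi>'"
    unfolding universal_cone_def
  proof (intro conjI ballI allI impI)
    fix y assume "y \<in> insert x K"
    then show "case y of (i, j, a) \<Rightarrow> a \<cdot> \<pi>' i = \<pi>' j" using 2 by (cases y) auto
  next
    fix X \<phi> assume "X \<in> Ob C" "\<forall>i\<in>I. \<phi> i \<in> Hom C X (D i)" "\<forall>(i, j, a)\<in>insert x K. a \<cdot> \<phi> i = \<phi> j"
    then show "\<exists>!t. t \<in> Hom C X E \<and> (\<forall>i\<in>I. \<pi>' i \<cdot> t = \<phi> i)" by (intro 3) auto
  qed (use EO 1 in auto)
  then show ?case by blast
qed

end

section \<open>Limits of cocommutative comonoids\<close>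

context symmetric_monoidal_category
begin

definition coc_cat :: "(('o, 'm) coalg, ('o, 'm) tarr) cat" where
  "coc_cat = \<lparr>Ob = {X. coc X}, Hom = (\<lambda>X Y. {f. cmor X Y f}), Comp = tcomp, Id = (\<lambda>X. idt (cob X))\<rparr>"

lemma coc_cat_simps [simp]:
  "X \<in> Ob coc_cat \<longleftrightarrow> coc X" "f \<in> Hom coc_cat X Y \<longleftrightarrow> cmor X Y f" "Comp coc_cat = (\<bullet>)"
  "Id coc_cat X = idt (cob X)"
  by (auto simp: coc_cat_def)

lemma category_coc_cat: "category coc_cat"
  by unfold_locales (auto simp: tcomp_assoc cmor_ty intro: cmor_idt cmor_comp)

lemma coc_product:
  assumes [simp]: "coc X" "coc Y" "coc W" and u: "cmor W X u" and v: "cmor W Y v"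
  shows "\<exists>!w. cmor W (prodc X Y) w \<and> pr1 X Y \<bullet> w = u \<and> pr2 X Y \<bullet> w = v"
proof (intro ex1I conjI)
  show "cmor W (prodc X Y) (pair W u v)" by (intro cmor_pair u v) auto
  show "pr1 X Y \<bullet> pair W u v = u" by (intro pr1_pair cmor_ty[OF u] cmor_ty[OF v] cmor_cun[OF v]) auto
  show "pr2 X Y \<bullet> pair W u v = v" by (intro pr2_pair cmor_ty[OF u] cmor_ty[OF v] cmor_cun[OF u]) auto
qed (use pair_eta[of X Y W] in auto)

end

context equalizer_monoidal_category
begin

lemma has_equalizers_coc_cat: "has_equalizers coc_cat"
  unfolding has_equalizers_def coc_cat_simps
proof (intro ballI, unfold coc_cat_simps)
  fix X Y :: "('o, 'm) coalg" and f g
  assume X: "coc X" and Y: "coc Y" and f: "cmor X Y f" and g: "cmor X Y g"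
  obtain E :: "('o, 'm) coalg" and e where E: "coc E" and e: "cmor E X e" and fe: "f \<bullet> e = g \<bullet> e" and m: "tmono e"
    and un: "\<And>(W :: ('o, 'm) coalg) h. \<lbrakk>coc W; cmor W X h; f \<bullet> h = g \<bullet> h\<rbrakk> \<Longrightarrow> \<exists>k. cmor W E k \<and> e \<bullet> k = h"
    using coc_equalizer[OF X Y f g] by blast
  have "\<exists>!k. cmor W E k \<and> e \<bullet> k = h" if W: "coc W" "cmor W X h" "f \<bullet> h = g \<bullet> h" for W :: "('o, 'm) coalg" and h
  proof -
    obtain k where k: "cmor W E k" "e \<bullet> k = h" using un[OF W] by blast
    have "k' = k" if "e \<bullet> k' = h" for k'
      by (rule tmonoD[OF m, symmetric]) (use that k cmor_ty[OF W(2)] in auto)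
    with k show ?thesis by blast
  qed
  then show "\<exists>E e. is_equalizer coc_cat X Y f g E e"
    using E e fe unfolding is_equalizer_def coc_cat_simps
    by (intro exI[of _ E] exI[of _ e] conjI ballI impI) simp_all
qed

lemma coc_cones:
  assumes "finite I" "\<And>i. i \<in> I \<Longrightarrow> coc (D i)" "finite K"
    "\<And>i j a. (i, j, a) \<in> K \<Longrightarrow> i \<in> I \<and> j \<in> I \<and> cmor (D i) (D j) a"
  obtains L \<pi> where "category.universal_cone coc_cat I K D L \<pi>"
proof -
  have "\<exists>L \<pi>. category.universal_cone coc_cat I K D L \<pi>"
  proof (rule category.finite_cones[OF category_coc_cat])
    show "unitc \<in> Ob coc_cat" by simp
    show "\<exists>!f. f \<in> Hom coc_cat X unitc" if "X \<in> Ob coc_cat" for X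
      using that unfolding coc_cat_simps
      by (intro ex1I[of _ "cun X"] cmor_cun_unitc cmor_unitc_unique)
    show "\<exists>P p q. P \<in> Ob coc_cat \<and> p \<in> Hom coc_cat P A \<and> q \<in> Hom coc_cat P B \<and>
        (\<forall>X\<in>Ob coc_cat. \<forall>u\<in>Hom coc_cat X A. \<forall>v\<in>Hom coc_cat X B.
          \<exists>!w. w \<in> Hom coc_cat X P \<and> Comp coc_cat p w = u \<and> Comp coc_cat q w = v)"
      if "A \<in> Ob coc_cat" "B \<in> Ob coc_cat" for A B
      using that unfolding coc_cat_simps
      by (intro exI[of _ "prodc A B"] exI[of _ "pr1 A B"] exI[of _ "pr2 A B"] conjI ballI coc_product)
         (simp_all add: coc_prodc cmor_pr1 cmor_pr2)
  qed (use assms has_equalizers_coc_cat in auto)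
  then show ?thesis using that by blast
qed

end

section \<open>Hopf monoids as group objects\<close>

context symmetric_monoidal_category
begin

definition of_hopf :: "('o, 'm) hopf_data \<Rightarrow> ('o, 'm) tgrp" where
  "of_hopf H = (let c = Leaf (carr H) in
     \<lparr>gco = \<lparr>cob = c, cmu = Arr c (comul H) (c \<diamondop> c), cun = Arr c (counit H) Unit\<rparr>,
      gmul = Arr (c \<diamondop> c) (mul H) c, gone = Arr Unit (unt H) c, ginv = Arr c (antipode H) c\<rparr>)"

text \<open>Evaluates the words. It is a left inverse of \<open>of_hopf\<close>, but
  \<open>of_hopf (to_hopf G)\<close> replaces the word of G by a single letter; morphisms are
  therefore compared in \<open>gmor_iff\<close> for group objects on arbitrary words.\<close>

definition to_hopf :: "('o, 'm) tgrp \<Rightarrow> ('o, 'm) hopf_data" where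
  "to_hopf G = \<lparr>carr = tob (gob G), mul = raw (gmul G), unt = raw (gone G),
     comul = raw (cmu (gco G)), counit = raw (cun (gco G)), antipode = raw (ginv G)\<rparr>"

lemma to_of_hopf [simp]: "to_hopf (of_hopf H) = H"
  by (simp add: to_hopf_def of_hopf_def Let_def)

lemma to_hopf_simps [simp]:
  "carr (to_hopf G) = tob (gob G)" "mul (to_hopf G) = raw (gmul G)" "unt (to_hopf G) = raw (gone G)"
  "comul (to_hopf G) = raw (cmu (gco G))" "counit (to_hopf G) = raw (cun (gco G))"
  "antipode (to_hopf G) = raw (ginv G)"
  by (simp_all add: to_hopf_def)

lemma Hopf_coc_simps [simp]:
  "H \<in> Ob (Hopf_coc M) \<longleftrightarrow> hopf_monoid M H \<and> cocommutative M H"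
  "f \<in> Hom (Hopf_coc M) H K \<longleftrightarrow> hopf_morphism M H K f"
  "Comp (Hopf_coc M) = Comp M" "Id (Hopf_coc M) H = Id M (carr H)"
  by (simp_all add: Hopf_coc_def)

lemma raw_struct:
  "raw (al a b c) = \<alpha> (tob a) (tob b) (tob c)" "raw (lu a) = \<l> (tob a)" "raw (ru a) = \<r> (tob a)"
  "raw (br a b) = \<sigma> (tob a) (tob b)"
  by (simp_all add: struct_defs)

text \<open>The four bimonoid axioms say that multiplication and unit are comonoid morphisms, and
  the antipode axioms are the inverse laws.\<close>

lemma grp_of_hopf:
  assumes "H \<in> Ob (Hopf_coc M)"
  shows "grp (of_hopf H)"
proof -
  from assms have "hopf_monoid M H" and cc: "\<sigma> (carr H) (carr H) \<cdot> comul H = comul H"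
    by (auto simp: cocommutative_def)
  then interpret h: hopf_monoid M H by simp
  define c where "c = Leaf (carr H)"
  define m where "m = Arr (c \<diamondop> c) (mul H) c"
  define u where "u = Arr Unit (unt H) c"
  define d where "d = Arr c (comul H) (c \<diamondop> c)"
  define e where "e = Arr c (counit H) Unit"
  define s where "s = Arr c (antipode H) c"
  have c [simp]: "wf_tree c" "tob c = carr H" by (simp_all add: c_def h.carr_ob)
  have [simp]: "arr m" "src m = c \<diamondop> c" "tgt m = c" "raw m = mul H"
    "arr u" "src u = Unit" "tgt u = c" "raw u = unt H"
    "arr d" "src d = c" "tgt d = c \<diamondop> c" "raw d = comul H"
    "arr e" "src e = c" "tgt e = Unit" "raw e = counit H"
    "arr s" "src s = c" "tgt s = c" "raw s = antipode H"
    by (simp_all add: m_def u_def d_def e_def s_def arr_Arr h.mul_in_Hom h.unt_in_Hom h.comul_in_Hom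
        h.counit_in_Hom h.antipode_in_Hom)
  have G: "of_hopf H = \<lparr>gco = \<lparr>cob = c, cmu = d, cun = e\<rparr>, gmul = m, gone = u, ginv = s\<rparr>"
    by (simp add: of_hopf_def Let_def c_def m_def u_def d_def e_def s_def)
  note raws = raw_simps raw_struct raw_ms
  have coassoc: "al c c c \<bullet> (d \<star> idt c) \<bullet> d = (idt c \<star> d) \<bullet> d"
    and counits: "lu c \<bullet> (e \<star> idt c) \<bullet> d = idt c" "ru c \<bullet> (idt c \<star> e) \<bullet> d = idt c" "br c c \<bullet> d = d"
    and md: "d \<bullet> m = (m \<star> m) \<bullet> ms c c c c \<bullet> (d \<star> d)" and me: "e \<bullet> m = lu Unit \<bullet> (e \<star> e)"
    and ud: "d \<bullet> u \<bullet> lu Unit = u \<star> u" and ue: "e \<bullet> u = idt Unit"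
    and assoc: "m \<bullet> (m \<star> idt c) = m \<bullet> (idt c \<star> m) \<bullet> al c c c"
    and units: "m \<bullet> (u \<star> idt c) = lu c" "m \<bullet> (idt c \<star> u) = ru c"
    and invs: "m \<bullet> (s \<star> idt c) \<bullet> d = u \<bullet> e" "m \<bullet> (idt c \<star> s) \<bullet> d = u \<bullet> e"
    using h.comul_coassoc h.comul_lcounit h.comul_rcounit cc h.comul_mul h.counit_mul h.comul_unt h.counit_unt
      h.mul_assoc h.mul_lunit h.mul_runit h.antipode_left h.antipode_right
    by (auto intro!: arr_eqI simp: raws)
  \<comment> \<open>In \<open>comul_unt\<close> the unitor stands on the other side; this is the
    form in which the unit is a comonoid morphism out of \<open>unitc\<close>.\<close>
  have "(u \<star> u) \<bullet> lui Unit = d \<bullet> u"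
    by (simp add: ud[symmetric] tcomp_assoc)
  then show ?thesis
    unfolding G grp_def coc_def cmor_def prodc_def unitc_def
    using coassoc counits md me ue assoc units invs by (simp add: ty_def tcomp_assoc)
qed

lemma to_hopf_Ob:
  assumes G [simp]: "grp G"
  shows "to_hopf G \<in> Ob (Hopf_coc M)"
proof -
  let ?c = "gob G" and ?m = "gmul G" and ?u = "gone G" and ?d = "cmu (gco G)" and ?e = "cun (gco G)" and ?s = "ginv G"
  note raws = raw_simps raw_struct raw_ms
  have H: "?m \<bullet> (?m \<star> idt ?c) = ?m \<bullet> (idt ?c \<star> ?m) \<bullet> al ?c ?c ?c"
    "?d \<bullet> ?u \<bullet> lu Unit = ?u \<star> ?u" "?d \<bullet> ?m = (?m \<star> ?m) \<bullet> ms ?c ?c ?c ?c \<bullet> (?d \<star> ?d)"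
    "?e \<bullet> ?m = lu Unit \<bullet> (?e \<star> ?e)" "?e \<bullet> ?u = idt Unit"
    using grp_assoc[OF G] comp_rewr[OF cmor_cmu[OF grp_one[OF G]]] cmor_cun[OF grp_one[OF G]]
      cmor_cmu[OF grp_mul[OF G]] cmor_cun[OF grp_mul[OF G]]
    by (simp_all add: unitc_def prodc_def tcomp_assoc)
  note laws = H grp_lunit[OF G] grp_runit[OF G] grp_linv[OF G] grp_rinv[OF G]
    coc_laws[OF grp_coc[OF G]]
  note laws' = laws[THEN arg_cong, where f = raw]
  have t: "raw ?m \<in> Hom M (tob ?c \<otimes>\<^sub>o tob ?c) (tob ?c)" "raw ?u \<in> Hom M \<I> (tob ?c)"
    "raw ?d \<in> Hom M (tob ?c) (tob ?c \<otimes>\<^sub>o tob ?c)" "raw ?e \<in> Hom M (tob ?c) \<I>" "raw ?s \<in> Hom M (tob ?c) (tob ?c)"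
    using arr_raw[of ?m] arr_raw[of ?u] arr_raw[of ?d] arr_raw[of ?e] arr_raw[of ?s] by simp_all
  have "hopf_monoid M (to_hopf G)"
    unfolding hopf_monoid_def monoid_object_def monoid_object_axioms_def comonoid_object_def
      comonoid_object_axioms_def hopf_monoid_axioms_def
    using laws' t symmetric_monoidal_category_axioms by (simp add: raws)
  moreover have "cocommutative M (to_hopf G)"
    using laws' by (simp add: cocommutative_def raws)
  ultimately show ?thesis by simp
qed

lemma gmor_iff:
  assumes [simp]: "grp G" "grp H"
  shows "f \<in> Hom (Hopf_coc M) (to_hopf G) (to_hopf H) \<longleftrightarrow> gmor G H (Arr (gob G) f (gob H))"
proof (cases "f \<in> Hom M (tob (gob G)) (tob (gob H))")
  case True
  define x where "x = Arr (gob G) f (gob H)"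
  have [simp]: "arr x" "src x = gob G" "tgt x = gob H" "raw x = f"
    using True by (simp_all add: x_def arr_Arr)
  have "x \<bullet> gmul G = gmul H \<bullet> (x \<star> x) \<longleftrightarrow> raw (x \<bullet> gmul G) = raw (gmul H \<bullet> (x \<star> x))"
    "x \<bullet> gone G = gone H \<longleftrightarrow> raw (x \<bullet> gone G) = raw (gone H)"
    "cmu (gco H) \<bullet> x = (x \<star> x) \<bullet> cmu (gco G) \<longleftrightarrow> raw (cmu (gco H) \<bullet> x) = raw ((x \<star> x) \<bullet> cmu (gco G))"
    "cun (gco H) \<bullet> x = cun (gco G) \<longleftrightarrow> raw (cun (gco H) \<bullet> x) = raw (cun (gco G))"
    by (auto intro: arr_eqI)
  then show ?thesis
    using True unfolding x_def[symmetric]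
    by (auto simp: gmor_def cmor_def ty_def hopf_morphism_def raw_simps)
next
  case False
  then show ?thesis
    by (auto simp: gmor_def cmor_def ty_def hopf_morphism_def arr_Arr)
qed

lemma gmor_Arr: "gmor G H x \<Longrightarrow> Arr (gob G) (raw x) (gob H) = x"
  by (auto simp: gmor_def cmor_def ty_def elim!: arrE)

lemma gmor_raw: "\<lbrakk>gmor G H x; grp G; grp H\<rbrakk> \<Longrightarrow> raw x \<in> Hom (Hopf_coc M) (to_hopf G) (to_hopf H)"
  using gmor_iff gmor_Arr by metis


lemma gmor_of_hopf:
  assumes "f \<in> Hom (Hopf_coc M) H K" "H \<in> Ob (Hopf_coc M)" "K \<in> Ob (Hopf_coc M)"
  shows "gmor (of_hopf H) (of_hopf K) (Arr (gob (of_hopf H)) f (gob (of_hopf K)))"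
  using gmor_iff[of "of_hopf H" "of_hopf K" f] assms grp_of_hopf by simp

lemma gmor_comp:
  assumes f: "gmor G H f" and g: "gmor H K g"
  shows "gmor G K (g \<bullet> f)"
proof -
  have "(g \<bullet> f) \<bullet> gmul G = gmul K \<bullet> ((g \<bullet> f) \<star> (g \<bullet> f))"
    using f g comp_rewr[of g "gmul H" "gmul K" "g \<star> g"] by (simp add: gmor_def tcomp_assoc tens_comp)
  moreover have "(g \<bullet> f) \<bullet> gone G = gone K"
    using f g by (simp add: gmor_def tcomp_assoc)
  ultimately show ?thesis
    using f g cmor_comp by (auto simp: gmor_def)
qed

lemma gmor_idt: "grp G \<Longrightarrow> gmor G G (idt (gob G))"
  by (simp add: gmor_def cmor_idt)

lemma category_Hopf_coc: "category (Hopf_coc M)"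
proof
  fix A assume A: "A \<in> Ob (Hopf_coc M)"
  show "Id (Hopf_coc M) A \<in> Hom (Hopf_coc M) A A"
    using gmor_raw[OF gmor_idt[OF grp_of_hopf[OF A]] grp_of_hopf[OF A] grp_of_hopf[OF A]]
    by (simp add: raw_simps) (simp add: of_hopf_def Let_def)
next
  fix A B D f g
  assume H: "A \<in> Ob (Hopf_coc M)" "B \<in> Ob (Hopf_coc M)" "D \<in> Ob (Hopf_coc M)"
    and f: "f \<in> Hom (Hopf_coc M) A B" and g: "g \<in> Hom (Hopf_coc M) B D"
  note f' = gmor_of_hopf[OF f H(1,2)] and g' = gmor_of_hopf[OF g H(2,3)]
  show "Comp (Hopf_coc M) g f \<in> Hom (Hopf_coc M) A D"
    using gmor_raw[OF gmor_comp[OF f' g'] grp_of_hopf[OF H(1)] grp_of_hopf[OF H(3)]]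
      cmor_ty[OF gmor_cmor[OF f']] cmor_ty[OF gmor_cmor[OF g']] by (simp add: raw_simps)
next
  fix A B f assume "A \<in> Ob (Hopf_coc M)" "B \<in> Ob (Hopf_coc M)" "f \<in> Hom (Hopf_coc M) A B"
  then have "carr A \<in> Ob M" "carr B \<in> Ob M" "f \<in> Hom M (carr A) (carr B)"
    by (auto simp: hopf_morphism_def hopf_monoid_def monoid_object_def monoid_object_axioms_def)
  then show "Comp (Hopf_coc M) f (Id (Hopf_coc M) A) = f" "Comp (Hopf_coc M) (Id (Hopf_coc M) B) f = f"
    by (simp_all add: Comp_Id Id_Comp)
next
  fix A B D E f g h
  assume "A \<in> Ob (Hopf_coc M)" "B \<in> Ob (Hopf_coc M)" "D \<in> Ob (Hopf_coc M)" "E \<in> Ob (Hopf_coc M)"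
    "f \<in> Hom (Hopf_coc M) A B" "g \<in> Hom (Hopf_coc M) B D" "h \<in> Hom (Hopf_coc M) D E"
  then show "Comp (Hopf_coc M) (Comp (Hopf_coc M) h g) f = Comp (Hopf_coc M) h (Comp (Hopf_coc M) g f)"
    using Comp_assoc[of "carr A" "carr B" "carr D" "carr E" f g h]
    by (auto simp: hopf_morphism_def hopf_monoid_def monoid_object_def monoid_object_axioms_def)
qed

end

section \<open>Limits of cocommutative Hopf monoids\<close>

context equalizer_monoidal_category
begin

lemma grp_cones:
  assumes I: "finite I" and D [simp]: "\<And>i. i \<in> I \<Longrightarrow> grp (D i)" and K: "finite K"
    and arrs: "\<And>i j a. (i, j, a) \<in> K \<Longrightarrow> i \<in> I \<and> j \<in> I \<and> gmor (D i) (D j) a"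
  obtains L \<pi> where "grp L" "\<And>i. i \<in> I \<Longrightarrow> gmor L (D i) (\<pi> i)" "\<And>i j a. (i, j, a) \<in> K \<Longrightarrow> a \<bullet> \<pi> i = \<pi> j"
    "\<And>X \<phi>. \<lbrakk>grp X; \<And>i. i \<in> I \<Longrightarrow> gmor X (D i) (\<phi> i); \<And>i j a. (i, j, a) \<in> K \<Longrightarrow> a \<bullet> \<phi> i = \<phi> j\<rbrakk>
       \<Longrightarrow> \<exists>!t. gmor X L t \<and> (\<forall>i\<in>I. \<pi> i \<bullet> t = \<phi> i)"
proof -
  obtain L0 :: "('o, 'm) coalg" and \<pi> where u: "category.universal_cone coc_cat I K (\<lambda>i. gco (D i)) L0 \<pi>"
    by (rule coc_cones[of I "\<lambda>i. gco (D i)" K]) (use I K arrs gmor_cmor in auto)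
  have L0 [simp]: "coc L0" and \<pi>: "\<And>i. i \<in> I \<Longrightarrow> cmor L0 (gco (D i)) (\<pi> i)"
    and \<pi>K: "\<And>i j a. (i, j, a) \<in> K \<Longrightarrow> a \<bullet> \<pi> i = \<pi> j"
    using u unfolding category.universal_cone_def[OF category_coc_cat] by auto
  have univ: "\<exists>!t. cmor X L0 t \<and> (\<forall>i\<in>I. \<pi> i \<bullet> t = \<phi> i)"
    if "coc X" and "\<And>i. i \<in> I \<Longrightarrow> cmor X (gco (D i)) (\<phi> i)" "\<And>i j a. (i, j, a) \<in> K \<Longrightarrow> a \<bullet> \<phi> i = \<phi> j"
    for X :: "('o, 'm) coalg" and \<phi>
  proof -
    have "\<forall>(i, j, a)\<in>K. a \<bullet> \<phi> i = \<phi> j" using that by auto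
    then show ?thesis
      using u that(1,2) unfolding category.universal_cone_def[OF category_coc_cat] by simp
  qed
  have \<pi>Kx: "a \<bullet> \<pi> i \<bullet> x = \<pi> j \<bullet> x" if "(i, j, a) \<in> K" for i j a x
    using \<pi>K[OF that] by (simp flip: tcomp_assoc)
  have mono: "x = y" if X: "coc X" and x: "cmor X L0 x" and y: "cmor X L0 y"
    and xy: "\<And>i. i \<in> I \<Longrightarrow> \<pi> i \<bullet> x = \<pi> i \<bullet> y" for X :: "('o, 'm) coalg" and x y
  proof -
    have "\<exists>!t. cmor X L0 t \<and> (\<forall>i\<in>I. \<pi> i \<bullet> t = \<pi> i \<bullet> y)"
      by (rule univ[OF X]) (use \<pi> y in \<open>auto simp: \<pi>Kx intro: cmor_comp\<close>)
    then show ?thesis using x y xy by blast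
  qed
  obtain L where L: "grp L" and gL: "gco L = L0" and gm: "\<And>i. i \<in> I \<Longrightarrow> gmor L (D i) (\<pi> i)"
  proof (rule lift_grp[OF L0 D \<pi> mono])
    fix X :: "('o, 'm) coalg" and x y
    assume X: "coc X" and x: "cmor X L0 x" and y: "cmor X L0 y"
    have "\<exists>!t. cmor X L0 t \<and> (\<forall>i\<in>I. \<pi> i \<bullet> t = cv X (D i) (\<pi> i \<bullet> x) (\<pi> i \<bullet> y))"
    proof (rule univ[OF X])
      show "cmor X (gco (D i)) (cv X (D i) (\<pi> i \<bullet> x) (\<pi> i \<bullet> y))" if "i \<in> I" for i
        by (intro cmor_cv X D cmor_comp[OF x \<pi>] cmor_comp[OF y \<pi>] that)
      show "a \<bullet> cv X (D i) (\<pi> i \<bullet> x) (\<pi> i \<bullet> y) = cv X (D j) (\<pi> j \<bullet> x) (\<pi> j \<bullet> y)" if "(i, j, a) \<in> K" for i j a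
        using gmor_cv[of "D i" "D j" a] arrs[OF that] by (simp add: \<pi>Kx[OF that])
    qed
    then show "\<exists>z. cmor X L0 z \<and> (\<forall>i\<in>I. \<pi> i \<bullet> z = cv X (D i) (\<pi> i \<bullet> x) (\<pi> i \<bullet> y))" by blast
  next
    have "\<exists>!t. cmor unitc L0 t \<and> (\<forall>i\<in>I. \<pi> i \<bullet> t = gone (D i))"
      by (rule univ) (use arrs in \<open>auto simp: grp_one gmor_def\<close>)
    then show "\<exists>z. cmor unitc L0 z \<and> (\<forall>i\<in>I. \<pi> i \<bullet> z = gone (D i))" by blast
  next
    have inv: "cmor L0 (gco (D i)) (ginv (D i) \<bullet> \<pi> i)" if "i \<in> I" for i
      using that \<pi> by (intro cmor_comp[OF _ cmor_ginv]) auto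
    \<comment> \<open>The left-hand side is a left and the right-hand side a right convolution
      inverse of \<open>\<pi> j\<close>, so they agree. Thus the inverted projections form a cone
      again.\<close>
    have "a \<bullet> ginv (D i) \<bullet> \<pi> i = ginv (D j) \<bullet> \<pi> j" if a: "(i, j, a) \<in> K" for i j a
    proof -
      have i [simp]: "i \<in> I" and j [simp]: "j \<in> I" and g: "gmor (D i) (D j) a" using arrs[OF a] by auto
      note [simp] = cmor_ty(1-3)[OF gmor_cmor[OF g]] cmor_ty(1-3)[OF \<pi>]
      have 1: "cv L0 (D j) (a \<bullet> ginv (D i) \<bullet> \<pi> i) (\<pi> j) = triv L0 (D j)"
        using gmor_cv[OF g, of L0 "ginv (D i) \<bullet> \<pi> i" "\<pi> i"] cv_inv_left[OF D[OF i] \<pi>[OF i]] gmor_triv[OF g, of L0]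
        by (simp add: \<pi>K[OF a])
      have "a \<bullet> ginv (D i) \<bullet> \<pi> i = cv L0 (D j) (a \<bullet> ginv (D i) \<bullet> \<pi> i) (cv L0 (D j) (\<pi> j) (ginv (D j) \<bullet> \<pi> j))"
        using cv_inv_right[OF D[OF j] \<pi>[OF j]] by (simp add: cv_triv_right)
      also have "\<dots> = ginv (D j) \<bullet> \<pi> j"
        by (simp add: cv_assoc[symmetric] 1 cv_triv_left)
      finally show ?thesis .
    qed
    then have "\<exists>!t. cmor L0 L0 t \<and> (\<forall>i\<in>I. \<pi> i \<bullet> t = ginv (D i) \<bullet> \<pi> i)"
      by (intro univ) (auto intro: inv)
    then show "\<exists>z. cmor L0 L0 z \<and> (\<forall>i\<in>I. \<pi> i \<bullet> z = ginv (D i) \<bullet> \<pi> i)" by blast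
  qed auto
  have "\<exists>!t. gmor X L t \<and> (\<forall>i\<in>I. \<pi> i \<bullet> t = \<phi> i)"
    if X [simp]: "grp X" and \<phi>: "\<And>i. i \<in> I \<Longrightarrow> gmor X (D i) (\<phi> i)" and \<phi>K: "\<And>i j a. (i, j, a) \<in> K \<Longrightarrow> a \<bullet> \<phi> i = \<phi> j"
    for X \<phi>
  proof -
    have ex: "\<exists>!t. cmor (gco X) L0 t \<and> (\<forall>i\<in>I. \<pi> i \<bullet> t = \<phi> i)"
      by (rule univ) (use \<phi> \<phi>K gmor_cmor in auto)
    then obtain t where t: "cmor (gco X) L0 t" and t': "\<And>i. i \<in> I \<Longrightarrow> \<pi> i \<bullet> t = \<phi> i" by blast
    have tx: "\<pi> i \<bullet> t \<bullet> x = \<phi> i \<bullet> x" if "i \<in> I" for i x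
      using t'[OF that] by (simp flip: tcomp_assoc)
    \<comment> \<open>The mediating comonoid morphism respects the operations because each
      \<open>\<phi> i\<close> and \<open>\<pi> i\<close> does, which \<open>mono\<close>
      reflects.\<close>
    have "t \<bullet> gmul X = gmul L \<bullet> (t \<star> t)"
    proof (rule mono[of "prodc (gco X) (gco X)"])
      show "cmor (prodc (gco X) (gco X)) L0 (t \<bullet> gmul X)" by (intro cmor_comp[OF grp_mul t] X)
      show "cmor (prodc (gco X) (gco X)) L0 (gmul L \<bullet> (t \<star> t))"
        by (rule cmor_comp[OF cmor_tens grp_mul[OF L, unfolded gL]]) (use t X in auto)
      fix i assume i: "i \<in> I"
      have "\<phi> i \<bullet> gmul X = (\<pi> i \<bullet> gmul L) \<bullet> (t \<star> t)"
        using \<phi>[OF i] gm[OF i] by (simp add: gmor_def tcomp_assoc tens_comp t'[OF i])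
      then show "\<pi> i \<bullet> t \<bullet> gmul X = \<pi> i \<bullet> gmul L \<bullet> (t \<star> t)"
        using i by (simp add: tx tcomp_assoc)
    qed (simp add: coc_prodc)
    moreover have "t \<bullet> gone X = gone L"
    proof (rule mono[of unitc])
      show "cmor unitc L0 (t \<bullet> gone X)" by (intro cmor_comp[OF grp_one t] X)
      show "cmor unitc L0 (gone L)" using grp_one[OF L] gL by simp
      show "\<pi> i \<bullet> t \<bullet> gone X = \<pi> i \<bullet> gone L" if "i \<in> I" for i
        using that \<phi>[of i] gm[of i] by (simp add: tx gmor_def)
    qed simp
    ultimately have "gmor X L t" using t gL by (simp add: gmor_def)
    moreover have "cmor (gco X) L0 t'" if "gmor X L t'" for t' using that gL by (simp add: gmor_def)
    ultimately show ?thesis using t' ex by (intro ex1I[of _ t]) blast+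
  qed
  then show ?thesis
    using that[OF L gm \<pi>K] by blast
qed

lemma finitely_complete_Hopf_coc: "finitely_complete (Hopf_coc M)"
  unfolding finitely_complete_def
proof (intro conjI allI impI)
  show "category (Hopf_coc M)" by (rule category_Hopf_coc)
  fix J :: "(nat, nat) cat" and Do Da
  assume J: "finite_category J \<and> is_functor J (Hopf_coc M) Do Da"
  then have DO: "\<And>i. i \<in> Ob J \<Longrightarrow> Do i \<in> Ob (Hopf_coc M)"
    and DA: "\<And>i j a. \<lbrakk>i \<in> Ob J; j \<in> Ob J; a \<in> Hom J i j\<rbrakk> \<Longrightarrow> Da a \<in> Hom (Hopf_coc M) (Do i) (Do j)"
    by (auto simp: is_functor_def)
  define D where "D i = of_hopf (Do i)" for i
  \<comment> \<open>Every arrow is labelled with its ends, since the hom-sets of J for different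
    pairs of objects may overlap.\<close>
  define A where "A = (\<lambda>(i, j, a). (i, j, Arr (gob (D i)) (Da a) (gob (D j))))"
  define K where "K = A ` (SIGMA i:Ob J. SIGMA j:Ob J. Hom J i j)"
  have D: "grp (D i)" and toD: "to_hopf (D i) = Do i" if "i \<in> Ob J" for i
    using grp_of_hopf[OF DO[OF that]] by (simp_all add: D_def)
  have "finite (SIGMA i:Ob J. SIGMA j:Ob J. Hom J i j)"
    using J by (auto simp: finite_category_def)
  then have K: "finite K" by (simp add: K_def)
  have DA': "gmor (D i) (D j) (Arr (gob (D i)) (Da a) (gob (D j)))" if "i \<in> Ob J" "j \<in> Ob J" "a \<in> Hom J i j" for i j a
    using gmor_of_hopf[OF DA[OF that] DO DO] that by (simp add: D_def)
  obtain L \<pi> where L: "grp L" and \<pi>: "\<And>i. i \<in> Ob J \<Longrightarrow> gmor L (D i) (\<pi> i)"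
    and \<pi>K: "\<And>i j a. (i, j, a) \<in> K \<Longrightarrow> a \<bullet> \<pi> i = \<pi> j"
    and univ: "\<And>X \<phi>. \<lbrakk>grp X; \<And>i. i \<in> Ob J \<Longrightarrow> gmor X (D i) (\<phi> i); \<And>i j a. (i, j, a) \<in> K \<Longrightarrow> a \<bullet> \<phi> i = \<phi> j\<rbrakk>
       \<Longrightarrow> \<exists>!t. gmor X L t \<and> (\<forall>i\<in>Ob J. \<pi> i \<bullet> t = \<phi> i)"
    by (rule grp_cones[of "Ob J" D K]) (use J D K DA' in \<open>auto simp: finite_category_def K_def A_def\<close>)
  have raw_comp: "raw (x \<bullet> y) = raw x \<cdot> raw y" if "gmor G H y" "gmor H K x" for G H K x y
    using that by (intro raw_simps) (auto simp: gmor_def cmor_def ty_def)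
  have "is_cone J (Hopf_coc M) Do Da (to_hopf L) (\<lambda>i. raw (\<pi> i))"
    unfolding is_cone_def
  proof (intro conjI ballI)
    show "to_hopf L \<in> Ob (Hopf_coc M)" by (rule to_hopf_Ob[OF L])
    show "raw (\<pi> i) \<in> Hom (Hopf_coc M) (to_hopf L) (Do i)" if "i \<in> Ob J" for i
      using gmor_raw[OF \<pi> L D] toD that by simp
    fix i j a assume ij: "i \<in> Ob J" "j \<in> Ob J" "a \<in> Hom J i j"
    have "Arr (gob (D i)) (Da a) (gob (D j)) \<bullet> \<pi> i = \<pi> j"
      by (rule \<pi>K) (use ij in \<open>force simp: K_def A_def\<close>)
    then show "Comp (Hopf_coc M) (Da a) (raw (\<pi> i)) = raw (\<pi> j)"
      using raw_comp[OF \<pi> DA'] ij by fastforce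
  qed
  moreover have "\<exists>!t. t \<in> Hom (Hopf_coc M) X (to_hopf L) \<and> (\<forall>i\<in>Ob J. Comp (Hopf_coc M) (raw (\<pi> i)) t = \<phi> i)"
    if cone: "is_cone J (Hopf_coc M) Do Da X \<phi>" for X \<phi>
  proof -
    have X: "X \<in> Ob (Hopf_coc M)" and \<phi>: "\<And>i. i \<in> Ob J \<Longrightarrow> \<phi> i \<in> Hom (Hopf_coc M) X (Do i)"
      and \<phi>K: "\<And>i j a. \<lbrakk>i \<in> Ob J; j \<in> Ob J; a \<in> Hom J i j\<rbrakk> \<Longrightarrow> Da a \<cdot> \<phi> i = \<phi> j"
      using cone by (auto simp: is_cone_def)
    define Y where "Y = of_hopf X"
    have Y: "grp Y" and toY: "to_hopf Y = X" using grp_of_hopf[OF X] by (simp_all add: Y_def)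
    define \<psi> where "\<psi> i = Arr (gob Y) (\<phi> i) (gob (D i))" for i
    have \<psi>: "gmor Y (D i) (\<psi> i)" if "i \<in> Ob J" for i
      using gmor_of_hopf[OF \<phi> X DO] that by (simp add: \<psi>_def Y_def D_def)
    have "a \<bullet> \<psi> i = \<psi> j" if ija: "(i, j, a) \<in> K" for i j a
    proof -
      obtain b where b: "i \<in> Ob J" "j \<in> Ob J" "b \<in> Hom J i j" and a: "a = Arr (gob (D i)) (Da b) (gob (D j))"
        using ija by (auto simp: K_def A_def)
      have "gmor (D i) (D j) a" using DA'[OF b] by (simp add: a)
      from raw_comp[OF \<psi>[OF b(1)] this] cmor_ty[OF gmor_cmor[OF this]] cmor_ty[OF gmor_cmor[OF \<psi>[OF b(1)]]]
        cmor_ty[OF gmor_cmor[OF \<psi>[OF b(2)]]]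
      show ?thesis
        using \<phi>K[OF b] by (intro arr_eqI) (simp_all, simp add: a \<psi>_def)
    qed
    then have ex: "\<exists>!t. gmor Y L t \<and> (\<forall>i\<in>Ob J. \<pi> i \<bullet> t = \<psi> i)"
      by (intro univ Y \<psi>)
    then obtain t where t: "gmor Y L t" "\<And>i. i \<in> Ob J \<Longrightarrow> \<pi> i \<bullet> t = \<psi> i" by blast
    show ?thesis
    proof (intro ex1I conjI ballI)
      show "raw t \<in> Hom (Hopf_coc M) X (to_hopf L)" using gmor_raw[OF t(1) Y L] toY by simp
      show "Comp (Hopf_coc M) (raw (\<pi> i)) (raw t) = \<phi> i" if "i \<in> Ob J" for i
        using raw_comp[OF t(1) \<pi>[OF that]] t(2)[OF that] by (simp add: \<psi>_def)
      fix w assume w: "w \<in> Hom (Hopf_coc M) X (to_hopf L) \<and> (\<forall>i\<in>Ob J. Comp (Hopf_coc M) (raw (\<pi> i)) w = \<phi> i)"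
      define v where "v = Arr (gob Y) w (gob L)"
      have v: "gmor Y L v" using gmor_iff[OF Y L, of w] w toY by (simp add: v_def)
      have "\<pi> i \<bullet> v = \<psi> i" if i: "i \<in> Ob J" for i
      proof (rule arr_eqI)
        show "raw (\<pi> i \<bullet> v) = raw (\<psi> i)"
          using raw_comp[OF v \<pi>[OF i]] w i by (simp add: v_def \<psi>_def)
      qed (use cmor_ty[OF gmor_cmor[OF v]] cmor_ty[OF gmor_cmor[OF \<pi>[OF i]]] cmor_ty[OF gmor_cmor[OF \<psi>[OF i]]] in auto)
      then have "v = t" using ex v t by blast
      then show "w = raw t" by (auto simp: v_def)
    qed
  qed
  ultimately show "\<exists>L \<pi>. is_limit J (Hopf_coc M) Do Da L \<pi>"
    unfolding is_limit_def by blast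
qed

end

section \<open>Protomodularity\<close>

context symmetric_monoidal_category
begin

text \<open>Written as the convolution of two constant elements on the product of G with itself, the
  right-hand side of multiplicativity is again constant. Paired with a kernel, this morphism gives a
  cone over the pullback.\<close>

lemma gmor_trivial:
  assumes [simp]: "grp G" "grp H"
  shows "gmor G H (triv (gco G) H)"
proof -
  let ?P = "prodc (gco G) (gco G)" and ?t = "triv (gco G) H"
  have P [simp]: "coc ?P" by (simp add: coc_prodc)
  have "gmul H \<bullet> (?t \<star> ?t) = cv ?P H (?t \<bullet> pr1 (gco G) (gco G)) (?t \<bullet> pr2 (gco G) (gco G))"
    by (simp add: cv_def pair_pr flip: tens_pair)
  also have "\<dots> = triv ?P H"
    by (simp add: triv_comp[OF cmor_pr1] triv_comp[OF cmor_pr2] cv_triv_left)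
  also have "\<dots> = ?t \<bullet> gmul G"
    by (simp add: triv_comp[OF grp_mul])
  finally have "?t \<bullet> gmul G = gmul H \<bullet> (?t \<star> ?t)" by simp
  moreover have "?t \<bullet> gone G = gone H"
    by (simp add: triv_comp[OF grp_one]) (simp add: triv_def unitc_def)
  ultimately show ?thesis by (simp add: gmor_def cmor_triv)
qed

end

context equalizer_monoidal_category
begin

text \<open>Both \<open>f\<close> and its restriction to kernels act on generalised elements, so the argument is the
  elementary one for groups: write \<open>a = (a (s p a)\<^sup>-\<^sup>1) (s p a)\<close> with the first factor in the kernel.\<close>

lemma point_morphism_iso:
  assumes grps [simp]: "grp A" "grp A'" "grp B" "grp E" "grp P" "grp P'"
    and p: "gmor A B p" and s: "gmor B A s" and p': "gmor A' B p'" and s': "gmor B A' s'"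
    and ps': "p' \<bullet> s' = idt (gob B)"
    and f: "gmor A A' f" and pf: "p' \<bullet> f = p" and fs: "f \<bullet> s = s'"
    and h: "gmor E B h" and r: "gmor P E r" and q: "gmor P A q" and r': "gmor P' E r'" and q': "gmor P' A' q'"
    and ex: "\<And>X u v. \<lbrakk>grp X; gmor X E u; gmor X A v; h \<bullet> u = p \<bullet> v\<rbrakk> \<Longrightarrow> \<exists>w. gmor X P w \<and> r \<bullet> w = u \<and> q \<bullet> w = v"
    and ex': "\<And>X u v. \<lbrakk>grp X; gmor X E u; gmor X A' v; h \<bullet> u = p' \<bullet> v\<rbrakk> \<Longrightarrow> \<exists>w. gmor X P' w \<and> r' \<bullet> w = u \<and> q' \<bullet> w = v"
    and un': "\<And>X w w'. \<lbrakk>grp X; gmor X P' w; gmor X P' w'; r' \<bullet> w = r' \<bullet> w'; q' \<bullet> w = q' \<bullet> w'\<rbrakk> \<Longrightarrow> w = w'"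
    and f': "gmor P P' f'" and rf': "r' \<bullet> f' = r" and qf': "q' \<bullet> f' = f \<bullet> q"
    and g': "gmor P' P g'" and gf': "g' \<bullet> f' = idt (gob P)" and fg': "f' \<bullet> g' = idt (gob P')"
  obtains g where "gmor A' A g" "f \<bullet> g = idt (gob A')" "g \<bullet> f = idt (gob A)"
proof -
  note cm = gmor_cmor[OF p] gmor_cmor[OF s] gmor_cmor[OF p'] gmor_cmor[OF s'] gmor_cmor[OF f]
    gmor_cmor[OF q] gmor_cmor[OF g'] gmor_cmor[OF f'] gmor_cmor[OF q'] gmor_cmor[OF r'] gmor_cmor[OF r]
  note [simp] = cm[THEN cmor_ty(1)] cm[THEN cmor_ty(2)] cm[THEN cmor_ty(3)]
  have inj_ker: "x = triv X A" if X: "coc X" and x: "cmor X (gco A) x" and fx: "f \<bullet> x = triv X A'"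
    for X :: "('o, 'm) coalg" and x
  proof -
    obtain K k where K [simp]: "grp K" and k: "gmor K A k" and fk: "f \<bullet> k = triv (gco K) A'"
      and un: "\<And>X x. \<lbrakk>coc X; cmor X (gco A) x; f \<bullet> x = triv X A'\<rbrakk> \<Longrightarrow> \<exists>y. cmor X (gco K) y \<and> k \<bullet> y = x"
      using grp_kernel[OF grps(1,2) f] by blast
    obtain y where y: "cmor X (gco K) y" "k \<bullet> y = x" using un[OF X x fx] by blast
    \<comment> \<open>The pullback property is available for group objects only, so it is applied to
      k; the result for x follows by restriction along y.\<close>
    have "p \<bullet> k = triv (gco K) B"
      using gmor_triv[OF p', of "gco K"] by (simp add: pf[symmetric] fk tcomp_assoc)
    then obtain w where w: "gmor K P w" "r \<bullet> w = triv (gco K) E" "q \<bullet> w = k"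
      using ex[OF K gmor_trivial[OF K grps(4)] k] gmor_triv[OF h, of "gco K"] by auto
    \<comment> \<open>Both components of \<open>f' \<bullet> w\<close> are trivial, so it is
      trivial; as f' is invertible, w is trivial too, and so is k = q w.\<close>
    have "f' \<bullet> w = triv (gco K) P'"
    proof (rule un'[OF K])
      show "gmor K P' (f' \<bullet> w)" by (rule gmor_comp[OF w(1) f'])
      show "gmor K P' (triv (gco K) P')" by (simp add: gmor_trivial)
      show "r' \<bullet> f' \<bullet> w = r' \<bullet> triv (gco K) P'"
        using w(2) by (simp add: gmor_triv[OF r'] rf' flip: tcomp_assoc)
      show "q' \<bullet> f' \<bullet> w = q' \<bullet> triv (gco K) P'"
        using w(3) fk by (simp add: gmor_triv[OF q'] comp_rewr[OF qf'])
    qed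
    then have "g' \<bullet> f' \<bullet> w = triv (gco K) P"
      by (simp add: gmor_triv[OF g'])
    then have "w = triv (gco K) P"
      using cmor_ty[OF gmor_cmor[OF w(1)]] by (simp add: comp_cancel[OF gf'])
    then have "k = triv (gco K) A"
      using w(3) by (simp add: gmor_triv[OF q])
    then show ?thesis using y triv_comp by auto
  qed
  have inj: "x = y" if X [simp]: "coc X" and x: "cmor X (gco A) x" and y: "cmor X (gco A) y" and xy: "f \<bullet> x = f \<bullet> y"
    for X :: "('o, 'm) coalg" and x y
  proof -
    note [simp] = cmor_ty(1-3)[OF x] cmor_ty(1-3)[OF y]
    \<comment> \<open>As for groups, f kills x y^-1, and a trivial kernel gives x = y.\<close>
    have iy: "cmor X (gco A) (ginv A \<bullet> y)" by (rule cmor_comp[OF y cmor_ginv]) simp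
    have "f \<bullet> cv X A x (ginv A \<bullet> y) = f \<bullet> cv X A y (ginv A \<bullet> y)"
      by (simp add: gmor_cv[OF f] xy)
    also have "\<dots> = triv X A'"
      by (simp add: cv_inv_right[OF _ y] gmor_triv[OF f])
    finally have "cv X A x (ginv A \<bullet> y) = triv X A"
      by (intro inj_ker cmor_cv x iy) auto
    then have "cv X A (cv X A x (ginv A \<bullet> y)) y = y"
      by (simp add: cv_triv_left)
    then show ?thesis
      by (simp add: cv_assoc cv_inv_left[OF _ y] cv_triv_right)
  qed
  have surj_ker: "\<exists>x. cmor X (gco A) x \<and> f \<bullet> x = b" if X: "coc X" and b: "cmor X (gco A') b" and pb: "p' \<bullet> b = triv X B"
    for X :: "('o, 'm) coalg" and b
  proof -
    obtain K k where K [simp]: "grp K" and k: "gmor K A' k" and pk: "p' \<bullet> k = triv (gco K) B"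
      and un: "\<And>X x. \<lbrakk>coc X; cmor X (gco A') x; p' \<bullet> x = triv X B\<rbrakk> \<Longrightarrow> \<exists>y. cmor X (gco K) y \<and> k \<bullet> y = x"
      using grp_kernel[OF grps(2,3) p'] by blast
    obtain y where y: "cmor X (gco K) y" "k \<bullet> y = b" using un[OF X b pb] by blast
    obtain w where w: "gmor K P' w" "r' \<bullet> w = triv (gco K) E" "q' \<bullet> w = k"
      using ex'[OF K gmor_trivial[OF K grps(4)] k] gmor_triv[OF h, of "gco K"] pk by auto
    \<comment> \<open>The element b, lifted to P' with trivial component in E, is carried back to P
      by g' and then projected to A by q.\<close>
    have "f \<bullet> q \<bullet> g' \<bullet> w \<bullet> y = q' \<bullet> f' \<bullet> g' \<bullet> w \<bullet> y"
      by (simp add: comp_rewr[OF qf'])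
    also have "\<dots> = (q' \<bullet> w) \<bullet> y"
      using cmor_ty[OF gmor_cmor[OF w(1)]] cmor_ty[OF y(1)] by (simp add: comp_cancel[OF fg'] tcomp_assoc)
    also have "\<dots> = b" by (simp add: w y)
    finally have "f \<bullet> q \<bullet> g' \<bullet> w \<bullet> y = b" .
    moreover have "cmor X (gco A) (q \<bullet> g' \<bullet> w \<bullet> y)"
      using y(1) w(1) g' q by (auto intro!: cmor_comp gmor_cmor)
    ultimately show ?thesis by blast
  qed
  have surj: "\<exists>x. cmor X (gco A) x \<and> f \<bullet> x = a" if X [simp]: "coc X" and a: "cmor X (gco A') a"
    for X :: "('o, 'm) coalg" and a
  proof -
    let ?c = "s' \<bullet> p' \<bullet> a"
    note [simp] = cmor_ty(1-3)[OF a]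
    have c: "cmor X (gco A') ?c" using a cm(3,4) cmor_comp by blast
    have ic: "cmor X (gco A') (ginv A' \<bullet> ?c)" by (rule cmor_comp[OF c cmor_ginv]) simp
    \<comment> \<open>Since p' s' = 1, the elements a and s' p' a have the same image under p', so
      the quotient of a by s' p' a lies in the kernel of p'.\<close>
    have "p' \<bullet> cv X A' a (ginv A' \<bullet> ?c) = p' \<bullet> cv X A' ?c (ginv A' \<bullet> ?c)"
      by (simp add: gmor_cv[OF p'] comp_cancel[OF ps'])
    also have "\<dots> = triv X B"
      by (simp add: cv_inv_right[OF _ c] gmor_triv[OF p'])
    finally obtain x where x: "cmor X (gco A) x" "f \<bullet> x = cv X A' a (ginv A' \<bullet> ?c)"
      using surj_ker[OF X cmor_cv[OF X grps(2) a ic]] by blast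
    \<comment> \<open>The remaining factor s' p' a has the preimage s p' a because f s = s'.\<close>
    have sp: "cmor X (gco A) (s \<bullet> p' \<bullet> a)" using a cm(2,3) cmor_comp by blast
    have "f \<bullet> s \<bullet> p' \<bullet> a = ?c" using fs by (simp flip: tcomp_assoc)
    then have "f \<bullet> cv X A x (s \<bullet> p' \<bullet> a) = cv X A' (cv X A' a (ginv A' \<bullet> ?c)) ?c"
      by (simp add: gmor_cv[OF f] x)
    also have "\<dots> = a"
      by (simp add: cv_assoc cv_inv_left[OF _ c] cv_triv_right)
    finally show ?thesis
      using cmor_cv[OF X grps(1) x(1) sp] by blast
  qed
  \<comment> \<open>A preimage of the generic element \<open>idt (gob A')\<close> is a section of f.
    Injectivity on generalised elements makes it a two-sided inverse and also yields its
    compatibility with the operations.\<close>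
  obtain g where g: "cmor (gco A') (gco A) g" and fg: "f \<bullet> g = idt (gob A')"
    using surj[OF _ cmor_idt] by auto
  note [simp] = cmor_ty(1-3)[OF g]
  have fg_comp: "f \<bullet> g \<bullet> x = x" if "arr x" "tgt x = gob A'" for x
    using that comp_cancel[OF fg] by simp
  have gf: "g \<bullet> f = idt (gob A)"
    by (rule inj[of "gco A"]) (use cmor_comp[OF cm(5) g] in \<open>auto simp: fg_comp cmor_idt\<close>)
  have "g \<bullet> gmul A' = gmul A \<bullet> (g \<star> g)"
  proof (rule inj[of "prodc (gco A') (gco A')"])
    show "f \<bullet> g \<bullet> gmul A' = f \<bullet> gmul A \<bullet> (g \<star> g)"
      using comp_rewr[of f "gmul A" "gmul A'" "f \<star> f" "g \<star> g"] f by (simp add: gmor_def fg_comp tens_comp fg)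
    show "cmor (prodc (gco A') (gco A')) (gco A) (g \<bullet> gmul A')"
      by (intro cmor_comp[OF grp_mul g]) simp
    show "cmor (prodc (gco A') (gco A')) (gco A) (gmul A \<bullet> (g \<star> g))"
      by (intro cmor_comp[OF cmor_tens grp_mul] g) simp_all
  qed (simp add: coc_prodc)
  moreover have "g \<bullet> gone A' = gone A"
  proof (rule inj[of unitc])
    show "f \<bullet> g \<bullet> gone A' = f \<bullet> gone A" using f by (simp add: gmor_def fg_comp)
    show "cmor unitc (gco A) (g \<bullet> gone A')"
      by (intro cmor_comp[OF grp_one g]) simp
  qed (simp_all add: grp_one)
  ultimately have "gmor A' A g" using g by (simp add: gmor_def)
  then show ?thesis using that fg gf by blast
qed

section \<open>From Hopf monoids to group objects on words\<close>

definition typed_hom :: "('o, 'm) hopf_data \<Rightarrow> ('o, 'm) hopf_data \<Rightarrow> 'm \<Rightarrow> ('o, 'm) tarr" where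
  "typed_hom H K f = Arr (gob (of_hopf H)) f (gob (of_hopf K))"

lemma tob_gob_of_hopf [simp]: "tob (gob (of_hopf H)) = carr H"
  by (simp add: of_hopf_def Let_def)

lemma raw_typed_hom [simp]: "raw (typed_hom H K f) = f"
  by (simp add: typed_hom_def)

lemma gmor_typed_hom:
  "\<lbrakk>f \<in> Hom (Hopf_coc M) H K; H \<in> Ob (Hopf_coc M); K \<in> Ob (Hopf_coc M)\<rbrakk> \<Longrightarrow> gmor (of_hopf H) (of_hopf K) (typed_hom H K f)"
  unfolding typed_hom_def by (rule gmor_of_hopf)

lemma typed_hom_comp:
  assumes "f \<in> Hom (Hopf_coc M) H K" "g \<in> Hom (Hopf_coc M) K L"
    "H \<in> Ob (Hopf_coc M)" "K \<in> Ob (Hopf_coc M)" "L \<in> Ob (Hopf_coc M)"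
  shows "typed_hom K L g \<bullet> typed_hom H K f = typed_hom H L (g \<cdot> f)"
  using cmor_ty[OF gmor_cmor[OF gmor_typed_hom[of f H K]]] cmor_ty[OF gmor_cmor[OF gmor_typed_hom[of g K L]]] assms
  by (simp add: tcomp_def) (simp add: typed_hom_def)

lemma typed_hom_Id: "typed_hom H H (Id M (carr H)) = idt (gob (of_hopf H))"
  by (simp add: typed_hom_def idt_def)

lemma gmor_comp_raw: "\<lbrakk>gmor G H y; gmor H K x\<rbrakk> \<Longrightarrow> raw (x \<bullet> y) = raw x \<cdot> raw y"
  by (intro raw_simps) (auto simp: gmor_def cmor_def ty_def)

lemma gmor_eqI: "\<lbrakk>gmor G H x; gmor G H y; raw x = raw y\<rbrakk> \<Longrightarrow> x = y"
  by (rule arr_eqI) (auto simp: gmor_def cmor_def ty_def)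

text \<open>The pullback property for group objects X on arbitrary words; it will be applied to the
  kernels of \<open>grp_kernel\<close>, for which no particular word is prescribed.\<close>

lemma pullback_grp:
  assumes pb: "is_pullback (Hopf_coc M) E A B h p P r q"
    and ob: "E \<in> Ob (Hopf_coc M)" "A \<in> Ob (Hopf_coc M)" "B \<in> Ob (Hopf_coc M)"
    and h: "h \<in> Hom (Hopf_coc M) E B" and p: "p \<in> Hom (Hopf_coc M) A B"
    and X: "grp X" and u: "gmor X (of_hopf E) u" and v: "gmor X (of_hopf A) v"
    and eq: "typed_hom E B h \<bullet> u = typed_hom A B p \<bullet> v"
  shows "\<exists>!w. gmor X (of_hopf P) w \<and> typed_hom P E r \<bullet> w = u \<and> typed_hom P A q \<bullet> w = v"
proof -
  have P: "P \<in> Ob (Hopf_coc M)" and r: "r \<in> Hom (Hopf_coc M) P E" and q: "q \<in> Hom (Hopf_coc M) P A"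
    and univ: "\<And>X u v. \<lbrakk>X \<in> Ob (Hopf_coc M); u \<in> Hom (Hopf_coc M) X E; v \<in> Hom (Hopf_coc M) X A; h \<cdot> u = p \<cdot> v\<rbrakk>
      \<Longrightarrow> \<exists>!w. w \<in> Hom (Hopf_coc M) X P \<and> r \<cdot> w = u \<and> q \<cdot> w = v"
    using pb unfolding is_pullback_def by simp_all
  note G = grp_of_hopf[OF ob(1)] grp_of_hopf[OF ob(2)] grp_of_hopf[OF P]
  have "h \<cdot> raw u = p \<cdot> raw v"
    using gmor_comp_raw[OF u gmor_typed_hom[OF h ob(1,3)]] gmor_comp_raw[OF v gmor_typed_hom[OF p ob(2,3)]] eq by simp
  then have ex: "\<exists>!w. w \<in> Hom (Hopf_coc M) (to_hopf X) P \<and> r \<cdot> w = raw u \<and> q \<cdot> w = raw v"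
    using univ[OF to_hopf_Ob[OF X]] gmor_raw[OF u X G(1)] gmor_raw[OF v X G(2)] by simp
  then obtain w where w: "w \<in> Hom (Hopf_coc M) (to_hopf X) P" "r \<cdot> w = raw u" "q \<cdot> w = raw v" by blast
  define z where "z = Arr (gob X) w (gob (of_hopf P))"
  have z: "gmor X (of_hopf P) z" using gmor_iff[OF X G(3), of w] w by (simp add: z_def)
  have rz: "raw z = w" by (simp add: z_def)
  have r': "gmor (of_hopf P) (of_hopf E) (typed_hom P E r)" and q': "gmor (of_hopf P) (of_hopf A) (typed_hom P A q)"
    using gmor_typed_hom r q P ob by auto
  show ?thesis
  proof (intro ex1I conjI)
    show "gmor X (of_hopf P) z" by (rule z)
    show "typed_hom P E r \<bullet> z = u"
      by (rule gmor_eqI[OF gmor_comp[OF z r'] u]) (simp add: gmor_comp_raw[OF z r'] rz w)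
    show "typed_hom P A q \<bullet> z = v"
      by (rule gmor_eqI[OF gmor_comp[OF z q'] v]) (simp add: gmor_comp_raw[OF z q'] rz w)
    fix y assume y: "gmor X (of_hopf P) y \<and> typed_hom P E r \<bullet> y = u \<and> typed_hom P A q \<bullet> y = v"
    then have "raw y \<in> Hom (Hopf_coc M) (to_hopf X) P" using gmor_raw[of X "of_hopf P" y] X G by simp
    moreover have "r \<cdot> raw y = raw u" "q \<cdot> raw y = raw v"
      using y gmor_comp_raw[OF _ r', of X y] gmor_comp_raw[OF _ q', of X y] by auto
    ultimately have "raw y = w" using ex w by blast
    then show "y = z" using gmor_eqI[of X "of_hopf P" y z] y z rz by simp
  qed
qed

lemma change_of_base_conservative:
  assumes ob: "E \<in> Ob (Hopf_coc M)" "B \<in> Ob (Hopf_coc M)" and h: "h \<in> Hom (Hopf_coc M) E B"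
  shows "change_of_base_reflects_isos (Hopf_coc M) E B h"
  unfolding change_of_base_reflects_isos_def
proof (intro allI impI)
  fix x x' q y y' q' f f'
  assume cb: "change_of_base_arr (Hopf_coc M) E B h x x' q y y' q' f f'"
    and iso: "is_iso (pts (Hopf_coc M) E) x' y' f'"
  obtain A p s P r t A' p' s' P' r' t' where xy: "x = (A, p, s)" "x' = (P, r, t)" "y = (A', p', s')" "y' = (P', r', t')"
    by (metis prod_cases3)
  let ?H = "Hom (Hopf_coc M)" and ?O = "Ob (Hopf_coc M)"
  note defs = change_of_base_arr_def change_of_base_ob_def pts_def
  have O: "A \<in> ?O" "A' \<in> ?O" "P \<in> ?O" "P' \<in> ?O"
    and H: "p \<in> ?H A B" "s \<in> ?H B A" "p' \<in> ?H A' B" "s' \<in> ?H B A'" "r \<in> ?H P E" "r' \<in> ?H P' E"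
      "f \<in> ?H A A'" "f' \<in> ?H P P'"
    and Q: "p' \<cdot> s' = Id M (carr B)" "p' \<cdot> f = p" "f \<cdot> s = s'" "r' \<cdot> f' = r" "q' \<cdot> f' = f \<cdot> q"
    and pb: "is_pullback (Hopf_coc M) E A B h p P r q" and pb': "is_pullback (Hopf_coc M) E A' B h p' P' r' q'"
    using cb by (auto simp: defs xy)
  have q: "q \<in> ?H P A" and q': "q' \<in> ?H P' A'"
    using pb pb' by (simp_all add: is_pullback_def)
  obtain g' where g': "g' \<in> ?H P' P" and gf': "g' \<cdot> f' = Id M (carr P)" and fg': "f' \<cdot> g' = Id M (carr P')"
    using iso by (auto simp: is_iso_def inverse_arrows_def pts_def xy)
  note O' = O ob
  note G = O'[THEN grp_of_hopf]
  have ex: "\<exists>w. gmor X (of_hopf P) w \<and> typed_hom P E r \<bullet> w = u \<and> typed_hom P A q \<bullet> w = v"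
    if "grp X" "gmor X (of_hopf E) u" "gmor X (of_hopf A) v" "typed_hom E B h \<bullet> u = typed_hom A B p \<bullet> v" for X u v
    using pullback_grp[OF pb ob(1) O(1) ob(2) h H(1) that] by blast
  have ex': "\<exists>!w. gmor X (of_hopf P') w \<and> typed_hom P' E r' \<bullet> w = u \<and> typed_hom P' A' q' \<bullet> w = v"
    if "grp X" "gmor X (of_hopf E) u" "gmor X (of_hopf A') v" "typed_hom E B h \<bullet> u = typed_hom A' B p' \<bullet> v" for X u v
    using pullback_grp[OF pb' ob(1) O(2) ob(2) h H(3) that] .
  have hr': "h \<cdot> r' = p' \<cdot> q'" using pb' by (simp add: is_pullback_def)
  have un': "w = w'" if X: "grp X" and w: "gmor X (of_hopf P') w" and w': "gmor X (of_hopf P') w'"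
    and e: "typed_hom P' E r' \<bullet> w = typed_hom P' E r' \<bullet> w'" "typed_hom P' A' q' \<bullet> w = typed_hom P' A' q' \<bullet> w'" for X w w'
  proof -
    \<comment> \<open>The components of w form a cone because h r' = p' q', so the uniqueness part
      of the pullback property applies to w and w'.\<close>
    have "typed_hom E B h \<bullet> typed_hom P' E r' \<bullet> w = typed_hom A' B p' \<bullet> typed_hom P' A' q' \<bullet> w"
      using typed_hom_comp[OF H(6) h] typed_hom_comp[OF q' H(3)] O' hr' by (simp flip: tcomp_assoc)
    then have "\<exists>!z. gmor X (of_hopf P') z \<and> typed_hom P' E r' \<bullet> z = typed_hom P' E r' \<bullet> w \<and> typed_hom P' A' q' \<bullet> z = typed_hom P' A' q' \<bullet> w"
      by (intro ex' X gmor_comp[OF w] gmor_typed_hom H q' O ob)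
    then show ?thesis using w w' e by metis
  qed
  obtain g where g: "gmor (of_hopf A') (of_hopf A) g" and fg: "typed_hom A A' f \<bullet> g = idt (gob (of_hopf A'))"
    and gf: "g \<bullet> typed_hom A A' f = idt (gob (of_hopf A))"
  proof (rule point_morphism_iso[of "of_hopf A" "of_hopf A'" "of_hopf B" "of_hopf E" "of_hopf P" "of_hopf P'"
      "typed_hom A B p" "typed_hom B A s" "typed_hom A' B p'" "typed_hom B A' s'" "typed_hom A A' f" "typed_hom E B h" "typed_hom P E r" "typed_hom P A q"
      "typed_hom P' E r'" "typed_hom P' A' q'" "typed_hom P P' f'" "typed_hom P' P g'"])
    show "\<exists>w. gmor X (of_hopf P) w \<and> typed_hom P E r \<bullet> w = u \<and> typed_hom P A q \<bullet> w = v"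
      if "grp X" "gmor X (of_hopf E) u" "gmor X (of_hopf A) v" "typed_hom E B h \<bullet> u = typed_hom A B p \<bullet> v" for X u v
      using ex[OF that] .
    show "\<exists>w. gmor X (of_hopf P') w \<and> typed_hom P' E r' \<bullet> w = u \<and> typed_hom P' A' q' \<bullet> w = v"
      if "grp X" "gmor X (of_hopf E) u" "gmor X (of_hopf A') v" "typed_hom E B h \<bullet> u = typed_hom A' B p' \<bullet> v" for X u v
      using ex'[OF that] by blast
    show "w = w'" if "grp X" "gmor X (of_hopf P') w" "gmor X (of_hopf P') w'"
      "typed_hom P' E r' \<bullet> w = typed_hom P' E r' \<bullet> w'" "typed_hom P' A' q' \<bullet> w = typed_hom P' A' q' \<bullet> w'" for X w w'
      using un'[OF that] .
  qed (use G H Q O' q q' g' gf' fg' h in \<open>simp_all only: gmor_typed_hom typed_hom_comp typed_hom_Id\<close>)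
  have g2: "raw g \<in> ?H A' A" using gmor_raw[OF g G(2) G(1)] by simp
  have f2: "gmor (of_hopf A) (of_hopf A') (typed_hom A A' f)" by (rule gmor_typed_hom) (use H O in auto)
  have fg2: "f \<cdot> raw g = Id M (carr A')"
    using gmor_comp_raw[OF g f2] fg by (simp add: raw_simps)
  have gf2: "raw g \<cdot> f = Id M (carr A)"
    using gmor_comp_raw[OF f2 g] gf by (simp add: raw_simps)
  interpret Hc: category "Hopf_coc M" by (rule category_Hopf_coc)
  \<comment> \<open>An inverse of f automatically commutes with sections and projections: g s' = g f
    s = s and p g = p' f g = p'.\<close>
  have "raw g \<cdot> s' = s"
    using Hc.Comp_assoc[OF ob(2) O(1) O(2) O(1) H(2) H(7) g2] Hc.Id_Comp[OF ob(2) O(1) H(2)]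
    by (simp add: gf2 Q(3))
  moreover have "p \<cdot> raw g = p'"
    using Hc.Comp_assoc[OF O(2) O(1) O(2) ob(2) g2 H(7) H(3)] Hc.Comp_Id[OF O(2) ob(2) H(3)]
    by (simp add: fg2 Q(2))
  ultimately have "inverse_arrows (pts (Hopf_coc M) B) x y f (raw g)"
    using H(7) g2 Q fg2 gf2 by (simp add: inverse_arrows_def pts_def xy)
  then show "is_iso (pts (Hopf_coc M) B) x y f" by (auto simp: is_iso_def)
qed

theorem protomodular_Hopf_coc: "protomodular (Hopf_coc M)"
  unfolding protomodular_def using finitely_complete_Hopf_coc change_of_base_conservative by blast

end

section \<open>Abelian categories\<close>

context preadditive_category
begin

abbreviation zero_arr :: "'o \<Rightarrow> 'o \<Rightarrow> 'm" where "zero_arr A B \<equiv> \<one>\<^bsub>G A B\<^esub>"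

definition diff :: "'o \<Rightarrow> 'o \<Rightarrow> 'm \<Rightarrow> 'm \<Rightarrow> 'm" where
  "diff A B f g = f \<otimes>\<^bsub>G A B\<^esub> inv\<^bsub>G A B\<^esub> g"

lemma grp_G: "\<lbrakk>A \<in> Ob C; B \<in> Ob C\<rbrakk> \<Longrightarrow> group (G A B)"
  using hom_group comm_group.axioms(2) by blast

lemma zero_in_Hom: "\<lbrakk>A \<in> Ob C; B \<in> Ob C\<rbrakk> \<Longrightarrow> zero_arr A B \<in> Hom C A B"
  using monoid.one_closed[OF group.is_monoid[OF grp_G]] hom_group_carrier by blast

lemma diff_in_Hom:
  assumes "A \<in> Ob C" "B \<in> Ob C" "f \<in> Hom C A B" "g \<in> Hom C A B"
  shows "diff A B f g \<in> Hom C A B"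
proof -
  interpret H: group "G A B" using grp_G assms by blast
  show ?thesis using assms hom_group_carrier[of A B] H.m_closed H.inv_closed unfolding diff_def by auto
qed

lemma diff_eq_zero_iff:
  assumes "A \<in> Ob C" "B \<in> Ob C" "f \<in> Hom C A B" "g \<in> Hom C A B"
  shows "diff A B f g = zero_arr A B \<longleftrightarrow> f = g"
proof -
  interpret H: group "G A B" using grp_G assms by blast
  have fg: "f \<in> carrier (G A B)" "g \<in> carrier (G A B)" using assms hom_group_carrier by auto
  then have "f = g" if "f \<otimes>\<^bsub>G A B\<^esub> inv\<^bsub>G A B\<^esub> g = \<one>\<^bsub>G A B\<^esub>"
    using that H.inv_equality[of f "inv\<^bsub>G A B\<^esub> g"] H.inv_inv[of g] by simp
  then show ?thesis using fg by (auto simp: diff_def)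
qed

lemma zero_Comp: "\<lbrakk>A \<in> Ob C; B \<in> Ob C; D \<in> Ob C; f \<in> Hom C A B\<rbrakk> \<Longrightarrow> zero_arr B D \<cdot> f = zero_arr A D"
  using hom_one[OF Comp_additive_left grp_G grp_G] by blast

lemma Comp_zero: "\<lbrakk>A \<in> Ob C; B \<in> Ob C; D \<in> Ob C; g \<in> Hom C B D\<rbrakk> \<Longrightarrow> g \<cdot> zero_arr A B = zero_arr A D"
  using hom_one[OF Comp_additive_right grp_G grp_G] by blast

lemma hom_diff:
  assumes "A \<in> Ob C" "B \<in> Ob C" "f \<in> Hom C A B" "g \<in> Hom C A B" "F \<in> hom (G A B) H" "group H"
  shows "F (diff A B f g) = F f \<otimes>\<^bsub>H\<^esub> inv\<^bsub>H\<^esub> F g"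
proof -
  interpret h: group_hom "G A B" H F
    using assms grp_G by (simp add: group_hom_def group_hom_axioms_def)
  have fg: "f \<in> carrier (G A B)" "g \<in> carrier (G A B)" using assms hom_group_carrier by auto
  then show ?thesis
    using h.hom_mult[OF fg(1) h.G.inv_closed[OF fg(2)]] h.hom_inv[OF fg(2)] by (simp only: diff_def)
qed

lemma diff_Comp:
  assumes "A \<in> Ob C" "B \<in> Ob C" "D \<in> Ob C" "f \<in> Hom C B D" "g \<in> Hom C B D" "u \<in> Hom C A B"
  shows "diff B D f g \<cdot> u = diff A D (f \<cdot> u) (g \<cdot> u)"
  using hom_diff[OF assms(2-5) Comp_additive_left[OF assms(1-3,6)] grp_G[OF assms(1,3)]] by (simp add: diff_def)

lemma Comp_diff:
  assumes "A \<in> Ob C" "B \<in> Ob C" "D \<in> Ob C" "f \<in> Hom C A B" "g \<in> Hom C A B" "h \<in> Hom C B D"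
  shows "h \<cdot> diff A B f g = diff A D (h \<cdot> f) (h \<cdot> g)"
  using hom_diff[OF assms(1,2,4,5) Comp_additive_right[OF assms(1-3,6)] grp_G[OF assms(1,3)]] by (simp add: diff_def)

text \<open>Composition is additive, so an arrow is killed by the difference of f and g iff it
  equalizes them.\<close>

lemma equalizer_iff_kernel:
  assumes A: "A \<in> Ob C" and B: "B \<in> Ob C" and f: "f \<in> Hom C A B" and g: "g \<in> Hom C A B"
  shows "is_equalizer C A B f g E e \<longleftrightarrow> is_kernel C G A B (diff A B f g) E e"
proof -
  have *: "diff A B f g \<cdot> u = zero_arr X B \<longleftrightarrow> f \<cdot> u = g \<cdot> u" if X: "X \<in> Ob C" and u: "u \<in> Hom C X A" for X u
    using diff_Comp[OF X A B f g u] diff_eq_zero_iff[OF X B] Comp_in_Hom[OF X A B u] f g by simp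
  show ?thesis
    unfolding is_equalizer_def is_kernel_def using diff_in_Hom[OF A B f g] * by auto
qed

end

section \<open>Coimages and exact functors\<close>

context abelian_category
begin

lemma cokernel_epi:
  assumes "is_cokernel C G A B f Q q" "A \<in> Ob C" "B \<in> Ob C"
  shows "is_epi C B Q q"
  unfolding is_epi_def
proof (intro conjI ballI impI)
  show "q \<in> Hom C B Q" using assms by (simp add: is_cokernel_def)
  fix X u v assume X: "X \<in> Ob C" and u: "u \<in> Hom C Q X" and v: "v \<in> Hom C Q X" and eq: "u \<cdot> q = v \<cdot> q"
  have Q: "Q \<in> Ob C" "q \<in> Hom C B Q" "f \<in> Hom C A B" and qf: "q \<cdot> f = zero_arr A Q"
    and univ: "\<And>w. \<lbrakk>w \<in> Hom C B X; w \<cdot> f = zero_arr A X\<rbrakk> \<Longrightarrow> \<exists>!v. v \<in> Hom C Q X \<and> v \<cdot> q = w"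
    using assms X by (auto simp: is_cokernel_def)
  have "(u \<cdot> q) \<cdot> f = zero_arr A X"
    using Comp_assoc[OF assms(2,3) Q(1) X Q(3,2) u] Comp_zero[OF assms(2) Q(1) X u] qf by simp
  then show "u = v"
    using univ[of "u \<cdot> q"] Comp_in_Hom[OF assms(3) Q(1) X Q(2) u] u v eq by metis
qed

text \<open>The arrow f factors through the cokernel q of its kernel k, so whatever q kills is
  killed by f and lifts to k. This turns a kernel into a short exact sequence, which is what an
  exact functor is assumed to preserve.\<close>

lemma kernel_of_cokernel:
  assumes k: "is_kernel C G A B f K k" and q: "is_cokernel C G K A k Q q" and A: "A \<in> Ob C" and B: "B \<in> Ob C"
  shows "short_exact C G K A Q k q"
proof -
  have K: "K \<in> Ob C" "k \<in> Hom C K A" "f \<in> Hom C A B" "f \<cdot> k = zero_arr K B" using k by (auto simp: is_kernel_def)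
  have Q: "Q \<in> Ob C" "q \<in> Hom C A Q" "q \<cdot> k = zero_arr K Q" using q by (auto simp: is_cokernel_def)
  obtain m where m: "m \<in> Hom C Q B" "m \<cdot> q = f"
    using q B K unfolding is_cokernel_def by blast
  have "f \<cdot> u = zero_arr X B" if X: "X \<in> Ob C" and u: "u \<in> Hom C X A" "q \<cdot> u = zero_arr X Q" for X u
    using Comp_assoc[OF X A Q(1) B u(1) Q(2) m(1)] Comp_zero[OF X Q(1) B m(1)] u m by simp
  then have "is_kernel C G A Q q K k"
    using k K Q unfolding is_kernel_def by blast
  then show ?thesis using q by (simp add: short_exact_def)
qed

text \<open>It suffices that m w = 0 forces w = 0. Such an m factors through the cokernel c of w,
  hence f factors through the epimorphism c q. The aim is a retraction t of c, for then w = t c w =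
  0.\<close>

lemma coimage_mono:
  assumes A: "A \<in> Ob C" and B: "B \<in> Ob C" and k: "is_kernel C G A B f K k" and q: "is_cokernel C G K A k Q q"
    and m: "m \<in> Hom C Q B" and mq: "m \<cdot> q = f"
  shows "is_mono C Q B m"
  unfolding is_mono_def
proof (intro conjI ballI impI)
  show "m \<in> Hom C Q B" by (rule m)
  fix X u v assume X: "X \<in> Ob C" and u: "u \<in> Hom C X Q" and v: "v \<in> Hom C X Q" and eq: "m \<cdot> u = m \<cdot> v"
  have K: "K \<in> Ob C" "k \<in> Hom C K A" "f \<in> Hom C A B" using k by (auto simp: is_kernel_def)
  have Q: "Q \<in> Ob C" "q \<in> Hom C A Q" "q \<cdot> k = zero_arr K Q" using q by (auto simp: is_cokernel_def)
  define w where "w = diff X Q u v"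
  have w: "w \<in> Hom C X Q" unfolding w_def by (rule diff_in_Hom[OF X Q(1) u v])
  have "m \<cdot> u \<in> Hom C X B" by (rule Comp_in_Hom[OF X Q(1) B u m])
  then have mw: "m \<cdot> w = zero_arr X B"
    using Comp_diff[OF X Q(1) B u v m] diff_eq_zero_iff[OF X B] eq by (simp add: w_def)
  obtain R c where c: "is_cokernel C G X Q w R c" using cokernels[OF X Q(1) w] by blast
  then have R: "R \<in> Ob C" "c \<in> Hom C Q R" "c \<cdot> w = zero_arr X R" by (auto simp: is_cokernel_def)
  obtain m' where m': "m' \<in> Hom C R B" "m' \<cdot> c = m"
    using c B m mw unfolding is_cokernel_def by blast
  have cq: "c \<cdot> q \<in> Hom C A R" by (rule Comp_in_Hom[OF A Q(1) R(1) Q(2) R(2)])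
  have "is_epi C A R (c \<cdot> q)"
    unfolding is_epi_def
  proof (intro conjI ballI impI cq)
    fix Y a b assume Y: "Y \<in> Ob C" and a: "a \<in> Hom C R Y" and b: "b \<in> Hom C R Y" and ab: "a \<cdot> (c \<cdot> q) = b \<cdot> (c \<cdot> q)"
    have "(a \<cdot> c) \<cdot> q = (b \<cdot> c) \<cdot> q"
      using Comp_assoc[OF A Q(1) R(1) Y Q(2) R(2)] a b ab by simp
    then have "a \<cdot> c = b \<cdot> c"
      using cokernel_epi[OF q K(1) A] Y Comp_in_Hom[OF Q(1) R(1) Y R(2)] a b unfolding is_epi_def by blast
    then show "a = b"
      using cokernel_epi[OF c X Q(1)] Y a b unfolding is_epi_def by blast
  qed
  \<comment> \<open>Normality makes c q the cokernel of some g. As f factors through c q, it kills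
    g, so g lifts to the kernel k of f and q g = 0; hence q factors through c q, and the factor t
    satisfies t c = 1 because q is epi.\<close>
  then obtain D g where D: "D \<in> Ob C" and g: "is_cokernel C G D A g R (c \<cdot> q)"
    using epi_normal[OF A R(1)] by blast
  then have gH: "g \<in> Hom C D A" and g0: "(c \<cdot> q) \<cdot> g = zero_arr D R" by (auto simp: is_cokernel_def)
  have f: "f = m' \<cdot> (c \<cdot> q)"
    using Comp_assoc[OF A Q(1) R(1) B Q(2) R(2) m'(1)] m' mq by simp
  have "f \<cdot> g = zero_arr D B"
    using Comp_assoc[OF D A R(1) B gH cq m'(1)] Comp_zero[OF D R(1) B m'(1)] g0 by (simp add: f)
  then obtain g' where g': "g' \<in> Hom C D K" "k \<cdot> g' = g"
    using k D gH unfolding is_kernel_def by blast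
  have "q \<cdot> g = zero_arr D Q"
    using Comp_assoc[OF D K(1) A Q(1) g'(1) K(2) Q(2)] zero_Comp[OF D K(1) Q(1) g'(1)] g' Q by simp
  then obtain t where t: "t \<in> Hom C R Q" "t \<cdot> (c \<cdot> q) = q"
    using g Q unfolding is_cokernel_def by blast
  have "(t \<cdot> c) \<cdot> q = Id C Q \<cdot> q"
    using Comp_assoc[OF A Q(1) R(1) Q(1) Q(2) R(2) t(1)] Id_Comp[OF A Q(1,2)] t by simp
  then have tc: "t \<cdot> c = Id C Q"
    using cokernel_epi[OF q K(1) A] Q(1) Comp_in_Hom[OF Q(1) R(1) Q(1) R(2) t(1)] Id_in_Hom[OF Q(1)]
    unfolding is_epi_def by blast
  have "w = (t \<cdot> c) \<cdot> w" using Id_Comp[OF X Q(1) w] tc by simp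
  also have "\<dots> = zero_arr X Q"
    using Comp_assoc[OF X Q(1) R(1) Q(1) w R(2) t(1)] Comp_zero[OF X R(1) Q(1) t(1)] R by simp
  finally show "u = v"
    using diff_eq_zero_iff[OF X Q(1) u v] by (simp add: w_def)
qed

lemma has_equalizers: "has_equalizers C"
  unfolding has_equalizers_def
proof (intro ballI)
  fix A B f g assume H: "A \<in> Ob C" "B \<in> Ob C" "f \<in> Hom C A B" "g \<in> Hom C A B"
  then show "\<exists>E e. is_equalizer C A B f g E e"
    using kernels[OF H(1,2) diff_in_Hom[OF H]] by (simp add: equalizer_iff_kernel)
qed

lemma exact_functor_preserves_equalizers:
  assumes D: "preadditive_category D G'"
    and add: "additive_functor C G D G' Fo Fa" and ex: "exact_functor C G D G' Fo Fa"
  shows "preserves_equalizers C D Fo Fa"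
  unfolding preserves_equalizers_def
proof (intro ballI allI impI)
  fix A B f g E e
  assume A: "A \<in> Ob C" and B: "B \<in> Ob C" and f: "f \<in> Hom C A B" and g: "g \<in> Hom C A B"
    and E: "is_equalizer C A B f g E e"
  interpret D: preadditive_category D G' by (rule D)
  define d where "d = diff A B f g"
  have d: "d \<in> Hom C A B" unfolding d_def by (rule diff_in_Hom[OF A B f g])
  have k: "is_kernel C G A B d E e" using E equalizer_iff_kernel[OF A B f g] by (simp add: d_def)
  then have e: "E \<in> Ob C" "e \<in> Hom C E A" "d \<cdot> e = zero_arr E B" by (auto simp: is_kernel_def)
  obtain Q q where q: "is_cokernel C G E A e Q q" using cokernels[OF e(1) A e(2)] by blast
  then have Q: "Q \<in> Ob C" "q \<in> Hom C A Q" by (auto simp: is_cokernel_def)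
  obtain m where m: "m \<in> Hom C Q B" "m \<cdot> q = d"
    using q B d e unfolding is_cokernel_def by blast
  have "is_mono C Q B m" by (rule coimage_mono[OF A B k q m])
  \<comment> \<open>As a monomorphism, m is the kernel of some z and hence, by
    \<open>kernel_of_cokernel\<close>, also of its own cokernel r.\<close>
  then obtain Z z where Z: "Z \<in> Ob C" and z: "is_kernel C G B Z z Q m" using mono_normal[OF Q(1) B] by blast
  obtain R r where r: "is_cokernel C G Q B m R r" using cokernels[OF Q(1) B m(1)] by blast
  then have R: "R \<in> Ob C" "r \<in> Hom C B R" by (auto simp: is_cokernel_def)
  have F: "is_functor C D Fo Fa" using ex by (simp add: exact_functor_def)
  have FO: "\<And>A. A \<in> Ob C \<Longrightarrow> Fo A \<in> Ob D"
    and FH: "\<And>A B f. \<lbrakk>A \<in> Ob C; B \<in> Ob C; f \<in> Hom C A B\<rbrakk> \<Longrightarrow> Fa f \<in> Hom D (Fo A) (Fo B)"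
    and FC: "\<And>A B E f g. \<lbrakk>A \<in> Ob C; B \<in> Ob C; E \<in> Ob C; f \<in> Hom C A B; g \<in> Hom C B E\<rbrakk> \<Longrightarrow> Fa (g \<cdot> f) = Fa g \<cdot>\<^bsub>D\<^esub> Fa f"
    using F by (auto simp: is_functor_def)
  have ex': "short_exact D G' (Fo X) (Fo Y) (Fo Z) (Fa a) (Fa b)"
    if "short_exact C G X Y Z a b" "X \<in> Ob C" "Y \<in> Ob C" "Z \<in> Ob C" for X Y Z a b
    using ex that by (auto simp: exact_functor_def)
  have k1: "is_kernel D G' (Fo A) (Fo Q) (Fa q) (Fo E) (Fa e)"
    using ex'[OF kernel_of_cokernel[OF k q A B] e(1) A Q(1)] by (simp add: short_exact_def)
  have k2: "is_kernel D G' (Fo B) (Fo R) (Fa r) (Fo Q) (Fa m)"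
    using ex'[OF kernel_of_cokernel[OF z r B Z] Q(1) B R(1)] by (simp add: short_exact_def)
  note o = FO[OF A] FO[OF B] FO[OF Q(1)] FO[OF e(1)] FO[OF R(1)]
  note a = FH[OF A Q] FH[OF Q(1) B m(1)] FH[OF e(1) A e(2)] FH[OF B R]
  have Fd: "Fa d = Fa m \<cdot>\<^bsub>D\<^esub> Fa q" using FC[OF A Q(1) B Q(2) m(1)] m by simp
  have zero: "Fa q \<cdot>\<^bsub>D\<^esub> u = \<one>\<^bsub>G' X (Fo Q)\<^esub>"
    if X: "X \<in> Ob D" and u: "u \<in> Hom D X (Fo A)" and du: "Fa d \<cdot>\<^bsub>D\<^esub> u = \<one>\<^bsub>G' X (Fo B)\<^esub>" for X u
  proof -
    have qu: "Fa q \<cdot>\<^bsub>D\<^esub> u \<in> Hom D X (Fo Q)" by (rule D.Comp_in_Hom[OF X o(1,3) u a(1)])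
    have 1: "Fa m \<cdot>\<^bsub>D\<^esub> (Fa q \<cdot>\<^bsub>D\<^esub> u) = \<one>\<^bsub>G' X (Fo B)\<^esub>"
      using D.Comp_assoc[OF X o(1,3,2) u a(1,2)] du by (simp add: Fd)
    have 2: "Fa m \<cdot>\<^bsub>D\<^esub> \<one>\<^bsub>G' X (Fo Q)\<^esub> = \<one>\<^bsub>G' X (Fo B)\<^esub>"
      by (rule D.Comp_zero[OF X o(3,2) a(2)])
    have "Fa r \<cdot>\<^bsub>D\<^esub> \<one>\<^bsub>G' X (Fo B)\<^esub> = \<one>\<^bsub>G' X (Fo R)\<^esub>"
      by (rule D.Comp_zero[OF X o(2,5) a(4)])
    then have "\<exists>!v. v \<in> Hom D X (Fo Q) \<and> Fa m \<cdot>\<^bsub>D\<^esub> v = \<one>\<^bsub>G' X (Fo B)\<^esub>"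
      using k2 X D.zero_in_Hom[OF X o(2)] unfolding is_kernel_def by blast
    then show ?thesis using qu 1 2 D.zero_in_Hom[OF X o(3)] by blast
  qed
  have "Fa d \<cdot>\<^bsub>D\<^esub> Fa e = \<one>\<^bsub>G' (Fo E) (Fo B)\<^esub>"
    using D.Comp_assoc[OF o(4,1,3,2) a(3,1,2)] D.Comp_zero[OF o(4,3,2) a(2)] k1 by (simp add: Fd is_kernel_def)
  then have kd: "is_kernel D G' (Fo A) (Fo B) (Fa d) (Fo E) (Fa e)"
    using k1 zero FH[OF A B d] unfolding is_kernel_def by blast
  \<comment> \<open>Additivity turns the image of d back into the difference of the images of f and
    g, so the kernel is again an equalizer.\<close>
  have "Fa \<in> hom (G A B) (G' (Fo A) (Fo B))" using add A B by (simp add: additive_functor_def)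
  then have "Fa d = D.diff (Fo A) (Fo B) (Fa f) (Fa g)"
    using hom_diff[OF A B f g _ D.grp_G[OF o(1,2)]] by (simp add: d_def D.diff_def)
  then show "is_equalizer D (Fo A) (Fo B) (Fa f) (Fa g) (Fo E) (Fa e)"
    using D.equalizer_iff_kernel[OF o(1,2) FH[OF A B f] FH[OF A B g]] kd by simp
qed

end

context abelian_symmetric_monoidal_category
begin

sublocale equalizer_monoidal_category M
proof
  show "has_equalizers M" by (rule has_equalizers)
  show "tensor_preserves_equalizers M"
    unfolding tensor_preserves_equalizers_def
    using exact_functor_preserves_equalizers[OF preadditive_category_axioms]
      ltensor_additive rtensor_additive ltensor_exact rtensor_exact by blast
qed

end

theorem proposition3p11:
  fixes M :: "('o, 'm) moncat"
  shows  "(symmetric_monoidal_category M \<and> has_equalizers M \<and> tensor_preserves_equalizers M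
            \<longrightarrow> protomodular (Hopf_coc M))
       \<and> (\<forall>G. abelian_symmetric_monoidal_category M G \<longrightarrow> protomodular (Hopf_coc M))"
proof (intro conjI allI impI)
  assume "symmetric_monoidal_category M \<and> has_equalizers M \<and> tensor_preserves_equalizers M"
  then interpret equalizer_monoidal_category M
    by (simp add: equalizer_monoidal_category_def equalizer_monoidal_category_axioms_def)
  show "protomodular (Hopf_coc M)" by (rule protomodular_Hopf_coc)
next
  fix G assume "abelian_symmetric_monoidal_category M G"
  then interpret abelian_symmetric_monoidal_category M G .
  show "protomodular (Hopf_coc M)" by (rule protomodular_Hopf_coc)
qed

end
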